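(* Let $p\geq 5$ be a prime and let $G$ be a metabelian thin $p$-group, not of maximal class, whose nilpotency class $\operatorname{cl}(G)$ is $p$ or $p+1$. Then there are four cases in which there is a Beauville structure for $G$: (i) $\operatorname{cl}(G)=p$ and $|\gamma_p(G)|=p^2$; (ii) $\operatorname{cl}(G)=p+1$; (iii) $\operatorname{cl}(G)=p$, $|\gamma_p(G)|=p$ and $G^p=\gamma_{p-1}(G)$; (iv) $\operatorname{cl}(G)=p$, $|\gamma_p(G)|=p$, $G^p=\gamma_p(G)$ and $G$ has at least three maximal subgroups of exponent $p$.
   Context: Here $\gamma_i(G)$ denotes the $i$-th term of the lower central series ($\gamma_1(G)=G$). A non-cyclic finite $p$-group $G$ is thin if every normal subgroup of $G$ lies between two consecutive terms of the lower central series (i.e. for every normal subgroup $N$ there is $i$ with $\gamma_{i+1}(G)\le N\le \gamma_i(G)$) and $|\gamma_i(G):\gamma_{i+1}(G)|\le p^2$ for all $i\ge 1$. A group of order $p^n$, $n\ge 3$, is of maximal class if its nilpotency class is $n-1$. Metabelian means that the derived subgroup $G'$ is abelian. $G^p$ is the subgroup generated by all powers $g^p$, $g\in G$. The exponent of a group is the maximum of the orders of its elements. For a finite group $G$ and $x,y\in G$ put $\Sigma(x,y)=\bigcup_{g\in G}\big(\langle x\rangle^g\cup\langle y\rangle^g\cup\langle xy\rangle^g\big)$. A Beauville structure for a $2$-generator finite group $G$ is a pair of generating sets $\{x_1,y_1\}$, $\{x_2,y_2\}$ of $G$ with $\Sigma(x_1,y_1)\cap\Sigma(x_2,y_2)=1$.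 *)

theory Defs
  imports "HOL-Algebra.Algebra" "HOL-Computational_Algebra.Primes"
begin

text \<open>Indexing follows the convention that the first term is the whole group; the value at
  index 0 is a dummy.\<close>

fun lower_central :: "('a, 'b) monoid_scheme \<Rightarrow> nat \<Rightarrow> 'a set" where
  "lower_central G 0 = carrier G"
| "lower_central G (Suc 0) = carrier G"
| "lower_central G (Suc (Suc n)) =
     generate G (\<Union>x \<in> lower_central G (Suc n). \<Union>y \<in> carrier G.
       {x \<otimes>\<^bsub>G\<^esub> y \<otimes>\<^bsub>G\<^esub> inv\<^bsub>G\<^esub> x \<otimes>\<^bsub>G\<^esub> inv\<^bsub>G\<^esub> y})"

text \<open>Only meaningful for nilpotent groups, such as finite p-groups.\<close>

definition nilpotency_class :: "('a, 'b) monoid_scheme \<Rightarrow> nat" where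
  "nilpotency_class G = (LEAST c. lower_central G (Suc c) = {\<one>\<^bsub>G\<^esub>})"

definition finite_p_group :: "nat \<Rightarrow> ('a, 'b) monoid_scheme \<Rightarrow> bool" where
  "finite_p_group p G \<longleftrightarrow> Factorial_Ring.prime p \<and> group G \<and> finite (carrier G) \<and> (\<exists>n. order G = p ^ n)"

definition subgroup_index :: "('a, 'b) monoid_scheme \<Rightarrow> 'a set \<Rightarrow> 'a set \<Rightarrow> nat" where
  "subgroup_index G H K = card (rcosets\<^bsub>G\<lparr>carrier := H\<rparr>\<^esub> K)"

definition thin_p_group :: "nat \<Rightarrow> ('a, 'b) monoid_scheme \<Rightarrow> bool" where
  "thin_p_group p G \<longleftrightarrow>
     finite_p_group p G \<and> \<not> cyclic_group G \<and>
     (\<forall>N. N \<lhd> G \<longrightarrow>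
        (\<exists>i\<ge>1. lower_central G (i + 1) \<subseteq> N \<and> N \<subseteq> lower_central G i)) \<and>
     (\<forall>i\<ge>1. subgroup_index G (lower_central G i) (lower_central G (i + 1)) \<le> p\<^sup>2)"

definition maximal_class :: "nat \<Rightarrow> ('a, 'b) monoid_scheme \<Rightarrow> bool" where
  "maximal_class p G \<longleftrightarrow>
     finite_p_group p G \<and> (\<exists>n\<ge>3. order G = p ^ n \<and> nilpotency_class G = n - 1)"

definition metabelian :: "('a, 'b) monoid_scheme \<Rightarrow> bool" where
  "metabelian G \<longleftrightarrow> group G \<and> comm_group (G\<lparr>carrier := derived G (carrier G)\<rparr>)"

definition power_subgroup :: "('a, 'b) monoid_scheme \<Rightarrow> nat \<Rightarrow> 'a set" where
  "power_subgroup G n = generate G ((\<lambda>g. g [^]\<^bsub>G\<^esub> n) ` carrier G)"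

definition group_exponent :: "('a, 'b) monoid_scheme \<Rightarrow> nat" where
  "group_exponent G = Max (group.ord G ` carrier G)"

definition maximal_subgroup :: "'a set \<Rightarrow> ('a, 'b) monoid_scheme \<Rightarrow> bool" where
  "maximal_subgroup M G \<longleftrightarrow>
     subgroup M G \<and> M \<noteq> carrier G \<and>
     (\<forall>H. subgroup H G \<longrightarrow> M \<subseteq> H \<longrightarrow> H = M \<or> H = carrier G)"

definition conj_set :: "('a, 'b) monoid_scheme \<Rightarrow> 'a set \<Rightarrow> 'a \<Rightarrow> 'a set" where
  "conj_set G H g = (\<lambda>h. inv\<^bsub>G\<^esub> g \<otimes>\<^bsub>G\<^esub> h \<otimes>\<^bsub>G\<^esub> g) ` H"

definition beauville_Sigma :: "('a, 'b) monoid_scheme \<Rightarrow> 'a \<Rightarrow> 'a \<Rightarrow> 'a set" where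
  "beauville_Sigma G x y =
     (\<Union>g \<in> carrier G. conj_set G (generate G {x}) g \<union> conj_set G (generate G {y}) g
        \<union> conj_set G (generate G {x \<otimes>\<^bsub>G\<^esub> y}) g)"

definition beauville_structure ::
    "('a, 'b) monoid_scheme \<Rightarrow> 'a \<times> 'a \<Rightarrow> 'a \<times> 'a \<Rightarrow> bool" where
  "beauville_structure G = (\<lambda>(x\<^sub>1, y\<^sub>1) (x\<^sub>2, y\<^sub>2).
     group G \<and> finite (carrier G) \<and>
     {x\<^sub>1, y\<^sub>1, x\<^sub>2, y\<^sub>2} \<subseteq> carrier G \<and>
     generate G {x\<^sub>1, y\<^sub>1} = carrier G \<and> generate G {x\<^sub>2, y\<^sub>2} = carrier G \<and>
     beauville_Sigma G x\<^sub>1 y\<^sub>1 \<inter> beauville_Sigma G x\<^sub>2 y\<^sub>2 = {\<one>\<^bsub>G\<^esub>})"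

end

theory Submission
  imports Defs "HOL-Number_Theory.Number_Theory" "HOL-Computational_Algebra.Polynomial"
begin

text \<open>
  Let \<open>M\<close> be the derived subgroup. Since \<open>G\<close> is metabelian and generated by two elements \<open>x\<close>, \<open>y\<close>,
  the abelian group \<open>M\<close> is a cyclic module over the polynomial ring \<open>\<int>[a, b]\<close>, generated by the
  commutator \<open>c = [x, y]\<close>, where \<open>a\<close> and \<open>b\<close> act as conjugation by \<open>x\<close> and \<open>y\<close>; put \<open>U = a - 1\<close> and
  \<open>V = b - 1\<close>. Thinness forces the associated graded module to be a quotient of \<open>F\<^sub>p[U, V]\<close> by an
  irreducible quadratic form, which a change of generators turns into \<open>U\<^sup>2 - d V\<^sup>2\<close>. Hence each factor
  \<open>\<gamma>\<^sub>i / \<gamma>\<^sub>i\<^sub>+\<^sub>1\<close> with \<open>3 \<le> i\<close> strictly below the class is a copy of the field \<open>F\<^sub>p(\<surd>d)\<close>, and an element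
  \<open>g \<in> x\<^sup>s y\<^sup>t M\<close> outside \<open>M\<close> acts through \<open>g - 1\<close> as multiplication by \<open>z = t + s \<surd>d \<noteq> 0\<close>.

  As \<open>g\<close> commutes with \<open>g\<^sup>p\<close> and \<open>[g\<^sup>p, h] = (z\<^bsup>p-1\<^esup> + p) [g, h]\<close>, the power \<open>g\<^sup>p\<close> lies in the last but
  one term of the lower central series, in the kernel of \<open>g - 1\<close>. If the class is \<open>p\<close> and
  \<open>c\<^sup>p \<noteq> 1\<close>, no such \<open>g\<^sup>p\<close> lies in the last term; if the class is \<open>p + 1\<close>, this
  happens for at most two of the \<open>p + 1\<close> directions \<open>(s : t)\<close>, because \<open>z\<^bsup>p-1\<^esup> = (t - s \<surd>d) / (t + s \<surd>d)\<close>
  makes it the vanishing of a nonzero quadratic form in \<open>s\<close>, \<open>t\<close>. Powers in different directions are then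
  independent, and any six directions, with the exceptional ones in the same triple, give a Beauville
  structure.

  If the class is \<open>p\<close> and \<open>c\<^sup>p = 1\<close>, then \<open>g\<^sup>p\<close> depends only on the coset \<open>g M\<close> and lies in \<open>\<gamma>\<^sub>p\<close>.
  Collecting \<open>(x\<^sup>s y\<^sup>t)\<^sup>p\<close> shows that \<open>t\<^sup>2 - d s\<^sup>2\<close> times this power is a cubic form in \<open>s\<close>, \<open>t\<close> with values
  in \<open>\<gamma>\<^sub>p\<close>, no nonzero functional of which vanishes identically; so each functional vanishes in at most
  three directions. If \<open>\<gamma>\<^sub>p\<close> has order \<open>p\<close>, a Beauville structure exists if and only if one triple can be
  chosen among directions with trivial \<open>p\<close>-th power, that is, if and only if three maximal subgroups have
  exponent \<open>p\<close>. If \<open>\<gamma>\<^sub>p\<close> has order \<open>p\<^sup>2\<close>, the directions are partitioned according to the line spanned by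
  the power; the parts have at most three elements, and two separated triples can be chosen unless \<open>p = 5\<close>
  and there are exactly three parts of size two, which a finite computation excludes.
\<close>

section \<open>Commutators and the lower central series\<close>

text \<open>From gamma_3 on, only the last factor may be smaller than the field. Below it a nonzero
  \<open>z\<close> acts injectively; if the last term has order p, the step into it loses a
  dimension. So one operator g - 1 places an element it kills only in the last but one term, and two
  independent directions are needed to force it into the last.

  The upper bound on the class enters through Z^p, which annihilates everything for Z of positive
  degree: it follows that gamma_3 has exponent p, and inside M only the order of c remains open. The
  bound p >= 5 gives at least six directions, the least number for two disjoint triples; any three
  different directions are those of g, h and gh for suitable generators g, h. It also makes the
  class at least 5, which excludes a one-dimensional degree 2.

  No quotient ring or finite field is built. Identities hold modulo the annihilator \<open>I\<close>
  or an ideal \<open>K i\<close>, residues modulo p are integers with divisibility side conditions,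
  and elements of the field are pairs of integers.\<close>

context group
begin

lemma inv_l_cancel [simp]: "\<lbrakk>g \<in> carrier G; h \<in> carrier G\<rbrakk> \<Longrightarrow> inv g \<otimes> (g \<otimes> h) = h"
  by (simp flip: m_assoc)

lemma inv_r_cancel [simp]: "\<lbrakk>g \<in> carrier G; h \<in> carrier G\<rbrakk> \<Longrightarrow> g \<otimes> (inv g \<otimes> h) = h"
  by (simp flip: m_assoc)

definition cmt :: "'a \<Rightarrow> 'a \<Rightarrow> 'a" where
  "cmt g h = g \<otimes> h \<otimes> inv g \<otimes> inv h"

lemma cmt_closed [simp]: "\<lbrakk>g \<in> carrier G; h \<in> carrier G\<rbrakk> \<Longrightarrow> cmt g h \<in> carrier G"
  by (simp add: cmt_def)

lemma inv_cmt: "\<lbrakk>g \<in> carrier G; h \<in> carrier G\<rbrakk> \<Longrightarrow> inv (cmt g h) = cmt h g"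
  by (simp add: cmt_def m_assoc inv_mult_group)

lemma cmt_mult_left:
  "\<lbrakk>g \<in> carrier G; g' \<in> carrier G; h \<in> carrier G\<rbrakk>
    \<Longrightarrow> cmt (g \<otimes> g') h = g \<otimes> cmt g' h \<otimes> inv g \<otimes> cmt g h"
  by (simp add: cmt_def m_assoc inv_mult_group)

lemma cmt_mult_right:
  "\<lbrakk>g \<in> carrier G; h \<in> carrier G; h' \<in> carrier G\<rbrakk>
    \<Longrightarrow> cmt g (h \<otimes> h') = cmt g h \<otimes> (h \<otimes> cmt g h' \<otimes> inv h)"
  by (simp add: cmt_def m_assoc inv_mult_group)

lemma conj_cmt:
  "\<lbrakk>g \<in> carrier G; h \<in> carrier G; u \<in> carrier G\<rbrakk>
    \<Longrightarrow> u \<otimes> cmt g h \<otimes> inv u = cmt (u \<otimes> g \<otimes> inv u) (u \<otimes> h \<otimes> inv u)"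
  by (simp add: cmt_def m_assoc inv_mult_group)

lemma normal_conj: "\<lbrakk>N \<lhd> G; n \<in> N; g \<in> carrier G\<rbrakk> \<Longrightarrow> g \<otimes> n \<otimes> inv g \<in> N"
  by (simp add: normal_inv_iff)

lemma normal_conj': "\<lbrakk>N \<lhd> G; n \<in> N; g \<in> carrier G\<rbrakk> \<Longrightarrow> inv g \<otimes> n \<otimes> g \<in> N"
  using normal_conj[of N n "inv g"] by simp

lemma normal_subgroup: "N \<lhd> G \<Longrightarrow> subgroup N G"
  by (simp add: normal_inv_iff)

text \<open>The product rule for \<open>cmt (g \<otimes> g') h\<close> gives closure, because
  \<open>N\<close> is normal. A commutator condition then only has to be checked on
  generators.\<close>

lemma subgroup_centralizer_mod:
  assumes N: "N \<lhd> G" and S: "S \<subseteq> carrier G"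
  shows "subgroup {g \<in> carrier G. \<forall>h\<in>S. cmt g h \<in> N} G"
proof (rule subgroupI)
  have sg: "subgroup N G" using N by (rule normal_subgroup)
  show "{g \<in> carrier G. \<forall>h\<in>S. cmt g h \<in> N} \<noteq> {}"
    using S subgroup.one_closed[OF sg] by (auto simp: cmt_def subset_iff intro!: exI[of _ \<one>])
  fix g assume g: "g \<in> {g \<in> carrier G. \<forall>h\<in>S. cmt g h \<in> N}"
  have "cmt (inv g) h \<in> N" if "h \<in> S" for h
  proof -
    have h: "h \<in> carrier G" using that S by auto
    have "cmt (inv g) h = inv g \<otimes> inv (cmt g h) \<otimes> g"
      using g h by (simp add: cmt_def m_assoc inv_mult_group)
    then show ?thesis
      using g that h normal_conj'[OF N] subgroup.m_inv_closed[OF sg] by auto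
  qed
  then show "inv g \<in> {g \<in> carrier G. \<forall>h\<in>S. cmt g h \<in> N}" using g by auto
  fix g' assume g': "g' \<in> {g \<in> carrier G. \<forall>h\<in>S. cmt g h \<in> N}"
  show "g \<otimes> g' \<in> {g \<in> carrier G. \<forall>h\<in>S. cmt g h \<in> N}"
    using g g' S by (auto simp: cmt_mult_left subset_iff intro!: subgroup.m_closed[OF sg] normal_conj[OF N])
qed auto

lemma cmt_swap_mem: "\<lbrakk>subgroup N G; g \<in> carrier G; h \<in> carrier G; cmt g h \<in> N\<rbrakk> \<Longrightarrow> cmt h g \<in> N"
  using inv_cmt subgroup.m_inv_closed by metis

lemma generated_subset:
  assumes "generate G S = carrier G" "subgroup H G" "S \<subseteq> H"
  shows "carrier G \<subseteq> H"
  using generate_subgroup_incl[OF assms(3,2)] assms(1) by simp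

text \<open>If two generators commute modulo \<open>N\<close>, everything does. The centralizer
  argument is applied twice, once for each argument of the commutator.\<close>

lemma cmt_mem_of_generators:
  assumes gen: "generate G {x, y} = carrier G" and xy: "x \<in> carrier G" "y \<in> carrier G"
    and N: "N \<lhd> G" and c: "cmt x y \<in> N" and g: "g \<in> carrier G" and h: "h \<in> carrier G"
  shows "cmt g h \<in> N"
proof -
  have sg: "subgroup N G" using N by (rule normal_subgroup)
  have one: "\<one> \<in> N" using subgroup.one_closed[OF sg] .
  have c': "cmt y x \<in> N" using cmt_swap_mem[OF sg _ _ c] xy by simp
  have self: "cmt u u \<in> N" if "u \<in> carrier G" for u
    using that one by (simp add: cmt_def m_assoc)
  have "carrier G \<subseteq> {g \<in> carrier G. \<forall>h\<in>{x,y}. cmt g h \<in> N}"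
    by (rule generated_subset[OF gen subgroup_centralizer_mod[OF N]]) (use xy c c' self in auto)
  then have 1: "cmt g x \<in> N" "cmt g y \<in> N" if "g \<in> carrier G" for g using that by auto
  have "carrier G \<subseteq> {g \<in> carrier G. \<forall>h\<in>carrier G. cmt g h \<in> N}"
    by (rule generated_subset[OF gen subgroup_centralizer_mod[OF N]])
       (use xy 1 cmt_swap_mem[OF sg] in auto)
  then show ?thesis using g h by auto
qed

lemma lower_central_Suc:
  "lower_central G (Suc (Suc n)) = generate G {cmt g h |g h. g \<in> lower_central G (Suc n) \<and> h \<in> carrier G}"
  unfolding lower_central.simps(3) cmt_def by (rule arg_cong[where f = "generate G"]) auto

lemma lower_central_normal: "lower_central G n \<lhd> G"
\<comment> \<open>Two base cases, since the terms with index 0 and 1 are both the whole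
  group.\<close>
proof (induction n rule: induct_nat_012)
  case (ge2 n)
  note 3 = ge2(2)
  show ?case
    unfolding lower_central_Suc
  proof (rule normal_generateI)
    have sub: "lower_central G (Suc n) \<subseteq> carrier G"
      using 3 normal_imp_subgroup subgroup.subset by blast
    then show "{cmt g h |g h. g \<in> lower_central G (Suc n) \<and> h \<in> carrier G} \<subseteq> carrier G"
      by (auto simp: subset_iff)
    fix k u assume "k \<in> {cmt g h |g h. g \<in> lower_central G (Suc n) \<and> h \<in> carrier G}"
      and u: "u \<in> carrier G"
    then obtain g h where gh: "k = cmt g h" "g \<in> lower_central G (Suc n)" "h \<in> carrier G" by auto
    have "u \<otimes> k \<otimes> inv u = cmt (u \<otimes> g \<otimes> inv u) (u \<otimes> h \<otimes> inv u)"
      using gh u sub by (auto simp: conj_cmt)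
    moreover have "u \<otimes> h \<otimes> inv u \<in> carrier G" using gh u by simp
    ultimately show "u \<otimes> k \<otimes> inv u \<in> {cmt g h |g h. g \<in> lower_central G (Suc n) \<and> h \<in> carrier G}"
      using normal_conj[OF 3 gh(2) u] by blast
  qed
qed (auto simp: normal_inv_iff subgroup_self)

declare lower_central.simps(3) [simp del]

lemma lower_central_subgroup: "subgroup (lower_central G n) G"
  by (rule normal_subgroup[OF lower_central_normal])

lemma lower_central_carrier: "g \<in> lower_central G n \<Longrightarrow> g \<in> carrier G"
  using lower_central_subgroup subgroup.mem_carrier by metis

lemma cmt_lower_central:
  "\<lbrakk>g \<in> lower_central G (Suc n); h \<in> carrier G\<rbrakk> \<Longrightarrow> cmt g h \<in> lower_central G (Suc (Suc n))"
  unfolding lower_central_Suc by (rule generate.incl) auto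

lemma lower_central_Suc_subset: "lower_central G (Suc n) \<subseteq> lower_central G n"
proof (cases n)
  case (Suc m)
  have "cmt g h \<in> lower_central G (Suc m)" if "g \<in> lower_central G (Suc m)" "h \<in> carrier G" for g h
  proof -
    have g: "g \<in> carrier G" using that lower_central_carrier by auto
    have "cmt g h = g \<otimes> (h \<otimes> inv g \<otimes> inv h)" using g that by (simp add: cmt_def m_assoc)
    then show ?thesis
      using that normal_conj[OF lower_central_normal]
      by (simp add: subgroup.m_closed[OF lower_central_subgroup] subgroup.m_inv_closed[OF lower_central_subgroup])
  qed
  then show ?thesis
    unfolding Suc lower_central_Suc
    by (intro generate_subgroup_incl lower_central_subgroup) auto
qed auto

lemma lower_central_antimono: "i \<le> j \<Longrightarrow> lower_central G j \<subseteq> lower_central G i"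
  by (rule lift_Suc_antimono_le[of "lower_central G"]) (rule lower_central_Suc_subset)

lemma derived_eq_lower_central: "derived G (carrier G) = lower_central G 2"
  by (simp add: derived_def numeral_2_eq_2 lower_central.simps(3))

lemma cmt_in_derived: "\<lbrakk>g \<in> carrier G; h \<in> carrier G\<rbrakk> \<Longrightarrow> cmt g h \<in> lower_central G 2"
  using cmt_lower_central[of g 0 h] by (simp add: numeral_2_eq_2)

lemma derived_subset:
  assumes "subgroup N G" "\<And>g h. \<lbrakk>g \<in> carrier G; h \<in> carrier G\<rbrakk> \<Longrightarrow> cmt g h \<in> N"
  shows "lower_central G 2 \<subseteq> N"
proof -
  have "lower_central G 2 = lower_central G (Suc (Suc 0))" by (simp only: numeral_2_eq_2)
  also have "\<dots> \<subseteq> N"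
    unfolding lower_central_Suc by (rule generate_subgroup_incl) (use assms in auto)
  finally show ?thesis .
qed

lemma subgroup_mult_normal:
  assumes H: "subgroup H G" and N: "N \<lhd> G"
  shows "subgroup {h \<otimes> n |h n. h \<in> H \<and> n \<in> N} G"
proof -
  interpret second_isomorphism_grp N G H
    using assms by (simp add: second_isomorphism_grp.intro second_isomorphism_grp_axioms.intro)
  have "{h \<otimes> n |h n. h \<in> H \<and> n \<in> N} = H <#> N"
    unfolding set_mult_def by auto
  also have "\<dots> = N <#> H" by (rule commut_normal[OF H N])
  finally show ?thesis using normal_set_mult_subgroup by simp
qed

text \<open>The key point is that \<open>\<gamma>\<^sub>i\<close> is central modulo \<open>\<gamma>\<^sub>i\<^sub>+\<^sub>1\<close>, so commutators of
  elements of \<open>H\<gamma>\<^sub>i\<close> agree with commutators in \<open>H\<close> modulo \<open>\<gamma>\<^sub>i\<^sub>+\<^sub>1\<close>.\<close>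

lemma supplement_of_derived:
  assumes nil: "lower_central G n = {\<one>}" and H: "subgroup H G"
    and sup: "\<And>g. g \<in> carrier G \<Longrightarrow> \<exists>h\<in>H. \<exists>m\<in>lower_central G 2. g = h \<otimes> m"
  shows "H = carrier G"
proof -
  have Hc: "h \<in> carrier G" if "h \<in> H" for h using that H subgroup.mem_carrier by metis
  have main: "\<forall>g\<in>carrier G. \<exists>h\<in>H. \<exists>m\<in>lower_central G (Suc (Suc i)). g = h \<otimes> m" for i
  proof (induction i)
    case 0
    then show ?case using sup by (simp add: numeral_2_eq_2 del: lower_central.simps)
  next
    case (Suc i)
    let ?A = "lower_central G (Suc (Suc i))" and ?B = "lower_central G (Suc (Suc (Suc i)))"
    define N where "N = {h \<otimes> m |h m. h \<in> H \<and> m \<in> ?B}"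
    have Bc: "m \<in> carrier G" if "m \<in> ?B" for m using that lower_central_carrier by blast
    have Ac: "m \<in> carrier G" if "m \<in> ?A" for m using that lower_central_carrier by blast
    have N: "subgroup N G" unfolding N_def by (rule subgroup_mult_normal[OF H lower_central_normal])
    have BN: "m \<in> N" if "m \<in> ?B" for m
    proof -
      have "m = \<one> \<otimes> m" using Bc[OF that] by simp
      then show ?thesis unfolding N_def using subgroup.one_closed[OF H] that by blast
    qed
    have HN: "h \<in> N" if "h \<in> H" for h
    proof -
      have "h = h \<otimes> \<one>" using Hc[OF that] by simp
      then show ?thesis unfolding N_def using subgroup.one_closed[OF lower_central_subgroup] that by blast
    qed
    have "cmt g g' \<in> N" if gg: "g \<in> carrier G" "g' \<in> carrier G" for g g'
    proof -
      obtain h z where 1: "g = h \<otimes> z" "h \<in> H" "z \<in> ?A"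
        using Suc gg(1) by blast
      obtain h' z' where 2: "g' = h' \<otimes> z'" "h' \<in> H" "z' \<in> ?A"
        using Suc gg(2) by blast
      note * = 1 2
      have 1: "h \<otimes> cmt z g' \<otimes> inv h \<in> ?B"
        using * gg Hc by (intro normal_conj[OF lower_central_normal] cmt_lower_central) auto
      have "cmt h z' \<in> ?B"
        by (rule cmt_swap_mem[OF lower_central_subgroup _ _ cmt_lower_central]) (use * Hc Ac in auto)
      then have 2: "h' \<otimes> cmt h z' \<otimes> inv h' \<in> ?B"
        using * Hc by (intro normal_conj[OF lower_central_normal]) auto
      have "cmt g g' = h \<otimes> cmt z g' \<otimes> inv h \<otimes> cmt h g'"
        using * Hc Ac gg by (simp add: cmt_mult_left)
      also have "cmt h g' = cmt h h' \<otimes> (h' \<otimes> cmt h z' \<otimes> inv h')"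
        using * Hc Ac by (simp add: cmt_mult_right)
      finally have eq: "cmt g g' = h \<otimes> cmt z g' \<otimes> inv h \<otimes> (cmt h h' \<otimes> (h' \<otimes> cmt h z' \<otimes> inv h'))" .
      have "cmt h h' \<in> H"
        using * H unfolding cmt_def by (meson subgroup.m_closed subgroup.m_inv_closed)
      then show ?thesis
        unfolding eq by (intro subgroup.m_closed[OF N] BN[OF 1] BN[OF 2] HN)
    qed
    then have "lower_central G 2 \<subseteq> N" using N by (intro derived_subset)
    moreover have "?A \<subseteq> lower_central G 2" by (rule lower_central_antimono) simp
    ultimately have AN: "?A \<subseteq> N" by simp
    show ?case
    proof
      fix g assume "g \<in> carrier G"
      then obtain h z where "g = h \<otimes> z" "h \<in> H" "z \<in> ?A" using Suc by blast
      then have "g \<in> N" using AN HN subgroup.m_closed[OF N] by blast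
      then show "\<exists>h\<in>H. \<exists>m\<in>?B. g = h \<otimes> m" unfolding N_def by blast
    qed
  qed
  \<comment> \<open>\<open>main n\<close> reaches the term with index n + 2, which lies in the
    trivial term with index n.\<close>
  have triv: "lower_central G (Suc (Suc n)) \<subseteq> {\<one>}"
    using nil lower_central_antimono[of n "Suc (Suc n)"] by simp
  have "carrier G \<subseteq> H"
  proof
    fix g assume "g \<in> carrier G"
    then obtain h m where "h \<in> H" "m \<in> lower_central G (Suc (Suc n))" "g = h \<otimes> m"
      using main[of n] by blast
    then show "g \<in> H" using triv Hc by auto
  qed
  then show ?thesis using Hc by auto
qed

end

section \<open>The derived subgroup as a module over a polynomial ring\<close>

text \<open>Horner's scheme in multiplicative notation: the coefficient of degree k contributes a
  power of \<open>c\<close>, conjugated k times by \<open>x\<close>.\<close>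

definition phi1 :: "('a, 'b) monoid_scheme \<Rightarrow> 'a \<Rightarrow> 'a \<Rightarrow> int poly \<Rightarrow> 'a" where
  "phi1 G x c q = fold_coeffs (\<lambda>n m. c [^]\<^bsub>G\<^esub> n \<otimes>\<^bsub>G\<^esub> (x \<otimes>\<^bsub>G\<^esub> m \<otimes>\<^bsub>G\<^esub> inv\<^bsub>G\<^esub> x)) q \<one>\<^bsub>G\<^esub>"

text \<open>The outer variable stands for conjugation by \<open>y\<close>; the coefficients are
  polynomials in conjugation by \<open>x\<close>.\<close>

definition phi2 :: "('a, 'b) monoid_scheme \<Rightarrow> 'a \<Rightarrow> 'a \<Rightarrow> 'a \<Rightarrow> int poly poly \<Rightarrow> 'a" where
  "phi2 G x y c q = fold_coeffs (\<lambda>r m. phi1 G x c r \<otimes>\<^bsub>G\<^esub> (y \<otimes>\<^bsub>G\<^esub> m \<otimes>\<^bsub>G\<^esub> inv\<^bsub>G\<^esub> y)) q \<one>\<^bsub>G\<^esub>"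

text \<open>The polynomials vanishing at (1, 1) form the ideal generated by a - 1 and b - 1.
  Decomposable polynomials include the integers and are closed under multiplication by a, since a r
  = (a - 1) r + r, and likewise by b.\<close>

lemma bivariate_poly_decomp:
  fixes r :: "int poly poly"
  shows "\<exists>n f g. r = of_int n + ([:[:0, 1:]:] - 1) * f + ([:0, 1:] - 1) * g"
proof -
  let ?P = "\<lambda>r::int poly poly. \<exists>n f g. r = of_int n + ([:[:0, 1:]:] - 1) * f + ([:0, 1:] - 1) * g"
  have add: "?P (r + s)" if "?P r" "?P s" for r s
  proof -
    obtain n f g n' f' g' where
      "r = of_int n + ([:[:0, 1:]:] - 1) * f + ([:0, 1:] - 1) * g"
      "s = of_int n' + ([:[:0, 1:]:] - 1) * f' + ([:0, 1:] - 1) * g'"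
      using \<open>?P r\<close> \<open>?P s\<close> by blast
    then have "r + s = of_int (n + n') + ([:[:0, 1:]:] - 1) * (f + f') + ([:0, 1:] - 1) * (g + g')"
      by (simp only: of_int_add distrib_left distrib_right ac_simps)
    then show ?thesis by blast
  qed
  have a: "?P ([:[:0, 1:]:] * r)" if "?P r" for r
  proof -
    have "?P (([:[:0, 1:]:] - 1) * r)"
      by (rule exI[of _ 0], rule exI[of _ r], rule exI[of _ 0]) (simp only: of_int_0 mult_zero_right add_0_left add_0_right)
    from add[OF this that] show ?thesis by (simp only: left_diff_distrib mult_1 diff_add_cancel)
  qed
  have b: "?P ([:0, 1:] * r)" if "?P r" for r
  proof -
    have "?P (([:0, 1:] - 1) * r)"
      by (rule exI[of _ 0], rule exI[of _ 0], rule exI[of _ r]) (simp only: of_int_0 mult_zero_right add_0_left add_0_right)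
    from add[OF this that] show ?thesis by (simp only: left_diff_distrib mult_1 diff_add_cancel)
  qed
  have int: "?P (of_int n)" for n
    by (rule exI[of _ n], rule exI[of _ 0], rule exI[of _ 0]) (simp only: mult_zero_right add_0_right)
  have c: "?P [:s:]" for s
  proof (induction s)
    case 0
    show ?case using int[of 0] by simp
  next
    case (pCons n s)
    have "[:pCons n s:] = of_int n + [:[:0, 1:]:] * [:s:]"
      by (simp add: of_int_poly)
    then show ?case using add[OF int a[OF pCons(2)]] by simp
  qed
  show ?thesis
  proof (induction r)
    case 0
    show ?case using int[of 0] by simp
  next
    case (pCons s r)
    have "pCons s r = [:s:] + [:0, 1:] * r" by simp
    then show ?case using add[OF c b[OF pCons(2)]] by simp
  qed
qed

context group
begin

lemma conj_mult:
  "\<lbrakk>g \<in> carrier G; m \<in> carrier G; n \<in> carrier G\<rbrakk>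
    \<Longrightarrow> g \<otimes> (m \<otimes> n) \<otimes> inv g = (g \<otimes> m \<otimes> inv g) \<otimes> (g \<otimes> n \<otimes> inv g)"
  by (simp add: m_assoc)

lemma phi1_0 [simp]: "phi1 G x c 0 = \<one>"
  by (simp add: phi1_def)

lemma phi2_0 [simp]: "phi2 G x y c 0 = \<one>"
  by (simp add: phi2_def)

lemma phi1_pCons:
  assumes "x \<in> carrier G"
  shows "phi1 G x c (pCons n q) = c [^] n \<otimes> (x \<otimes> phi1 G x c q \<otimes> inv x)"
  \<comment> \<open>\<open>pCons 0 0\<close> is the zero polynomial, over which
    \<open>fold_coeffs\<close> makes no step; the formula still holds because both factors are
    trivial.\<close>
  using assms by (cases "n = 0 \<and> q = 0") (auto simp: phi1_def)

lemma phi2_pCons: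
  assumes "y \<in> carrier G"
  shows "phi2 G x y c (pCons r q) = phi1 G x c r \<otimes> (y \<otimes> phi2 G x y c q \<otimes> inv y)"
  using assms by (cases "r = 0 \<and> q = 0") (auto simp: phi2_def)

text \<open>The interface to the rest: later arguments use only these properties of
  \<open>\<Phi>\<close>, never the encoding by nested polynomials.\<close>

lemma exists_polynomial_action:
  assumes M: "M \<lhd> G" and comm: "\<And>m n. \<lbrakk>m \<in> M; n \<in> M\<rbrakk> \<Longrightarrow> m \<otimes> n = n \<otimes> m"
    and x: "x \<in> carrier G" and y: "y \<in> carrier G" and cM: "cmt x y \<in> M"
  obtains \<Phi> :: "int poly poly \<Rightarrow> 'a" and a b :: "int poly poly" where
    "\<And>f g. \<Phi> (f + g) = \<Phi> f \<otimes> \<Phi> g" "\<And>f. \<Phi> f \<in> M" "\<Phi> 1 = cmt x y"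
    "\<And>f. \<Phi> (a * f) = x \<otimes> \<Phi> f \<otimes> inv x" "\<And>f. \<Phi> (b * f) = y \<otimes> \<Phi> f \<otimes> inv y"
    "\<And>N r f. \<lbrakk>N \<lhd> G; \<Phi> f \<in> N\<rbrakk> \<Longrightarrow> \<Phi> (r * f) \<in> N"
    "\<And>r. \<exists>n f g. r = of_int n + (a - 1) * f + (b - 1) * g"
proof -
  define c where "c = cmt x y"
  have sg: "subgroup M G" using M by (rule normal_subgroup)
  note mc = subgroup.m_closed[OF sg]
  have Mc: "m \<in> carrier G" if "m \<in> M" for m using that sg subgroup.mem_carrier by metis
  have cM: "c \<in> M" and cc: "c \<in> carrier G" using cM Mc by (auto simp: c_def)
  have pow: "c [^] n \<in> M" for n :: int
    using subgroup_int_pow_closed[OF sg cM] .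
  have cx: "x \<otimes> m \<otimes> inv x \<in> M" and cy: "y \<otimes> m \<otimes> inv y \<in> M" if "m \<in> M" for m
    using that normal_conj[OF M] x y by auto
  have lcomm: "m \<otimes> (n \<otimes> k) = n \<otimes> (m \<otimes> k)" if "m \<in> M" "n \<in> M" "k \<in> M" for m n k
    using comm[OF that(1,2)] that Mc by (metis m_assoc)
  have one: "\<one> \<in> M" using subgroup.one_closed[OF sg] .
  let ?p = "phi1 G x c" and ?P = "phi2 G x y c"
  have p: "?p q \<in> M" for q
    by (induction q) (auto simp: phi1_pCons x one intro!: mc cx pow)
  have P: "?P q \<in> M" for q
    by (induction q) (auto simp: phi2_pCons y one intro!: mc cy p)
  have swap4: "(m \<otimes> m') \<otimes> (n \<otimes> n') = (m \<otimes> n) \<otimes> (m' \<otimes> n')"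
    if "m \<in> M" "m' \<in> M" "n \<in> M" "n' \<in> M" for m m' n n'
    using that lcomm[of m' n n'] Mc mc by (simp add: m_assoc)
  have p_add: "?p (q + r) = ?p q \<otimes> ?p r" for q r
  proof (induction q r rule: poly_induct2)
    case (pCons n q n' r)
    have "?p (pCons n q + pCons n' r) = (c [^] n \<otimes> c [^] n') \<otimes> ((x \<otimes> ?p q \<otimes> inv x) \<otimes> (x \<otimes> ?p r \<otimes> inv x))"
      using pCons x Mc[OF p] cc by (simp add: phi1_pCons conj_mult int_pow_mult)
    also have "\<dots> = ?p (pCons n q) \<otimes> ?p (pCons n' r)"
      using x by (simp add: phi1_pCons swap4 pow cx p)
    finally show ?case .
  qed auto
  have P_add: "?P (q + r) = ?P q \<otimes> ?P r" for q r
  proof (induction q r rule: poly_induct2)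
    case (pCons n q n' r)
    have "?P (pCons n q + pCons n' r) = (?p n \<otimes> ?p n') \<otimes> ((y \<otimes> ?P q \<otimes> inv y) \<otimes> (y \<otimes> ?P r \<otimes> inv y))"
      using pCons y Mc[OF P] by (simp add: phi2_pCons conj_mult p_add)
    also have "\<dots> = ?P (pCons n q) \<otimes> ?P (pCons n' r)"
      using y by (simp add: phi2_pCons swap4 p cy P)
    finally show ?case .
  qed auto
  \<comment> \<open>Conjugations by xy and by yx differ by conjugation by \<open>c\<close>, which is
    trivial on the abelian group \<open>M\<close>; so the two variables may commute.\<close>
  have xy_conj: "x \<otimes> (y \<otimes> m \<otimes> inv y) \<otimes> inv x = y \<otimes> (x \<otimes> m \<otimes> inv x) \<otimes> inv y" if "m \<in> M" for m
  proof -
    define k where "k = y \<otimes> (x \<otimes> m \<otimes> inv x) \<otimes> inv y"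
    have k: "k \<in> M" unfolding k_def by (intro cx cy that)
    have "x \<otimes> (y \<otimes> m \<otimes> inv y) \<otimes> inv x = c \<otimes> k \<otimes> inv c"
      using that x y Mc unfolding c_def k_def cmt_def by (simp add: m_assoc inv_mult_group)
    also have "\<dots> = k" using comm[OF cM k] k Mc cc by (simp add: m_assoc)
    finally show ?thesis unfolding k_def .
  qed
  define a :: "int poly poly" where "a = [:[:0, 1:]:]"
  define b :: "int poly poly" where "b = [:0, 1:]"
  have b: "?P (b * f) = y \<otimes> ?P f \<otimes> inv y" for f
    using y Mc[OF P] by (simp add: b_def phi2_pCons)
  have a: "?P (a * f) = x \<otimes> ?P f \<otimes> inv x" for f
  proof (induction f)
    case 0
    then show ?case using x by simp
  next
    case (pCons r q)
    have "a * pCons r q = pCons (pCons 0 r) (a * q)" by (simp add: a_def)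
    then have "?P (a * pCons r q) = (x \<otimes> ?p r \<otimes> inv x) \<otimes> (y \<otimes> (x \<otimes> ?P q \<otimes> inv x) \<otimes> inv y)"
      using x y pCons Mc[OF p] by (simp add: phi2_pCons phi1_pCons)
    also have "\<dots> = x \<otimes> ?P (pCons r q) \<otimes> inv x"
      using x y Mc[OF p] Mc[OF P] by (simp add: phi2_pCons conj_mult[OF x Mc[OF p]] xy_conj P)
    finally show ?case .
  qed
  have P0: "?P (of_int n * f) \<in> N" if N: "N \<lhd> G" and f: "?P f \<in> N" for N n f
  proof -
    note N' = normal_subgroup[OF N]
    have nat: "?P (of_nat k * h) \<in> N" if "?P h \<in> N" for k h
      by (induction k)
         (auto simp: distrib_right P_add that subgroup.one_closed[OF N'] intro!: subgroup.m_closed[OF N'])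
    have "?P (- f) \<otimes> ?P f = ?P (- f + f)" by (rule P_add[symmetric])
    then have "?P (- f) = inv (?P f)" using Mc[OF P] by (simp add: inv_equality)
    then have "?P (- f) \<in> N" using f subgroup.m_inv_closed[OF N'] by simp
    then have "?P (of_nat k * - f) \<in> N" for k by (rule nat)
    with nat[OF f] show ?thesis by (cases n) (auto simp del: of_nat_Suc)
  qed
  have ideal1: "?P ([:s:] * f) \<in> N" if N: "N \<lhd> G" and f: "?P f \<in> N" for N s f
  proof (induction s)
    case 0
    then show ?case using subgroup.one_closed[OF normal_subgroup[OF N]] by simp
  next
    case (pCons n s)
    have "[:pCons n s:] = of_int n + a * [:s:]"
      by (simp add: of_int_poly a_def)
    then have "[:pCons n s:] * f = of_int n * f + a * ([:s:] * f)" by (simp only: distrib_right mult.assoc)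
    then show ?case
      by (simp only: P_add a)
         (intro subgroup.m_closed[OF normal_subgroup[OF N]] P0[OF N f] normal_conj[OF N] pCons(2) x)
  qed
  have ideal: "?P (r * f) \<in> N" if N: "N \<lhd> G" and f: "?P f \<in> N" for N r f
  proof (induction r)
    case 0
    then show ?case using subgroup.one_closed[OF normal_subgroup[OF N]] by simp
  next
    case (pCons s r)
    have "pCons s r = [:s:] + b * r" by (simp add: b_def)
    then have "pCons s r * f = [:s:] * f + b * (r * f)" by (simp only: distrib_right mult.assoc)
    then show ?case
      by (simp only: P_add b)
         (intro subgroup.m_closed[OF normal_subgroup[OF N]] ideal1[OF N f] normal_conj[OF N] pCons(2) y)
  qed
  have "?P 1 = cmt x y"
    using x y cc by (simp add: one_pCons phi2_pCons phi1_pCons flip: c_def)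
  then show ?thesis
    using that[of ?P a b] P_add P a b ideal bivariate_poly_decomp unfolding a_def b_def by blast
qed

end

section \<open>The operator ring of a two-generator metabelian group\<close>

lemma one_plus_power_expand:
  fixes z :: "'r::comm_ring_1"
  shows "\<exists>u. (1 + z) ^ n = 1 + of_nat n * z + z * z * u"
proof (induction n)
  case 0
  then show ?case by (intro exI[of _ 0]) simp
next
  case (Suc n)
  then obtain u where u: "(1 + z) ^ n = 1 + of_nat n * z + z * z * u" by blast
  have "(1 + z) ^ Suc n = 1 + of_nat (Suc n) * z + z * z * (of_nat n + u + z * u)"
    by (simp add: u algebra_simps)
  then show ?case by blast
qed

text \<open>The ring and its elements \<open>a\<close>, \<open>b\<close> are left abstract:
  replacing the generator x by x y^l keeps \<open>\<Phi>\<close> and turns \<open>a\<close> into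
  \<open>a * b ^ l\<close>, which is no longer a variable.\<close>

locale metabelian_action = group G for G (structure) +
  fixes x y :: 'a and \<Phi> :: "'r::comm_ring_1 \<Rightarrow> 'a" and a b :: 'r
  assumes fin: "finite (carrier G)"
    and x_closed [simp]: "x \<in> carrier G" and y_closed [simp]: "y \<in> carrier G"
    and gen: "generate G {x, y} = carrier G"
    and phi_add: "\<Phi> (f + g) = \<Phi> f \<otimes> \<Phi> g"
    and phi_closed [simp]: "\<Phi> f \<in> carrier G"
    and phi_one: "\<Phi> 1 = cmt x y"
    and phi_a: "\<Phi> (a * f) = x \<otimes> \<Phi> f \<otimes> inv x"
    and phi_b: "\<Phi> (b * f) = y \<otimes> \<Phi> f \<otimes> inv y"
    and phi_normal: "\<lbrakk>N \<lhd> G; \<Phi> f \<in> N\<rbrakk> \<Longrightarrow> \<Phi> (r * f) \<in> N"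
    and decomp: "\<exists>n f g. r = of_int n + (a - 1) * f + (b - 1) * g"
begin

lemma phi_zero [simp]: "\<Phi> 0 = \<one>"
proof -
  have "\<Phi> 0 \<otimes> \<Phi> 0 = \<Phi> 0 \<otimes> \<one>" using phi_add[of 0 0] by simp
  then show ?thesis by (simp only: l_cancel phi_closed one_closed)
qed

lemma phi_minus: "\<Phi> (- f) = inv (\<Phi> f)"
proof -
  have "\<Phi> (- f) \<otimes> \<Phi> f = \<one>" using phi_add[of "- f" f] by simp
  then show ?thesis by (simp add: inv_equality)
qed

lemma phi_comm: "\<Phi> f \<otimes> \<Phi> g = \<Phi> g \<otimes> \<Phi> f"
  by (simp flip: phi_add add: add.commute)

lemma phi_diff: "\<Phi> (f - g) = \<Phi> f \<otimes> inv (\<Phi> g)"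
  using phi_add[of f "- g"] by (simp add: phi_minus)

lemma phi_eq_iff: "\<Phi> f = \<Phi> g \<longleftrightarrow> \<Phi> (f - g) = \<one>"
  unfolding phi_diff by (metis inv_closed inv_equality inv_inv phi_closed r_inv)

lemma phi_of_nat: "\<Phi> (of_nat n * f) = \<Phi> f [^] n"
proof (induction n)
  case (Suc n)
  have "\<Phi> (of_nat (Suc n) * f) = \<Phi> (of_nat n * f + f)" by (simp add: distrib_right add.commute)
  also have "\<dots> = \<Phi> f [^] Suc n" unfolding phi_add using Suc by simp
  finally show ?case .
qed simp

lemma phi_of_int: "\<Phi> (of_int n * f) = \<Phi> f [^] n"
proof (cases n rule: int_cases2)
  case (nonneg k)
  then show ?thesis by (simp add: phi_of_nat int_pow_int)
next
  case (nonpos k)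
  then show ?thesis by (simp add: phi_of_nat int_pow_neg_int phi_minus)
qed

text \<open>\<open>I\<close> is the annihilator of the commutator of the two generators, and \<open>K i\<close> is the ideal
  corresponding to \<open>\<gamma>\<^sub>i\<^sub>+\<^sub>2\<close>.\<close>

definition I :: "'r set" where "I = {f. \<Phi> f = \<one>}"

definition K :: "nat \<Rightarrow> 'r set" where "K i = {f. \<Phi> f \<in> lower_central G (Suc (Suc i))}"

definition U :: 'r where "U = a - 1"

definition V :: 'r where "V = b - 1"

definition acts :: "'a \<Rightarrow> 'r \<Rightarrow> bool" where
  "acts g r \<longleftrightarrow> g \<in> carrier G \<and> (\<forall>f. \<Phi> (r * f) = g \<otimes> \<Phi> f \<otimes> inv g)"

text \<open>The augmentation ideal. It precedes \<open>K (Suc 0)\<close> logically: that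
  \<open>U\<close> and \<open>V\<close> lie there rests on \<open>range_phi\<close>, whose proof
  goes through \<open>exists_acts\<close>.\<close>

definition aug :: "'r set" where "aug = {U * f + V * g |f g. True}"

lemma augI: "U * f + V * g \<in> aug"
  by (auto simp: aug_def)

lemma aug_add: "\<lbrakk>f \<in> aug; g \<in> aug\<rbrakk> \<Longrightarrow> f + g \<in> aug"
proof -
  assume "f \<in> aug" "g \<in> aug"
  then obtain f1 f2 g1 g2 where "f = U * f1 + V * f2" "g = U * g1 + V * g2" by (auto simp: aug_def)
  then have "f + g = U * (f1 + g1) + V * (f2 + g2)" by (simp add: algebra_simps)
  then show ?thesis by (simp add: augI)
qed

lemma aug_mult: "f \<in> aug \<Longrightarrow> r * f \<in> aug"
proof -
  assume "f \<in> aug"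
  then obtain f1 f2 where "f = U * f1 + V * f2" by (auto simp: aug_def)
  then have "r * f = U * (r * f1) + V * (r * f2)" by (simp add: algebra_simps)
  then show ?thesis by (simp add: augI)
qed

lemma U_aug: "U \<in> aug" and V_aug: "V \<in> aug" and zero_aug: "0 \<in> aug"
  using augI[of 1 0] augI[of 0 1] augI[of 0 0] by auto

lemma acts_closed: "acts g r \<Longrightarrow> g \<in> carrier G"
  by (simp add: acts_def)

lemma acts_x: "acts x a" and acts_y: "acts y b"
  by (simp_all add: acts_def phi_a phi_b)

lemma acts_one: "acts \<one> 1"
  by (simp add: acts_def)

lemma acts_mult: "\<lbrakk>acts g r; acts h s\<rbrakk> \<Longrightarrow> acts (g \<otimes> h) (r * s)"
  by (simp add: acts_def mult.assoc m_assoc inv_mult_group)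

lemma acts_pow: "acts g r \<Longrightarrow> acts (g [^] n) (r ^ n)" for n :: nat
proof (induction n)
  case (Suc n)
  then show ?case using acts_mult[of "g [^] n" "r ^ n" g r] by (simp add: mult.commute)
qed (simp add: acts_one)

lemma acts_phi: "acts (\<Phi> f) 1"
  using phi_comm[of f] by (simp add: acts_def m_assoc)

text \<open>By finiteness inverses are powers, so the ring needs no inverses of \<open>a\<close> and
  \<open>b\<close>.\<close>

lemma inv_eq_pow:
  assumes "g \<in> carrier G" shows "\<exists>n::nat. inv g = g [^] n"
proof -
  have "ord g \<ge> 1" using ord_ge_1[OF fin assms] .
  then obtain n where "ord g = Suc n" by (cases "ord g") auto
  then have "g [^] n \<otimes> g = \<one>" using pow_ord_eq_1[OF assms] by simp
  then show ?thesis using inv_equality assms by (metis nat_pow_closed)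
qed

lemma exists_acts:
  assumes "g \<in> carrier G" shows "\<exists>j\<in>aug. acts g (1 + j)"
proof -
  let ?A = "{g \<in> carrier G. \<exists>j\<in>aug. acts g (1 + j)}"
  have mult: "\<exists>j\<in>aug. acts (g \<otimes> h) (1 + j)"
    if gh: "\<exists>j\<in>aug. acts g (1 + j)" "\<exists>j\<in>aug. acts h (1 + j)" for g h
  proof -
    obtain j k where jk: "j \<in> aug" "acts g (1 + j)" "k \<in> aug" "acts h (1 + k)" using gh by auto
    have "(1 + j) * (1 + k) = 1 + (j + k + j * k)" by (simp add: algebra_simps)
    then have "acts (g \<otimes> h) (1 + (j + k + j * k))" using acts_mult[OF jk(2,4)] by simp
    then show ?thesis using jk by (intro bexI[of _ "j + k + j * k"] aug_add aug_mult)
  qed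
  have pow: "\<exists>j\<in>aug. acts (g [^] n) (1 + j)" if "\<exists>j\<in>aug. acts g (1 + j)" for g and n :: nat
    by (induction n) (use that mult acts_one zero_aug in force)+
  have "subgroup ?A G"
  proof (rule subgroupI)
    show "?A \<noteq> {}" using acts_one zero_aug by force
    fix g assume g: "g \<in> ?A"
    then show "inv g \<in> ?A" using inv_eq_pow[of g] pow[of g] by auto
    fix h assume "h \<in> ?A"
    then show "g \<otimes> h \<in> ?A" using g mult by auto
  qed auto
  moreover have "{x, y} \<subseteq> ?A"
  proof -
    have "1 + U = a" "1 + V = b" by (simp_all add: U_def V_def)
    then have "acts x (1 + U)" "acts y (1 + V)" using acts_x acts_y by simp_all
    then show ?thesis using U_aug V_aug by auto
  qed
  ultimately show ?thesis using generated_subset[OF gen] assms by blast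
qed

lemma phi_U: "\<Phi> (U * f) = cmt x (\<Phi> f)"
  by (simp add: U_def left_diff_distrib phi_diff phi_a cmt_def)

lemma phi_V: "\<Phi> (V * f) = cmt y (\<Phi> f)"
  by (simp add: V_def left_diff_distrib phi_diff phi_b cmt_def)

lemma I_add: "\<lbrakk>f \<in> I; g \<in> I\<rbrakk> \<Longrightarrow> f + g \<in> I"
  and I_diff: "\<lbrakk>f \<in> I; g \<in> I\<rbrakk> \<Longrightarrow> f - g \<in> I"
  and I_minus: "f \<in> I \<Longrightarrow> - f \<in> I"
  and I_zero: "0 \<in> I"
  by (auto simp: I_def phi_add phi_diff phi_minus)

lemma I_mult: "f \<in> I \<Longrightarrow> r * f \<in> I"
  using phi_normal[of "{\<one>}" f r] by (auto simp: I_def normal_inv_iff triv_subgroup)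

text \<open>Ideals give normal subgroups, because conjugation by any group element is multiplication
  by a ring element.\<close>

lemma phi_image_normal:
  assumes "\<And>f g. \<lbrakk>f \<in> S; g \<in> S\<rbrakk> \<Longrightarrow> f + g \<in> S" "\<And>r f. f \<in> S \<Longrightarrow> r * f \<in> S" "0 \<in> S"
  shows "\<Phi> ` S \<lhd> G"
proof -
  have "subgroup (\<Phi> ` S) G"
  proof (rule subgroupI)
    fix g assume "g \<in> \<Phi> ` S"
    then obtain f where f: "g = \<Phi> f" "f \<in> S" by auto
    have "- f \<in> S" using assms(2)[OF f(2), of "- 1"] by simp
    then show "inv g \<in> \<Phi> ` S" using f phi_minus[of f] by (metis image_eqI)
    fix h assume "h \<in> \<Phi> ` S"
    then show "g \<otimes> h \<in> \<Phi> ` S" using f assms(1) by (auto simp flip: phi_add)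
  qed (use assms(3) in auto)
  moreover have "g \<otimes> h \<otimes> inv g \<in> \<Phi> ` S" if gh: "g \<in> carrier G" "h \<in> \<Phi> ` S" for g h
  proof -
    obtain f where f: "h = \<Phi> f" "f \<in> S" using gh by auto
    obtain j where "acts g (1 + j)" using exists_acts[OF gh(1)] by auto
    then have "g \<otimes> h \<otimes> inv g = \<Phi> ((1 + j) * f)" by (simp add: acts_def f)
    then show ?thesis using assms(2)[OF f(2)] by simp
  qed
  ultimately show ?thesis by (simp add: normal_inv_iff)
qed

text \<open>The generators commute modulo the normal subgroup \<open>range \<Phi>\<close>, which
  gives one inclusion; the decomposition of ring elements gives the other.\<close>

lemma range_phi: "range \<Phi> = lower_central G 2"
proof
  show "lower_central G 2 \<subseteq> range \<Phi>"
  proof (rule derived_subset)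
    have N: "range \<Phi> \<lhd> G" by (rule phi_image_normal) auto
    then show "subgroup (range \<Phi>) G" by (rule normal_subgroup)
    show "cmt g h \<in> range \<Phi>" if "g \<in> carrier G" "h \<in> carrier G" for g h
      using cmt_mem_of_generators[OF gen x_closed y_closed N _ that] phi_one by (metis rangeI)
  qed
  show "range \<Phi> \<subseteq> lower_central G 2"
  proof
    fix g assume "g \<in> range \<Phi>"
    then obtain r where r: "g = \<Phi> r" by auto
    obtain n f h where d: "r = of_int n + U * f + V * h" using decomp[of r] by (auto simp: U_def V_def)
    have "\<Phi> r = \<Phi> 1 [^] n \<otimes> \<Phi> (U * f) \<otimes> \<Phi> (V * h)"
      using phi_of_int[of n 1] by (simp add: d phi_add)
    moreover have "\<Phi> 1 [^] n \<in> lower_central G 2"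
      unfolding phi_one by (rule subgroup_int_pow_closed[OF lower_central_subgroup cmt_in_derived]) auto
    ultimately show "g \<in> lower_central G 2"
      unfolding r by (simp add: phi_U phi_V cmt_in_derived subgroup.m_closed[OF lower_central_subgroup])
  qed
qed

lemma K_0: "K 0 = UNIV"
  using range_phi by (auto simp: K_def numeral_2_eq_2)

lemma K_add: "\<lbrakk>f \<in> K i; g \<in> K i\<rbrakk> \<Longrightarrow> f + g \<in> K i"
  by (simp add: K_def phi_add subgroup.m_closed[OF lower_central_subgroup])

lemma K_minus: "f \<in> K i \<Longrightarrow> - f \<in> K i"
  by (simp add: K_def phi_minus subgroup.m_inv_closed[OF lower_central_subgroup])

lemma K_diff: "\<lbrakk>f \<in> K i; g \<in> K i\<rbrakk> \<Longrightarrow> f - g \<in> K i"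
  using K_add[of f i "- g"] K_minus by simp

lemma K_zero [simp]: "0 \<in> K i"
  by (simp add: K_def subgroup.one_closed[OF lower_central_subgroup])

lemma K_mult: "f \<in> K i \<Longrightarrow> r * f \<in> K i"
  by (simp add: K_def phi_normal[OF lower_central_normal])

lemma K_mult_right: "f \<in> K i \<Longrightarrow> f * r \<in> K i"
  using K_mult[of f i r] by (simp add: mult.commute)

lemma I_subset_K: "f \<in> I \<Longrightarrow> f \<in> K i"
  by (simp add: I_def K_def subgroup.one_closed[OF lower_central_subgroup])

lemma K_antimono: "i \<le> j \<Longrightarrow> f \<in> K j \<Longrightarrow> f \<in> K i"
  using lower_central_antimono[of "Suc (Suc i)" "Suc (Suc j)"] by (auto simp: K_def)

lemma phi_image_K: "\<Phi> ` K i = lower_central G (Suc (Suc i))"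
proof -
  have "lower_central G (Suc (Suc i)) \<subseteq> range \<Phi>"
    unfolding range_phi by (rule lower_central_antimono) simp
  then show ?thesis by (auto simp: K_def)
qed

lemma K_U: "f \<in> K i \<Longrightarrow> U * f \<in> K (Suc i)"
  by (simp add: K_def phi_U)
     (rule cmt_swap_mem[OF lower_central_subgroup _ _ cmt_lower_central], auto)

lemma K_V: "f \<in> K i \<Longrightarrow> V * f \<in> K (Suc i)"
  by (simp add: K_def phi_V)
     (rule cmt_swap_mem[OF lower_central_subgroup _ _ cmt_lower_central], auto)

text \<open>The module is generated in degree 0. The ideal of combinations of \<open>U\<close> and
  \<open>V\<close> with coefficients in \<open>K i\<close> has a normal image, and \<open>x\<close>,
  \<open>y\<close> centralize the preceding term modulo it; hence so does all of G.\<close>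

lemma K_Suc_decomp:
  assumes "f \<in> K (Suc i)"
  shows "\<exists>g\<in>K i. \<exists>h\<in>K i. f - (U * g + V * h) \<in> I"
proof -
  let ?S = "{U * g + V * h |g h. g \<in> K i \<and> h \<in> K i}"
  have N: "\<Phi> ` ?S \<lhd> G"
  proof (rule phi_image_normal)
    fix f g assume "f \<in> ?S" "g \<in> ?S"
    then obtain f1 f2 g1 g2 where *: "f = U * f1 + V * f2" "g = U * g1 + V * g2"
      "f1 \<in> K i" "f2 \<in> K i" "g1 \<in> K i" "g2 \<in> K i" by auto
    then have "f + g = U * (f1 + g1) + V * (f2 + g2)" by (simp add: algebra_simps)
    then show "f + g \<in> ?S" using * K_add by blast
  next
    fix f r assume "f \<in> ?S"
    then obtain f1 f2 where *: "f = U * f1 + V * f2" "f1 \<in> K i" "f2 \<in> K i" by auto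
    then have "r * f = U * (r * f1) + V * (r * f2)" by (simp add: algebra_simps)
    then show "r * f \<in> ?S" using * K_mult by blast
  next
    show "0 \<in> ?S" by (auto intro!: exI[of _ 0])
  qed
  note N' = normal_subgroup[OF N]
  let ?L = "lower_central G (Suc (Suc i))"
  have Lc: "?L \<subseteq> carrier G" using lower_central_carrier by auto
  have "carrier G \<subseteq> {g \<in> carrier G. \<forall>h\<in>?L. cmt g h \<in> \<Phi> ` ?S}"
  proof (rule generated_subset[OF gen subgroup_centralizer_mod[OF N Lc]])
    have "cmt x m \<in> \<Phi> ` ?S" "cmt y m \<in> \<Phi> ` ?S" if m: "m \<in> ?L" for m
    proof -
      obtain f where f: "f \<in> K i" "m = \<Phi> f" using m unfolding phi_image_K[symmetric] by auto
      have "U * f + V * 0 \<in> ?S" "U * 0 + V * f \<in> ?S" using f K_zero by blast+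
      then show "cmt x m \<in> \<Phi> ` ?S" "cmt y m \<in> \<Phi> ` ?S" using f phi_U[of f] phi_V[of f] by force+
    qed
    then show "{x, y} \<subseteq> {g \<in> carrier G. \<forall>h\<in>?L. cmt g h \<in> \<Phi> ` ?S}" by auto
  qed
  then have "cmt h g \<in> \<Phi> ` ?S" if "g \<in> carrier G" "h \<in> ?L" for g h
    using that Lc cmt_swap_mem[OF N', of g h] by auto
  then have "lower_central G (Suc (Suc (Suc i))) \<subseteq> \<Phi> ` ?S"
    unfolding lower_central_Suc[of "Suc i"] by (intro generate_subgroup_incl[OF _ N']) auto
  then have "\<Phi> f \<in> \<Phi> ` ?S" using assms by (auto simp: K_def)
  then obtain g h where "g \<in> K i" "h \<in> K i" "\<Phi> f = \<Phi> (U * g + V * h)" by auto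
  then show ?thesis unfolding phi_eq_iff I_def by blast
qed

text \<open>The filtration is multiplicative: the first factor is peeled off into multiples of
  \<open>U\<close> and \<open>V\<close>, each raising the degree by one.\<close>

lemma K_mult_add: "\<lbrakk>f \<in> K i; g \<in> K j\<rbrakk> \<Longrightarrow> f * g \<in> K (i + j)"
proof (induction i arbitrary: f)
  case 0
  then show ?case by (simp add: K_mult)
next
  case (Suc i)
  obtain u v where uv: "u \<in> K i" "v \<in> K i" "f - (U * u + V * v) \<in> I"
    using K_Suc_decomp[OF Suc(2)] by auto
  have "f * g = U * (u * g) + V * (v * g) + g * (f - (U * u + V * v))" by (simp add: algebra_simps)
  moreover have "U * (u * g) \<in> K (Suc (i + j))" "V * (v * g) \<in> K (Suc (i + j))"
    using Suc uv by (auto intro!: K_U K_V)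
  moreover have "g * (f - (U * u + V * v)) \<in> K (Suc (i + j))"
    using uv(3) I_mult I_subset_K by blast
  ultimately show ?case by (simp add: K_add)
qed

lemma U_in_K [simp]: "U \<in> K (Suc 0)" and V_in_K [simp]: "V \<in> K (Suc 0)"
  using K_U[of 1 0] K_V[of 1 0] by (auto simp: K_0)

lemma K_power: "f \<in> K (Suc 0) \<Longrightarrow> f ^ n \<in> K n"
  by (induction n) (use K_0 K_mult_add[of f "Suc 0"] in auto)

lemma aug_K: "f \<in> aug \<Longrightarrow> f \<in> K (Suc 0)"
  by (auto simp: aug_def intro!: K_add K_mult_right)

lemma decomp_int: "\<exists>n. r - of_int n \<in> K (Suc 0)"
proof -
  obtain n f g where "r = of_int n + U * f + V * g" using decomp[of r] by (auto simp: U_def V_def)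
  then have "r - of_int n = U * f + V * g" by simp
  then show ?thesis using augI aug_K by metis
qed

section \<open>Powers, commutators and directions\<close>

lemma cmt_pow:
  fixes n :: nat
  assumes "acts g r" "h \<in> carrier G" "cmt g h = \<Phi> e"
  shows "cmt (g [^] n) h = \<Phi> ((\<Sum>k<n. r ^ k) * e)"
proof (induction n)
  case 0
  then show ?case using assms by (simp add: cmt_def)
next
  case (Suc n)
  have g: "g \<in> carrier G" using assms by (simp add: acts_closed)
  have "cmt (g [^] Suc n) h = g [^] n \<otimes> \<Phi> e \<otimes> inv (g [^] n) \<otimes> cmt (g [^] n) h"
    using g assms by (simp add: cmt_mult_left)
  also have "\<dots> = \<Phi> (r ^ n * e + (\<Sum>k<n. r ^ k) * e)"
    using acts_pow[OF assms(1), of n] Suc by (simp add: acts_def phi_add)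
  finally show ?case by (simp add: algebra_simps)
qed

text \<open>Collecting moves \<open>\<Phi> u\<close> past each power of g, where it becomes r^k u.
  For n = p the sum decides whether the power depends only on the coset of M.\<close>

lemma phi_mult_pow:
  fixes n :: nat
  assumes "acts g r"
  shows "(\<Phi> u \<otimes> g) [^] n = \<Phi> ((\<Sum>k<n. r ^ k) * u) \<otimes> g [^] n"
proof (induction n)
  case (Suc n)
  have g: "g \<in> carrier G" using assms by (simp add: acts_closed)
  have "(\<Phi> u \<otimes> g) [^] Suc n = \<Phi> ((\<Sum>k<n. r ^ k) * u) \<otimes> (g [^] n \<otimes> \<Phi> u \<otimes> inv (g [^] n)) \<otimes> g [^] Suc n"
    using g Suc by (simp add: m_assoc)
  also have "\<dots> = \<Phi> ((\<Sum>k<n. r ^ k) * u + r ^ n * u) \<otimes> g [^] Suc n"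
    using acts_pow[OF assms(1), of n] by (simp add: acts_def phi_add)
  finally show ?case by (simp add: algebra_simps)
qed (use assms acts_closed in auto)

text \<open>To first order, the operator of x^s y^t minus 1 is linear in s and t.\<close>

lemma acts_direction:
  "\<exists>j. acts (x [^] s \<otimes> y [^] t) (1 + j) \<and> j - (of_nat s * U + of_nat t * V) \<in> K 2" for s t :: nat
proof -
  obtain u where u: "a ^ s = 1 + of_nat s * U + U * U * u"
    using one_plus_power_expand[of U s] by (auto simp: U_def)
  obtain v where v: "b ^ t = 1 + of_nat t * V + V * V * v"
    using one_plus_power_expand[of V t] by (auto simp: V_def)
  have "acts (x [^] s \<otimes> y [^] t) (a ^ s * b ^ t)"
    by (intro acts_mult acts_pow acts_x acts_y)
  moreover have "a ^ s * b ^ t - 1 - (of_nat s * U + of_nat t * V) =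
     U * U * u + V * V * v + U * (of_nat s + U * u) * (V * (of_nat t + V * v))"
    by (simp add: u v algebra_simps)
  moreover have "U * U * u \<in> K 2" "V * V * v \<in> K 2" "U * (of_nat s + U * u) * (V * (of_nat t + V * v)) \<in> K 2"
    using K_mult_add[of U "Suc 0" "U * u" "Suc 0"] K_mult_add[of V "Suc 0" "V * v" "Suc 0"]
      K_mult_add[of "U * (of_nat s + U * u)" "Suc 0" "V * (of_nat t + V * v)" "Suc 0"]
    by (auto simp: K_mult_right numeral_2_eq_2 mult.assoc)
  ultimately show ?thesis
    by (intro exI[of _ "a ^ s * b ^ t - 1"]) (simp add: K_add)
qed

text \<open>\<open>dir g s t\<close> says \<open>g \<in> x\<^sup>s y\<^sup>t M\<close>, so it determines \<open>s\<close> and \<open>t\<close> only modulo \<open>p\<close>.\<close>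

definition dir :: "'a \<Rightarrow> nat \<Rightarrow> nat \<Rightarrow> bool" where
  "dir g s t \<longleftrightarrow> (\<exists>f. g = \<Phi> f \<otimes> (x [^] s \<otimes> y [^] t))"

lemma dir_closed: "dir g s t \<Longrightarrow> g \<in> carrier G"
  by (auto simp: dir_def)

lemma dir_acts:
  assumes "dir g s t"
  shows "\<exists>j. acts g (1 + j) \<and> j - (of_nat s * U + of_nat t * V) \<in> K 2"
proof -
  obtain f where f: "g = \<Phi> f \<otimes> (x [^] s \<otimes> y [^] t)" using assms by (auto simp: dir_def)
  then show ?thesis using acts_direction[of s t] acts_mult[OF acts_phi, of _ _ f] by fastforce
qed

lemma phi_swap: "g \<in> carrier G \<Longrightarrow> \<exists>f'. g \<otimes> \<Phi> f = \<Phi> f' \<otimes> g"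
proof -
  assume g: "g \<in> carrier G"
  then obtain j where "acts g (1 + j)" using exists_acts by auto
  then have "\<Phi> ((1 + j) * f) = g \<otimes> \<Phi> f \<otimes> inv g" by (simp add: acts_def)
  then have "\<Phi> ((1 + j) * f) \<otimes> g = g \<otimes> \<Phi> f" using g by (simp add: m_assoc)
  then show ?thesis by metis
qed

lemma cmt_phi: "\<lbrakk>g \<in> carrier G; h \<in> carrier G\<rbrakk> \<Longrightarrow> \<exists>e. cmt g h = \<Phi> e"
  using cmt_in_derived range_phi by (metis imageE)

lemma mult_swap:
  assumes "g \<in> carrier G" "h \<in> carrier G" shows "\<exists>f. g \<otimes> h = \<Phi> f \<otimes> (h \<otimes> g)"
proof -
  obtain e where "cmt g h = \<Phi> e" using cmt_phi assms by blast
  then have "g \<otimes> h = \<Phi> e \<otimes> (h \<otimes> g)" using assms by (simp add: cmt_def m_assoc flip: \<open>cmt g h = \<Phi> e\<close>)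
  then show ?thesis by blast
qed

lemma dir_mult:
  assumes "dir g s t" "dir h s' t'" shows "dir (g \<otimes> h) (s + s') (t + t')"
proof -
  obtain f where f: "g = \<Phi> f \<otimes> (x [^] s \<otimes> y [^] t)" using assms by (auto simp: dir_def)
  obtain f' where f': "h = \<Phi> f' \<otimes> (x [^] s' \<otimes> y [^] t')" using assms by (auto simp: dir_def)
  obtain f2 where f2: "(x [^] s \<otimes> y [^] t) \<otimes> \<Phi> f' = \<Phi> f2 \<otimes> (x [^] s \<otimes> y [^] t)"
    using phi_swap[of "x [^] s \<otimes> y [^] t" f'] by auto
  obtain e where e: "y [^] t \<otimes> x [^] s' = \<Phi> e \<otimes> (x [^] s' \<otimes> y [^] t)" using mult_swap[of "y [^] t" "x [^] s'"] by auto
  obtain e2 where e2: "x [^] s \<otimes> \<Phi> e = \<Phi> e2 \<otimes> x [^] s" using phi_swap[of "x [^] s" e] by auto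
  have "g \<otimes> h = \<Phi> f \<otimes> ((x [^] s \<otimes> y [^] t) \<otimes> \<Phi> f') \<otimes> (x [^] s' \<otimes> y [^] t')"
    by (simp add: f f' m_assoc)
  also have "\<dots> = \<Phi> f \<otimes> \<Phi> f2 \<otimes> (x [^] s \<otimes> (y [^] t \<otimes> x [^] s') \<otimes> y [^] t')"
    unfolding f2 by (simp add: m_assoc)
  also have "\<dots> = \<Phi> f \<otimes> \<Phi> f2 \<otimes> ((x [^] s \<otimes> \<Phi> e) \<otimes> (x [^] s' \<otimes> (y [^] t \<otimes> y [^] t')))"
    unfolding e by (simp add: m_assoc)
  also have "\<dots> = \<Phi> f \<otimes> \<Phi> f2 \<otimes> \<Phi> e2 \<otimes> ((x [^] s \<otimes> x [^] s') \<otimes> (y [^] t \<otimes> y [^] t'))"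
    unfolding e2 by (simp add: m_assoc)
  also have "\<dots> = \<Phi> (f + f2 + e2) \<otimes> (x [^] (s + s') \<otimes> y [^] (t + t'))"
    by (simp add: phi_add nat_pow_mult)
  finally show ?thesis unfolding dir_def by blast
qed

lemma dir_phi: "dir (\<Phi> f) 0 0"
  by (auto simp: dir_def)

lemma dir_x: "dir x (Suc 0) 0" and dir_y: "dir y 0 (Suc 0)"
  by (auto simp: dir_def intro!: exI[of _ 0])

lemma dir_xy: "dir (x [^] s \<otimes> y [^] t) s t"
  by (auto simp: dir_def intro!: exI[of _ 0])

lemma dir_pow: "dir g s t \<Longrightarrow> dir (g [^] n) (n * s) (n * t)" for n :: nat
proof (induction n)
  case 0
  then show ?case using dir_phi[of 0] by simp
next
  case (Suc n)
  then show ?case using dir_mult[of "g [^] n" "n * s" "n * t" g s t] by (simp add: add.commute)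
qed

lemma dir_exists:
  assumes "g \<in> carrier G" shows "\<exists>s t. dir g s t"
proof -
  let ?A = "{g. \<exists>s t. dir g s t}"
  have "subgroup ?A G"
  proof (rule subgroupI)
    show "?A \<noteq> {}" using dir_phi by blast
    show "?A \<subseteq> carrier G" using dir_closed by blast
    fix g assume g: "g \<in> ?A"
    then show "inv g \<in> ?A" using inv_eq_pow[of g] dir_closed dir_pow by fastforce
    fix h assume "h \<in> ?A"
    then show "g \<otimes> h \<in> ?A" using g dir_mult by blast
  qed
  moreover have "{x, y} \<subseteq> ?A" using dir_x dir_y by auto
  ultimately show ?thesis using generated_subset[OF gen] assms by blast
qed

end

section \<open>Thin metabelian groups\<close>

text \<open>Meant for element orders in G/M, whose index is a power of p at most p^2: an order
  different from the index divides p.\<close>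

lemma prime_power_cases_le_square:
  fixes p j m :: nat
  assumes p: "Factorial_Ring.prime p" and "p ^ j \<le> p\<^sup>2" "m dvd p ^ j" "m \<noteq> p ^ j"
  shows "m dvd p"
proof -
  have "p > 1" using p prime_gt_1_nat by auto
  then have "j \<le> 2" using assms(2) power_le_imp_le_exp by blast
  obtain i where i: "i \<le> j" "m = p ^ i"
    using divides_primepow_nat[OF p] assms(3) by blast
  then have "i \<noteq> j" using assms(4) by auto
  then have "i \<le> 1" using i \<open>j \<le> 2\<close> by linarith
  then show ?thesis using i by (metis le_imp_power_dvd power_one_right)
qed

context group
begin

lemma mem_subgroup_of_coprime_powers:
  assumes H: "subgroup H G" and g: "g \<in> carrier G" and "g [^] (m::nat) \<in> H" "g [^] (n::nat) \<in> H"
    and "coprime m n"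
  shows "g \<in> H"
proof -
  obtain u v where uv: "u * int m + v * int n = 1"
    using bezout_int[of "int m" "int n"] assms(5) by auto
  have "g [^] (int m * u) \<in> H" "g [^] (int n * v) \<in> H"
    using subgroup_int_pow_closed[OF H assms(3), of u] subgroup_int_pow_closed[OF H assms(4), of v] g
    by (auto simp: int_pow_pow int_pow_int[symmetric])
  then have "g [^] (int m * u + int n * v) \<in> H"
    using g subgroup.m_closed[OF H] by (simp add: int_pow_mult)
  then show ?thesis using uv g by (simp add: mult.commute)
qed

end

section \<open>Nilpotency, generators and the index of the derived subgroup\<close>

locale thin_metabelian = group G for G (structure) +
  fixes p :: nat
  assumes thin: "thin_p_group p G" and metab: "metabelian G"
begin

abbreviation M :: "'a set" where "M \<equiv> lower_central G 2"

definition C :: nat where "C = nilpotency_class G"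

lemma prime_p: "Factorial_Ring.prime p" and fin_G: "finite (carrier G)"
  using thin by (auto simp: thin_p_group_def finite_p_group_def)

lemma p_gt_1: "p > 1"
  using prime_p prime_gt_1_nat by auto

lemma order_p_power: "\<exists>n. Coset.order G = p ^ n"
  using thin by (auto simp: thin_p_group_def finite_p_group_def)

lemma thin_normal: "N \<lhd> G \<Longrightarrow> \<exists>i\<ge>1. lower_central G (Suc i) \<subseteq> N \<and> N \<subseteq> lower_central G i"
  using thin by (auto simp: thin_p_group_def)

lemma thin_index: "i \<ge> 1 \<Longrightarrow> subgroup_index G (lower_central G i) (lower_central G (Suc i)) \<le> p\<^sup>2"
  using thin by (auto simp: thin_p_group_def)

lemma M_comm: "\<lbrakk>m \<in> M; n \<in> M\<rbrakk> \<Longrightarrow> m \<otimes> n = n \<otimes> m"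
  using metab comm_monoid.m_comm[of "G\<lparr>carrier := M\<rparr>" m n]
  by (simp add: metabelian_def derived_eq_lower_central comm_group_def)

text \<open>Thinness for the trivial normal subgroup makes some term trivial, so the minimum
  defining the class is attained.\<close>

lemma lower_central_C: "lower_central G (Suc C) = {\<one>}"
proof -
  have "{\<one>} \<lhd> G" by (auto simp: normal_inv_iff triv_subgroup)
  then obtain i where "lower_central G (Suc i) \<subseteq> {\<one>}" using thin_normal by blast
  then have "lower_central G (Suc i) = {\<one>}"
    using subgroup.one_closed[OF lower_central_subgroup, of "Suc i"] by auto
  then show ?thesis unfolding C_def nilpotency_class_def by (rule LeastI)
qed

lemma lower_central_nontrivial: "i < C \<Longrightarrow> lower_central G (Suc i) \<noteq> {\<one>}"
  unfolding C_def nilpotency_class_def by (rule not_less_Least)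

lemma M_subgroup: "subgroup M G" and M_normal: "M \<lhd> G"
  by (rule lower_central_subgroup lower_central_normal)+

lemma M_carrier: "m \<in> M \<Longrightarrow> m \<in> carrier G"
  by (rule lower_central_carrier)

lemma generate_mod_M:
  assumes S: "S \<subseteq> carrier G" and gen: "generate G (S \<union> M) = carrier G"
  shows "generate G S = carrier G"
proof (rule supplement_of_derived[OF lower_central_C generate_is_subgroup[OF S]])
  let ?N = "{h \<otimes> n |h n. h \<in> generate G S \<and> n \<in> M}"
  have N: "subgroup ?N G"
    by (rule subgroup_mult_normal[OF generate_is_subgroup[OF S] M_normal])
  have "S \<subseteq> ?N"
  proof
    fix s assume "s \<in> S"
    then have "s = s \<otimes> \<one>" "s \<in> generate G S" using S by (auto intro: generate.incl)
    then show "s \<in> ?N" using subgroup.one_closed[OF M_subgroup] by blast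
  qed
  moreover have "M \<subseteq> ?N"
  proof
    fix m assume "m \<in> M"
    then have "m = \<one> \<otimes> m" "m \<in> M" using M_carrier by auto
    then show "m \<in> ?N" using generate.one by blast
  qed
  ultimately have "carrier G \<subseteq> ?N"
    using generated_subset[OF gen N] by blast
  then show "\<exists>h\<in>generate G S. \<exists>m\<in>M. g = h \<otimes> m" if "g \<in> carrier G" for g
    using that by blast
qed

lemma not_cyclic_mod_M:
  assumes "g \<in> carrier G" shows "generate G (insert g M) \<noteq> carrier G"
proof
  assume "generate G (insert g M) = carrier G"
  then have "generate G {g} = carrier G" using generate_mod_M[of "{g}"] assms by simp
  then have "cyclic_group G"
    unfolding cyclic_group using assms generate_pow[OF assms] by (intro bexI[of _ g]) (auto simp: full_SetCompr_eq)
  then show False using thin by (simp add: thin_p_group_def)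
qed

lemma card_rcosets_M_le: "card (rcosets M) \<le> p\<^sup>2"
proof -
  have "G\<lparr>carrier := carrier G\<rparr> = G" by simp
  then show ?thesis using thin_index[of 1] by (simp add: subgroup_index_def numeral_2_eq_2)
qed

lemma card_rcosets_M_dvd: "\<exists>j. card (rcosets M) = p ^ j"
proof -
  obtain n where "Coset.order G = p ^ n" using order_p_power by blast
  then have "card (rcosets M) dvd p ^ n" using lagrange[OF M_subgroup] by (metis dvd_triv_left)
  then show ?thesis using divides_primepow_nat[OF prime_p] by blast
qed

text \<open>A coset whose order is the index would make G/M, hence G, cyclic. All orders therefore
  divide p, and an index below p^2 is contradictory.\<close>

lemma pow_p_M_and_index: "(\<forall>g\<in>carrier G. g [^] p \<in> M) \<and> card (rcosets M) = p\<^sup>2"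
proof -
  let ?Q = "G Mod M"
  interpret Q: group ?Q using M_normal by (rule normal.factorgroup_is_group)
  have h: "group_hom G ?Q (\<lambda>g. M #> g)"
    using normal.r_coset_hom_Mod[OF M_normal] by (simp add: group_hom_def group_hom_axioms_def Q.is_group is_group)
  have ordQ: "Coset.order ?Q = card (rcosets M)" by (simp add: Coset.order_def FactGroup_def)
  obtain j where j: "card (rcosets M) = p ^ j" using card_rcosets_M_dvd by blast
  have finQ: "finite (carrier ?Q)" using ordQ j p_gt_1 by (metis card.infinite Coset.order_def power_not_zero not_one_less_zero)
  have carr: "M #> g \<in> carrier ?Q" if "g \<in> carrier G" for g
    using that by (auto simp: FactGroup_def RCOSETS_def)
  have ne: "Q.ord (M #> g) \<noteq> p ^ j" if g: "g \<in> carrier G" for g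
  proof
    assume "Q.ord (M #> g) = p ^ j"
    then have "card (generate ?Q {M #> g}) = card (carrier ?Q)"
      using Q.generate_pow_card[OF carr[OF g]] ordQ j by (simp add: Coset.order_def)
    then have all: "generate ?Q {M #> g} = carrier ?Q"
      using Q.generate_incl[of "{M #> g}"] carr[OF g] by (intro card_subset_eq finQ) auto
    have "carrier G \<subseteq> generate G (insert g M)"
    proof
      fix u assume u: "u \<in> carrier G"
      obtain k :: int where "M #> u = (M #> g) [^]\<^bsub>?Q\<^esub> k"
        using carr[OF u] unfolding all[symmetric] Q.generate_pow[OF carr[OF g]] by blast
      then have "M #> u = M #> (g [^] k)"
        using group_hom.hom_int_pow[OF h g] by simp
      then have "u \<in> M #> (g [^] k)" using rcos_self[OF u M_subgroup] by simp
      then obtain m where m: "m \<in> M" "u = m \<otimes> g [^] k" by (auto simp: r_coset_def)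
      have sg: "subgroup (generate G (insert g M)) G"
        using g M_carrier by (intro generate_is_subgroup) auto
      have "g \<in> generate G (insert g M)" "m \<in> generate G (insert g M)" using m by (auto intro: generate.incl)
      then show "u \<in> generate G (insert g M)"
        unfolding m(2) by (intro subgroup.m_closed[OF sg] subgroup_int_pow_closed[OF sg])
    qed
    moreover have "generate G (insert g M) \<subseteq> carrier G"
      using g M_carrier by (intro generate_incl) auto
    ultimately show False using not_cyclic_mod_M[OF g] by blast
  qed
  have pow: "(M #> g) [^]\<^bsub>?Q\<^esub> p = \<one>\<^bsub>?Q\<^esub>" and ord: "Q.ord (M #> g) dvd p" if g: "g \<in> carrier G" for g
  proof -
    have "Q.ord (M #> g) dvd p ^ j"
      using Q.ord_dvd_group_order[OF carr[OF g]] ordQ j by simp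
    then show "Q.ord (M #> g) dvd p"
      using prime_power_cases_le_square[OF prime_p _ _ ne[OF g]] card_rcosets_M_le j by simp
    then show "(M #> g) [^]\<^bsub>?Q\<^esub> p = \<one>\<^bsub>?Q\<^esub>"
      using Q.pow_eq_id[OF carr[OF g]] by simp
  qed
  have "g [^] p \<in> M" if g: "g \<in> carrier G" for g
  proof -
    have "M #> (g [^] p) = M"
      using group_hom.hom_nat_pow[OF h g, of p] pow[OF g] by (simp add: FactGroup_def)
    then show ?thesis using rcos_self[OF _ M_subgroup, of "g [^] p"] g by simp
  qed
  moreover have "p ^ j = p\<^sup>2"
  proof (rule ccontr)
    assume j2: "p ^ j \<noteq> p\<^sup>2"
    have "p ^ j \<le> p ^ 2" using card_rcosets_M_le j by simp
    then have "j \<le> 2" using power_le_imp_le_exp p_gt_1 by blast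
    then have "j = 0 \<or> j = 1" using j2 by (cases "j = 2") auto
    then show False
    proof
      \<comment> \<open>Index p: every order is a proper divisor of p, so all cosets are
        trivial.\<close>
      assume "j = 1"
      then have "Q.ord (M #> g) = 1" if "g \<in> carrier G" for g
        using ord[OF that] ne[OF that] prime_p by (simp add: prime_nat_iff) blast
      then have "carrier ?Q \<subseteq> {\<one>\<^bsub>?Q\<^esub>}"
        using Q.ord_eq_1[of "M #> _"] carr by (fastforce simp: FactGroup_def RCOSETS_def)
      then have "card (carrier ?Q) \<le> 1" using card_mono[of "{\<one>\<^bsub>?Q\<^esub>}"] by simp
      then show False using \<open>j = 1\<close> ordQ j p_gt_1 by (simp add: Coset.order_def)
    next
      \<comment> \<open>Index 1: the identity coset has order equal to the index, which
        \<open>ne\<close> excludes.\<close>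
      assume "j = 0"
      then have "Q.ord (M #> \<one>) dvd 1"
        using Q.ord_dvd_group_order[OF carr[OF one_closed]] ordQ j by simp
      then show False using ne[OF one_closed] \<open>j = 0\<close> by simp
    qed
  qed
  ultimately show ?thesis using j by simp
qed

lemma pow_p_in_M: "g \<in> carrier G \<Longrightarrow> g [^] p \<in> M"
  using pow_p_M_and_index by blast

lemma order_eq: "Coset.order G = p\<^sup>2 * card M"
  using lagrange[OF M_subgroup] pow_p_M_and_index by simp

lemma finite_sub: "subgroup H G \<Longrightarrow> finite H"
  using subgroup.subset fin_G finite_subset by metis

lemma card_subgroup_power: "subgroup H G \<Longrightarrow> \<exists>i. card H = p ^ i"
proof -
  assume H: "subgroup H G"
  obtain n where "Coset.order G = p ^ n" using order_p_power by blast
  then have "card H dvd p ^ n" using lagrange[OF H] by (metis dvd_triv_right)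
  then show ?thesis using divides_primepow_nat[OF prime_p] by blast
qed

lemma card_proper_subgroup:
  assumes "subgroup H G" "subgroup L G" "H \<subset> L" shows "p * card H \<le> card L"
proof -
  obtain i j where ij: "card H = p ^ i" "card L = p ^ j" using assms card_subgroup_power by blast
  have "card H < card L" using assms finite_sub psubset_card_mono by blast
  then have "i < j" using ij p_gt_1 by (simp add: power_strict_increasing_iff)
  then have "p ^ Suc i \<le> p ^ j" using p_gt_1 by (intro power_increasing) auto
  then show ?thesis using ij by simp
qed

text \<open>Each adjoined element multiplies the order by at least p, and M has index p^2.\<close>

lemma two_generators: "\<exists>x\<in>carrier G. \<exists>y\<in>carrier G. generate G {x, y} = carrier G"
proof -
  have "M \<noteq> carrier G"
  proof
    assume "M = carrier G"
    then have "generate G (insert \<one> M) = carrier G"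
      using generate_incl[of "insert \<one> M"] generate.incl[of _ "insert \<one> M" G] by auto
    then show False using not_cyclic_mod_M by blast
  qed
  then obtain x where x: "x \<in> carrier G" "x \<notin> M" using M_carrier by blast
  let ?A = "generate G (insert x M)"
  have A: "subgroup ?A G" using x M_carrier by (intro generate_is_subgroup) auto
  have "?A \<noteq> carrier G" using not_cyclic_mod_M x by blast
  then obtain y where y: "y \<in> carrier G" "y \<notin> ?A" using subgroup.subset[OF A] by blast
  let ?B = "generate G ({x, y} \<union> M)"
  have B: "subgroup ?B G" using x y M_carrier by (intro generate_is_subgroup) auto
  have "M \<subset> ?A" using x by (auto intro: generate.incl)
  then have "p * card M \<le> card ?A" using card_proper_subgroup M_subgroup A by blast
  moreover have "?A \<subset> ?B"
    using y x M_carrier mono_generate[of "insert x M" "{x, y} \<union> M"] generate.incl[of y "{x, y} \<union> M" G] by auto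
  then have "p * card ?A \<le> card ?B" using card_proper_subgroup A B by blast
  ultimately have "p * (p * card M) \<le> card ?B"
    by (meson dual_order.trans mult_le_mono2)
  then have "card (carrier G) \<le> card ?B" using order_eq by (simp add: Coset.order_def power2_eq_square mult.assoc)
  then have "?B = carrier G"
    using subgroup.subset[OF B] by (intro card_seteq fin_G) auto
  then show ?thesis using generate_mod_M[of "{x, y}"] x y by auto
qed

text \<open>If p does not divide t, then y^t and y^p lie in the subgroup generated by x and M, hence
  so does y, and G is cyclic modulo M.\<close>

lemma generators_independent:
  fixes s t :: nat
  assumes xy: "x \<in> carrier G" "y \<in> carrier G" and gen: "generate G {x, y} = carrier G"
    and m: "x [^] s \<otimes> y [^] t \<in> M"
  shows "p dvd s \<and> p dvd t"
proof -
  have aux: "p dvd t"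
    if uv: "u \<in> carrier G" "v \<in> carrier G" "{u, v} = {x, y}" and "v [^] t \<in> generate G (insert u M)"
    for u v and t :: nat
  proof (rule ccontr)
    assume "\<not> p dvd t"
    then have cop: "coprime t p" using prime_p prime_imp_coprime[of p t] by (simp add: coprime_commute)
    let ?A = "generate G (insert u M)"
    have A: "subgroup ?A G" using uv M_carrier by (intro generate_is_subgroup) auto
    have "v [^] p \<in> ?A" using pow_p_in_M[OF uv(2)] by (auto intro: generate.incl)
    then have "v \<in> ?A" using mem_subgroup_of_coprime_powers[OF A uv(2) that(4) _ cop] by simp
    moreover have "u \<in> ?A" by (auto intro: generate.incl)
    ultimately have "{x, y} \<subseteq> ?A" unfolding uv(3)[symmetric] by simp
    then have "carrier G \<subseteq> ?A" by (rule generated_subset[OF gen A])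
    then show False using not_cyclic_mod_M[OF uv(1)] subgroup.subset[OF A] by blast
  qed
  have Ax: "subgroup (generate G (insert x M)) G" and Ay: "subgroup (generate G (insert y M)) G"
    using xy M_carrier by (auto intro!: generate_is_subgroup)
  have powx: "x [^] s \<in> generate G (insert x M)" and powy: "y [^] t \<in> generate G (insert y M)"
    using subgroup_int_pow_closed[OF Ax, of x "int s"] subgroup_int_pow_closed[OF Ay, of y "int t"]
    by (auto simp: int_pow_int intro: generate.incl)
  have "y [^] t = inv (x [^] s) \<otimes> (x [^] s \<otimes> y [^] t)" using xy by simp
  moreover have "x [^] s \<otimes> y [^] t \<in> generate G (insert x M)" using m by (auto intro: generate.incl)
  ultimately have "y [^] t \<in> generate G (insert x M)"
    using powx subgroup.m_closed[OF Ax] subgroup.m_inv_closed[OF Ax] by metis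
  then have 1: "p dvd t" using aux[of x y] xy by blast
  have "x [^] s = (x [^] s \<otimes> y [^] t) \<otimes> inv (y [^] t)" using xy by (simp add: m_assoc)
  moreover have "x [^] s \<otimes> y [^] t \<in> generate G (insert y M)" using m by (auto intro: generate.incl)
  ultimately have "x [^] s \<in> generate G (insert y M)"
    using powy subgroup.m_closed[OF Ay] subgroup.m_inv_closed[OF Ay] by metis
  then have "p dvd s" using aux[of y x] xy by blast
  with 1 show ?thesis by blast
qed

end

text \<open>Division modulo p; the quotient is natural because it often serves as an exponent in the
  group.\<close>

lemma exists_mod_solution:
  fixes p :: nat and v u :: int
  assumes "Factorial_Ring.prime p" "\<not> int p dvd v"
  obtains l :: nat where "int p dvd v * int l - u"
proof -
  have "coprime v (int p)" using assms by (metis coprime_commute prime_imp_coprime prime_nat_int_transfer)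
  then obtain w where w: "[v * w = 1] (mod int p)" using cong_solve_coprime_int by blast
  define l where "l = nat (w * u mod int p)"
  have l: "int l = w * u mod int p" using assms(1) prime_gt_0_nat by (simp add: l_def)
  have "[v * int l = v * (w * u)] (mod int p)" unfolding l by (intro cong_mult) (auto simp: cong_def)
  also have "[v * (w * u) = 1 * u] (mod int p)" unfolding mult.assoc[symmetric] using w by (intro cong_mult) auto
  finally show ?thesis using that[of l] by (simp add: cong_iff_dvd_diff)
qed

section \<open>The graded module of a thin group\<close>

locale thin_action = metabelian_action G x y \<Phi> a b + thin_metabelian G p
  for G (structure) and x y :: 'a and \<Phi> :: "'r::comm_ring_1 \<Rightarrow> 'a" and a b :: 'r and p :: nat +
  assumes p5: "p \<ge> 5" and nonmax: "\<not> maximal_class p G"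
    and cls: "nilpotency_class G = p \<or> nilpotency_class G = p + 1"
begin

lemma C_cases: "C = p \<or> C = Suc p"
  using cls by (auto simp: C_def)

lemma C_ge: "C \<ge> 5"
  using C_cases p5 by auto

text \<open>The shift by two against the lower central series makes \<open>K (C - 2)\<close> the
  last nontrivial term and \<open>K (C - 1)\<close> the annihilator.\<close>

lemma K_C: "C \<le> Suc i \<Longrightarrow> f \<in> K i \<Longrightarrow> f \<in> I"
  using lower_central_C lower_central_antimono[of "Suc C" "Suc (Suc i)"] by (auto simp: K_def I_def)

lemma K_nontrivial: "Suc i < C \<Longrightarrow> \<exists>f\<in>K i. f \<notin> I"
proof -
  assume "Suc i < C"
  then have "lower_central G (Suc (Suc i)) \<noteq> {\<one>}" by (rule lower_central_nontrivial)
  then obtain g where "g \<in> lower_central G (Suc (Suc i))" "g \<noteq> \<one>"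
    using subgroup.one_closed[OF lower_central_subgroup, of "Suc (Suc i)"] by blast
  then show ?thesis unfolding phi_image_K[symmetric] by (auto simp: I_def)
qed

text \<open>Generation in degree 0 propagates equality: if two consecutive ideals agree, so do all
  later ones, down to the annihilator.\<close>

lemma K_stable:
  assumes "\<And>f. f \<in> K i \<Longrightarrow> f \<in> K (Suc i)" and f: "f \<in> K i" shows "f \<in> I"
proof -
  have step: "f \<in> K (Suc j) \<Longrightarrow> f \<in> K (Suc (Suc j))" if IH: "\<And>f. f \<in> K j \<Longrightarrow> f \<in> K (Suc j)" for j f
  proof -
    assume "f \<in> K (Suc j)"
    then obtain g h where gh: "g \<in> K j" "h \<in> K j" "f - (U * g + V * h) \<in> I" using K_Suc_decomp by blast
    have "f = U * g + V * h + (f - (U * g + V * h))" by simp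
    also have "\<dots> \<in> K (Suc (Suc j))" by (intro K_add K_U K_V I_subset_K[OF gh(3)] IH gh)
    finally show ?thesis .
  qed
  have all: "\<And>f. f \<in> K (i + n) \<Longrightarrow> f \<in> K (Suc (i + n))" for n
    by (induction n) (use assms(1) step in auto)
  have "f \<in> K (i + n)" for n
    by (induction n) (use f all in auto)
  then have "f \<in> K (i + C)" .
  then show ?thesis by (rule K_C[rotated]) simp
qed

lemma K_strict: "Suc i < C \<Longrightarrow> \<exists>f\<in>K i. f \<notin> K (Suc i)"
  using K_nontrivial K_stable by blast

lemma geometric_sum_K:
  assumes "j \<in> K (Suc 0)" shows "(\<Sum>k<n. (1 + j) ^ k) - of_nat n \<in> K (Suc 0)"
proof (induction n)
  case (Suc n)
  obtain u where u: "(1 + j) ^ n = 1 + of_nat n * j + j * j * u" using one_plus_power_expand by blast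
  have "(\<Sum>k<Suc n. (1 + j) ^ k) - of_nat (Suc n) = ((\<Sum>k<n. (1 + j) ^ k) - of_nat n) + j * (of_nat n + j * u)"
    by (simp add: u algebra_simps)
  also have "\<dots> \<in> K (Suc 0)" using Suc assms by (intro K_add K_mult_right)
  finally show ?case .
qed simp

text \<open>Since x^p lies in M, [x^p, y] lies in gamma_3. In the module it is a geometric sum with
  p terms, which is p up to positive degree. Hence multiplication by p raises the degree.\<close>

lemma p_in_K: "of_nat p \<in> K (Suc 0)"
proof -
  obtain w where w: "x [^] p = \<Phi> w" using pow_p_in_M[OF x_closed] range_phi by (metis imageE)
  have "\<Phi> w \<in> lower_central G (Suc (Suc 0))" using K_0 by (auto simp: K_def)
  then have "cmt (x [^] p) y \<in> lower_central G (Suc (Suc (Suc 0)))"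
    unfolding w by (rule cmt_lower_central) simp
  then have s: "(\<Sum>k<p. (1 + U) ^ k) \<in> K (Suc 0)"
    using cmt_pow[OF acts_x y_closed phi_one[symmetric], of p] by (simp add: K_def U_def)
  have "of_nat p = (\<Sum>k<p. (1 + U) ^ k) - ((\<Sum>k<p. (1 + U) ^ k) - of_nat p)" by simp
  also have "\<dots> \<in> K (Suc 0)" using s geometric_sum_K[OF U_in_K] by (rule K_diff)
  finally show ?thesis .
qed

lemma p_K: "f \<in> K i \<Longrightarrow> of_nat p * f \<in> K (Suc i)"
  using K_mult_add[OF p_in_K] by simp

lemma int_dvd_K: "\<lbrakk>int p dvd n; f \<in> K i\<rbrakk> \<Longrightarrow> of_int n * f \<in> K (Suc i)"
proof -
  assume "int p dvd n" "f \<in> K i"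
  then obtain k where "n = int p * k" by auto
  then have "of_int n * f = of_int k * (of_nat p * f)" by (simp add: algebra_simps)
  then show ?thesis using p_K[OF \<open>f \<in> K i\<close>] by (simp add: K_mult)
qed

lemma cancel_coprime:
  assumes n: "\<not> int p dvd n"
  obtains u v :: int where "\<And>f::'r. f = of_int u * (of_int n * f) + of_int v * (of_nat p * f)"
proof -
  have "coprime n (int p)"
    using n prime_p by (metis coprime_commute prime_imp_coprime prime_nat_int_transfer)
  then obtain u v where uv: "u * n + v * int p = 1" using bezout_int[of n "int p"] by auto
  have "f = of_int u * (of_int n * f) + of_int v * (of_nat p * f)" for f :: 'r
  proof -
    have "of_int u * (of_int n * f) + of_int v * (of_nat p * f) = of_int (u * n + v * int p) * f"
      by (simp add: algebra_simps)
    then show ?thesis by (simp add: uv)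
  qed
  then show ?thesis using that by blast
qed

lemma cancel_K: "\<lbrakk>\<not> int p dvd n; of_int n * f \<in> K (Suc i); f \<in> K i\<rbrakk> \<Longrightarrow> f \<in> K (Suc i)"
  by (metis K_add K_mult cancel_coprime p_K)

lemma cancel_I: "\<lbrakk>\<not> int p dvd n; of_int n * f \<in> I; of_nat p * f \<in> I\<rbrakk> \<Longrightarrow> f \<in> I"
  by (metis I_add I_mult cancel_coprime)

text \<open>Thinness in module form: the ideal generated by \<open>f\<close> gives a normal
  subgroup, which contains the whole next term because \<open>f\<close> lies outside it.\<close>

lemma thin_K:
  assumes f: "f \<in> K i" "f \<notin> K (Suc i)" and g: "g \<in> K (Suc i)"
  shows "\<exists>r\<in>K (Suc 0). g - r * f \<in> I"
proof -
  let ?S = "range (\<lambda>r. r * f)"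
  have "\<Phi> ` ?S \<lhd> G"
  proof (rule phi_image_normal)
    show "f' + g' \<in> ?S" if "f' \<in> ?S" "g' \<in> ?S" for f' g'
      using that by (auto simp flip: distrib_right)
    show "r * f' \<in> ?S" if "f' \<in> ?S" for r f'
      using that by (auto simp flip: mult.assoc)
    show "0 \<in> ?S" by (auto intro: range_eqI[of _ _ 0])
  qed
  then obtain j where j: "lower_central G (Suc j) \<subseteq> \<Phi> ` ?S" "\<Phi> ` ?S \<subseteq> lower_central G j"
    using thin_normal by blast
  have "\<Phi> (1 * f) \<in> \<Phi> ` ?S" by blast
  then have fj: "\<Phi> f \<in> lower_central G j" using j by auto
  have "j \<le> Suc (Suc i)"
  proof (rule ccontr)
    assume "\<not> j \<le> Suc (Suc i)"
    then have "\<Phi> f \<in> lower_central G (Suc (Suc (Suc i)))"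
      using fj lower_central_antimono[of "Suc (Suc (Suc i))" j] by auto
    then show False using f by (simp add: K_def)
  qed
  then have "lower_central G (Suc (Suc (Suc i))) \<subseteq> lower_central G (Suc j)"
    by (intro lower_central_antimono) simp
  then have "\<Phi> g \<in> \<Phi> ` ?S" using g j by (auto simp: K_def)
  then obtain r where "\<Phi> g = \<Phi> (r * f)" by auto
  then have r: "g - r * f \<in> I" by (simp add: phi_eq_iff I_def)
  obtain n where n: "r - of_int n \<in> K (Suc 0)" using decomp_int by blast
  \<comment> \<open>If the constant term of the multiplier were prime to p, it could be cancelled
    and \<open>f\<close> would lie in the next term.\<close>
  have "of_int n * f = g - (r - of_int n) * f - (g - r * f)" by (simp add: algebra_simps)
  also have "\<dots> \<in> K (Suc i)"
    using K_mult_add[OF n f(1)] by (intro K_diff g I_subset_K[OF r]) simp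
  finally have "int p dvd n" using cancel_K f by blast
  then have "of_int n * 1 \<in> K (Suc 0)" by (intro int_dvd_K) (simp_all add: K_0)
  then have "r \<in> K (Suc 0)" using n K_add[of "r - of_int n" "Suc 0" "of_int n"] by simp
  then show ?thesis using r by blast
qed

lemma K1_linear:
  assumes "f \<in> K (Suc 0)"
  shows "\<exists>u v. f - (of_int u * U + of_int v * V) \<in> K 2"
proof -
  obtain g h where gh: "f - (U * g + V * h) \<in> I" using K_Suc_decomp[OF assms] by blast
  obtain u v where uv: "g - of_int u \<in> K (Suc 0)" "h - of_int v \<in> K (Suc 0)" using decomp_int by blast
  have "f - (of_int u * U + of_int v * V) = (f - (U * g + V * h)) + U * (g - of_int u) + V * (h - of_int v)"
    by (simp add: algebra_simps)
  also have "\<dots> \<in> K (Suc (Suc 0))" by (intro K_add K_U K_V I_subset_K[OF gh] uv)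
  finally show ?thesis by (auto simp: numeral_2_eq_2)
qed

lemma card_lower_central_bound:
  assumes span: "\<And>f. f \<in> K i \<Longrightarrow> \<exists>n. f - of_int n * w \<in> K (Suc i)" and w: "w \<in> K i"
  shows "card (lower_central G (Suc (Suc i))) \<le> p * card (lower_central G (Suc (Suc (Suc i))))"
proof -
  let ?L = "lower_central G (Suc (Suc (Suc i)))"
  let ?h = "\<lambda>(n, l). \<Phi> (of_nat n * w) \<otimes> l"
  have "lower_central G (Suc (Suc i)) \<subseteq> ?h ` ({..<p} \<times> ?L)"
  proof
    fix g assume "g \<in> lower_central G (Suc (Suc i))"
    then obtain f where f: "f \<in> K i" "g = \<Phi> f" unfolding phi_image_K[symmetric] by auto
    obtain n where n: "f - of_int n * w \<in> K (Suc i)" using span f by blast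
    define m where "m = nat (n mod int p)"
    have m: "int m = n mod int p" "m < p" using p_gt_1 by (auto simp: m_def nat_less_iff)
    have "int p dvd n - int m" using m by (simp add: mod_eq_dvd_iff[symmetric])
    then have "of_int (n - int m) * w \<in> K (Suc i)" using w by (rule int_dvd_K)
    then have "f - of_nat m * w \<in> K (Suc i)"
      using K_add[OF n, of "of_int (n - int m) * w"] by (simp add: algebra_simps)
    moreover have "g = \<Phi> (of_nat m * w) \<otimes> \<Phi> (f - of_nat m * w)" using f by (simp flip: phi_add)
    ultimately show "g \<in> ?h ` ({..<p} \<times> ?L)" using m by (auto simp: K_def intro!: image_eqI[of _ _ "(m, \<Phi> (f - of_nat m * w))"])
  qed
  then have "card (lower_central G (Suc (Suc i))) \<le> card ({..<p} \<times> ?L)"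
    by (rule surj_card_le[rotated]) (simp add: finite_sub[OF lower_central_subgroup])
  then show ?thesis by (simp add: card_cartesian_product)
qed

text \<open>If powers of one element span the layers, all factors from gamma_2 on have order p. As M
  has index p^2, the order is p^(C + 1), which is maximal class.\<close>

lemma not_uniserial:
  assumes "\<And>i f. f \<in> K i \<Longrightarrow> \<exists>n. f - of_int n * W ^ i \<in> K (Suc i)" and "W \<in> K (Suc 0)"
  shows False
proof -
  have card: "card (lower_central G (Suc (Suc i))) = p * card (lower_central G (Suc (Suc (Suc i))))"
    if i: "Suc i < C" for i
  proof (rule antisym)
    show "card (lower_central G (Suc (Suc i))) \<le> p * card (lower_central G (Suc (Suc (Suc i))))"
      using assms K_power by (intro card_lower_central_bound[where w = "W ^ i"]) auto
    obtain f where "f \<in> K i" "f \<notin> K (Suc i)" using K_strict[OF i] by blast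
    then have "lower_central G (Suc (Suc (Suc i))) \<subset> lower_central G (Suc (Suc i))"
      using lower_central_Suc_subset[of "Suc (Suc i)"] by (auto simp: K_def)
    then show "p * card (lower_central G (Suc (Suc (Suc i)))) \<le> card (lower_central G (Suc (Suc i)))"
      by (intro card_proper_subgroup lower_central_subgroup)
  qed
  \<comment> \<open>Orders are counted upwards from the trivial term with index C + 1.\<close>
  have "card (lower_central G (Suc C - j)) = p ^ j" if "j < C" for j
    using that
  proof (induction j)
    case 0
    then show ?case by (simp add: lower_central_C)
  next
    case (Suc j)
    then obtain i where i: "C = i + j + 2"
      by (metis Suc_lessD add.commute add_2_eq_Suc' less_imp_add_positive less_iff_Suc_add add_Suc_right)
    then have "Suc C - Suc j = Suc (Suc i)" "Suc C - j = Suc (Suc (Suc i))" by auto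
    then show ?case using Suc card[of i] i by (simp add: numeral_3_eq_3)
  qed
  from this[of "C - 1"] have "card M = p ^ (C - 1)" using C_ge by (simp add: Suc_diff_le numeral_2_eq_2)
  then have "Coset.order G = p ^ (C + 1)"
    using order_eq C_ge by (simp flip: power_add)
  then have "maximal_class p G"
    unfolding maximal_class_def using thin C_ge
    by (auto simp: thin_p_group_def C_def intro!: exI[of _ "C + 1"])
  then show False using nonmax by blast
qed

text \<open>A relation in degree 1 makes one of \<open>U\<close>, \<open>V\<close> a multiple of the
  other modulo degree 2. Powers of a single element then span all layers, contrary to
  \<open>not_uniserial\<close>.\<close>

lemma linear_independent:
  assumes "of_int u * U + of_int v * V \<in> K 2"
  shows "int p dvd u \<and> int p dvd v"
proof (rule ccontr)
  assume neg: "\<not> (int p dvd u \<and> int p dvd v)"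
  \<comment> \<open>Stated for an arbitrary pair to cover both orders of \<open>U\<close> and
    \<open>V\<close>; the coefficient prime to p comes second.\<close>
  have aux: False if W: "W \<in> K (Suc 0)" and W': "W' \<in> K (Suc 0)" and rel: "of_int u * W + of_int v * W' \<in> K 2"
    and v: "\<not> int p dvd v"
    and dec: "\<And>f i. f \<in> K (Suc i) \<Longrightarrow> \<exists>g\<in>K i. \<exists>h\<in>K i. f - (W * g + W' * h) \<in> I" for W W' u v
  proof -
    obtain l where l: "int p dvd v * int l - (- u)" using exists_mod_solution[OF prime_p v] .
    have "of_int v * (W' - of_nat l * W) = (of_int u * W + of_int v * W') - of_int (v * int l - (- u)) * W"
      by (simp add: algebra_simps)
    also have "\<dots> \<in> K 2" using rel int_dvd_K[OF l W] by (simp only: numeral_2_eq_2 K_diff)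
    finally have *: "of_int v * (W' - of_nat l * W) \<in> K (Suc (Suc 0))" by (simp only: numeral_2_eq_2)
    have l2: "W' - of_nat l * W \<in> K (Suc (Suc 0))"
      by (rule cancel_K[OF v *]) (intro K_diff W' K_mult W)
    have "\<exists>n. f - of_int n * W ^ i \<in> K (Suc i)" if "f \<in> K i" for i f
      using that
    proof (induction i arbitrary: f)
      case 0
      then show ?case using decomp_int by simp
    next
      case (Suc i)
      obtain g h where gh: "g \<in> K i" "h \<in> K i" "f - (W * g + W' * h) \<in> I" using dec Suc(2) by blast
      obtain m n where mn: "g - of_int m * W ^ i \<in> K (Suc i)" "h - of_int n * W ^ i \<in> K (Suc i)"
        using Suc(1) gh by blast
      have "f - of_int (m + n * int l) * W ^ Suc i =
         (f - (W * g + W' * h)) + W * (g - of_int m * W ^ i) + of_nat l * (W * (h - of_int n * W ^ i))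
          + (W' - of_nat l * W) * h"
        by (simp add: algebra_simps)
      also have "\<dots> \<in> K (Suc (Suc i))"
      proof (intro K_add)
        show "f - (W * g + W' * h) \<in> K (Suc (Suc i))" using gh I_subset_K by blast
        show "W * (g - of_int m * W ^ i) \<in> K (Suc (Suc i))" using K_mult_add[OF W mn(1)] by simp
        show "of_nat l * (W * (h - of_int n * W ^ i)) \<in> K (Suc (Suc i))"
          using K_mult[OF K_mult_add[OF W mn(2)]] by simp
        show "(W' - of_nat l * W) * h \<in> K (Suc (Suc i))"
          using K_mult_add[OF l2 gh(2)] by simp
      qed
      finally show ?case by blast
    qed
    then show False using W by (rule not_uniserial)
  qed
  show False
  proof (cases "int p dvd v")
    case False
    show ?thesis by (rule aux[OF U_in_K V_in_K assms False K_Suc_decomp])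
  next
    case True
    then have "\<not> int p dvd u" using neg by blast
    moreover have "of_int v * V + of_int u * U \<in> K 2" using assms by (simp add: add.commute)
    moreover have "\<exists>g\<in>K i. \<exists>h\<in>K i. f - (V * g + U * h) \<in> I" if "f \<in> K (Suc i)" for f i
      using K_Suc_decomp[OF that] by (metis add.commute)
    ultimately show ?thesis using aux[OF V_in_K U_in_K] by blast
  qed
qed

text \<open>Pigeonhole: p^3 combinations of the three monomials, but by thinness at most p^2 cosets
  of gamma_5 in gamma_4.\<close>

lemma degree_two_relation:
  "\<exists>u v w. \<not> (int p dvd u \<and> int p dvd v \<and> int p dvd w)
     \<and> of_int u * (U * U) + of_int v * (U * V) + of_int w * (V * V) \<in> K 3"
proof -
  let ?H = "lower_central G 4" and ?L = "lower_central G 5"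
  define F where "F = (\<lambda>(i::nat, j::nat, k::nat). of_nat i * (U * U) + of_nat j * (U * V) + of_nat k * (V * V))"
  have K2: "F t \<in> K 2" for t
    using K_mult_add[OF U_in_K U_in_K] K_mult_add[OF U_in_K V_in_K] K_mult_add[OF V_in_K V_in_K]
    by (cases t) (auto simp: F_def numeral_2_eq_2 intro!: K_add K_mult)
  let ?D = "{..<p} \<times> {..<p} \<times> {..<p}"
  let ?h = "\<lambda>t. ?L #> \<Phi> (F t)"
  have "?h ` ?D \<subseteq> rcosets\<^bsub>G\<lparr>carrier := ?H\<rparr>\<^esub> ?L"
    using K2 by (auto simp: RCOSETS_def r_coset_def K_def)
  moreover have "finite (rcosets\<^bsub>G\<lparr>carrier := ?H\<rparr>\<^esub> ?L)"
    using finite_sub[OF lower_central_subgroup] by (auto simp: RCOSETS_def)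
  ultimately have "card (?h ` ?D) \<le> card (rcosets\<^bsub>G\<lparr>carrier := ?H\<rparr>\<^esub> ?L)" by (intro card_mono)
  also have "\<dots> \<le> p\<^sup>2" using thin_index[of 4] by (simp add: subgroup_index_def)
  also have "p\<^sup>2 < p ^ 3" using p_gt_1 by (intro power_strict_increasing) auto
  also have "p ^ 3 = card ?D" by (simp only: card_cartesian_product card_lessThan power3_eq_cube mult.assoc)
  finally have "\<not> inj_on ?h ?D" by (rule pigeonhole)
  then have "\<exists>t t'. t \<in> ?D \<and> t' \<in> ?D \<and> t \<noteq> t' \<and> ?h t = ?h t'" unfolding inj_on_def by (simp only: ball_simps) metis
  then obtain t t' where t: "t \<in> ?D" "t' \<in> ?D" "t \<noteq> t'" "?h t = ?h t'" by (elim exE conjE)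
  obtain i j k i' j' k' where ijk: "t = (i, j, k)" "t' = (i', j', k')" by (cases t, cases t')
  have "\<Phi> (F t) \<in> ?L #> \<Phi> (F t')" using rcos_self[OF _ lower_central_subgroup, of "\<Phi> (F t)" 5] t(4) by simp
  then obtain l where l: "l \<in> ?L" "\<Phi> (F t) = l \<otimes> \<Phi> (F t')" by (auto simp: r_coset_def)
  then have "\<Phi> (F t - F t') = l" using lower_central_carrier by (simp add: phi_diff m_assoc)
  then have "F t - F t' \<in> K 3" using l by (simp add: K_def)
  moreover have "F t - F t' = of_int (int i - int i') * (U * U) + of_int (int j - int j') * (U * V)
      + of_int (int k - int k') * (V * V)"
    by (simp add: F_def ijk algebra_simps)
  moreover have "\<not> (int p dvd int i - int i' \<and> int p dvd int j - int j' \<and> int p dvd int k - int k')"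
  proof -
    have "m = m'" if "int p dvd int m - int m'" "m < p" "m' < p" for m m'
      using zdvd_not_zless[of "int m - int m'" "int p"] zdvd_not_zless[of "int m' - int m" "int p"] that
        dvd_diff_commute[of "int p" "int m" "int m'"] by (cases m m' rule: linorder_cases) auto
    then show ?thesis using t ijk by auto
  qed
  ultimately show ?thesis by (metis (no_types))
qed

end

section \<open>The quadratic relation\<close>

context thin_action
begin

lemma prime_int_p: "Factorial_Ring.prime (int p)"
  using prime_p by simp

lemma not_dvd_mult: "\<lbrakk>\<not> int p dvd m; \<not> int p dvd n\<rbrakk> \<Longrightarrow> \<not> int p dvd m * n"
  using prime_int_p prime_dvd_mult_iff by blast

lemma UU_K: "U * U \<in> K 2" and UV_K: "U * V \<in> K 2" and VV_K: "V * V \<in> K 2"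
  using K_mult_add[OF U_in_K U_in_K] K_mult_add[OF U_in_K V_in_K] K_mult_add[OF V_in_K V_in_K]
  by (simp_all add: numeral_2_eq_2)

lemma K2_U: "f \<in> K 2 \<Longrightarrow> U * f \<in> K 3" and K2_V: "f \<in> K 2 \<Longrightarrow> V * f \<in> K 3"
  and K3_U: "f \<in> K 3 \<Longrightarrow> U * f \<in> K 4" and K3_V: "f \<in> K 3 \<Longrightarrow> V * f \<in> K 4"
  and K11: "\<lbrakk>f \<in> K (Suc 0); g \<in> K (Suc 0)\<rbrakk> \<Longrightarrow> f * g \<in> K 2"
  and K21: "\<lbrakk>f \<in> K 2; g \<in> K (Suc 0)\<rbrakk> \<Longrightarrow> f * g \<in> K 3"
  using K_U[of f 2] K_V[of f 2] K_U[of f 3] K_V[of f 3] K_mult_add[of f "Suc 0" g "Suc 0"]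
    K_mult_add[of f 2 g "Suc 0"] by (simp_all add: eval_nat_numeral)

lemma dvd_K3: "\<lbrakk>int p dvd n; f \<in> K 2\<rbrakk> \<Longrightarrow> of_int n * f \<in> K 3"
  and cancel_K3: "\<lbrakk>\<not> int p dvd n; of_int n * f \<in> K 3; f \<in> K 2\<rbrakk> \<Longrightarrow> f \<in> K 3"
  and cancel_K4: "\<lbrakk>\<not> int p dvd n; of_int n * f \<in> K 4; f \<in> K 3\<rbrakk> \<Longrightarrow> f \<in> K 4"
  using int_dvd_K[of n f 2] cancel_K[of n f 2] cancel_K[of n f 3] by simp_all

lemma K2_quadratic:
  assumes "f \<in> K 2"
  shows "\<exists>u v w. f - (of_int u * (U * U) + of_int v * (U * V) + of_int w * (V * V)) \<in> K 3"
proof -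
  have "f \<in> K (Suc (Suc 0))" using assms by (simp add: numeral_2_eq_2)
  then obtain g h where gh: "g \<in> K (Suc 0)" "h \<in> K (Suc 0)" "f - (U * g + V * h) \<in> I"
    using K_Suc_decomp by blast
  obtain u v where uv: "g - (of_int u * U + of_int v * V) \<in> K 2" using K1_linear gh by blast
  obtain s t where st: "h - (of_int s * U + of_int t * V) \<in> K 2" using K1_linear gh by blast
  have "f - (of_int u * (U * U) + of_int (v + s) * (U * V) + of_int t * (V * V)) =
     (f - (U * g + V * h)) + U * (g - (of_int u * U + of_int v * V)) + V * (h - (of_int s * U + of_int t * V))"
    by (simp add: algebra_simps)
  also have "\<dots> \<in> K 3" by (intro K_add K2_U K2_V uv st I_subset_K[OF gh(3)])
  finally show ?thesis by blast
qed

lemma thin_linear: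
  assumes nz: "\<not> (int p dvd u \<and> int p dvd v)" and f: "f \<in> K 2"
  shows "\<exists>s t. f - (of_int s * U + of_int t * V) * (of_int u * U + of_int v * V) \<in> K 3"
proof -
  let ?l = "of_int u * U + of_int v * V"
  have l: "?l \<in> K (Suc 0)" by (intro K_add K_mult U_in_K V_in_K)
  have "?l \<notin> K (Suc (Suc 0))" using linear_independent[of u v] nz by (auto simp: numeral_2_eq_2)
  moreover have "f \<in> K (Suc (Suc 0))" using f by (simp add: numeral_2_eq_2)
  ultimately obtain r where r: "r \<in> K (Suc 0)" "f - r * ?l \<in> I" using thin_K l by blast
  obtain s t where st: "r - (of_int s * U + of_int t * V) \<in> K 2" using K1_linear r by blast
  have "f - (of_int s * U + of_int t * V) * ?l = (f - r * ?l) + (r - (of_int s * U + of_int t * V)) * ?l"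
    by (simp add: algebra_simps)
  also have "\<dots> \<in> K 3" by (intro K_add K21 st l I_subset_K[OF r(2)])
  finally show ?thesis by blast
qed

text \<open>By thinness, multiples of the second factor by linear forms span degree 2. The vanishing
  product is a dependence between its multiples by \<open>U\<close> and by \<open>V\<close>, so one
  of them is enough.\<close>

lemma factor_spans:
  assumes nz: "\<not> (int p dvd u \<and> int p dvd v)" and nz': "\<not> (int p dvd u' \<and> int p dvd v')"
    and fac: "(of_int u' * U + of_int v' * V) * (of_int u * U + of_int v * V) \<in> K 3"
  shows "\<exists>w\<in>K 2. \<forall>f\<in>K 2. \<exists>n. f - of_int n * w \<in> K 3"
proof -
  let ?l = "of_int u * U + of_int v * V"
  have l: "?l \<in> K (Suc 0)" by (intro K_add K_mult U_in_K V_in_K)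
  have aux: "\<exists>w\<in>K 2. \<forall>f\<in>K 2. \<exists>n. f - of_int n * w \<in> K 3"
    if W: "W \<in> K (Suc 0)" and n': "\<not> int p dvd n'" and fac': "(of_int m' * W + of_int n' * W') * ?l \<in> K 3"
      and lin: "\<And>f. f \<in> K 2 \<Longrightarrow> \<exists>s t. f - (of_int s * W + of_int t * W') * ?l \<in> K 3" for W W' m' n'
  proof (intro bexI[of _ "W * ?l"] ballI)
    show wl: "W * ?l \<in> K 2" by (intro K11 W l)
    fix f assume f: "f \<in> K 2"
    obtain s t where st: "f - (of_int s * W + of_int t * W') * ?l \<in> K 3" using lin f by blast
    \<comment> \<open>\<open>k\<close> inverts \<open>n'\<close> modulo p, so that W' ?l can be
      expressed through W ?l.\<close>
    obtain k where k: "int p dvd n' * int k - 1" using exists_mod_solution[OF prime_p n'] .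
    have "f - of_int (int k * (s * n' - t * m')) * (W * ?l) =
       of_int (int k * n') * (f - (of_int s * W + of_int t * W') * ?l) - of_int (n' * int k - 1) * f
       + of_int (int k * t) * ((of_int m' * W + of_int n' * W') * ?l)"
      by (simp add: algebra_simps)
    also have "\<dots> \<in> K 3" by (intro K_add K_diff K_mult[OF st] K_mult[OF fac'] dvd_K3 k f)
    finally show "\<exists>n. f - of_int n * (W * ?l) \<in> K 3" by blast
  qed
  show ?thesis
  proof (cases "int p dvd v'")
    case False
    show ?thesis using aux[OF U_in_K False fac] thin_linear[OF nz] by blast
  next
    case True
    then have "\<not> int p dvd u'" using nz' by blast
    moreover have "(of_int v' * V + of_int u' * U) * ?l \<in> K 3" using fac by (simp add: add.commute)
    moreover have "\<exists>s t. f - (of_int s * V + of_int t * U) * ?l \<in> K 3" if "f \<in> K 2" for f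
      using thin_linear[OF nz that] by (metis add.commute)
    ultimately show ?thesis using aux[OF V_in_K] by blast
  qed
qed

text \<open>A one-dimensional \<open>K 2 / K 3\<close> carries a nondegenerate symmetric form, whose relations already
  kill all cubic monomials; the class would then be at most 4.\<close>

lemma K2_not_cyclic:
  assumes w: "w \<in> K 2" and span: "\<And>f. f \<in> K 2 \<Longrightarrow> \<exists>n. f - of_int n * w \<in> K 3"
  shows False
proof -
  obtain A where A: "U * U - of_int A * w \<in> K 3" using span UU_K by blast
  obtain B where B: "U * V - of_int B * w \<in> K 3" using span UV_K by blast
  obtain D where D: "V * V - of_int D * w \<in> K 3" using span VV_K by blast
  \<comment> \<open>A degenerate Gram matrix has a kernel vector: a linear form killed by
    \<open>U\<close> and \<open>V\<close>, although its multiples span degree 2.\<close>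
  have nd: "\<not> int p dvd B * B - A * D"
  proof
    assume dvd: "int p dvd B * B - A * D"
    have "\<exists>m k. \<not> (int p dvd m \<and> int p dvd k) \<and> int p dvd m * A + k * B \<and> int p dvd m * B + k * D"
    proof (cases "int p dvd A \<and> int p dvd B")
      case True
      then show ?thesis using p_gt_1 by (intro exI[of _ 1] exI[of _ 0]) auto
    next
      case False
      then show ?thesis using dvd by (intro exI[of _ B] exI[of _ "- A"]) (auto simp: algebra_simps)
    qed
    then obtain m k where mk: "\<not> (int p dvd m \<and> int p dvd k)" "int p dvd m * A + k * B" "int p dvd m * B + k * D"
      by blast
    let ?l = "of_int m * U + of_int k * V"
    have "U * ?l = of_int m * (U * U - of_int A * w) + of_int k * (U * V - of_int B * w) + of_int (m * A + k * B) * w"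
      by (simp add: algebra_simps)
    also have "\<dots> \<in> K 3" by (intro K_add K_mult[OF A] K_mult[OF B] dvd_K3 mk w)
    finally have Ul: "U * ?l \<in> K 3" .
    have "V * ?l = of_int m * (U * V - of_int B * w) + of_int k * (V * V - of_int D * w) + of_int (m * B + k * D) * w"
      by (simp add: algebra_simps)
    also have "\<dots> \<in> K 3" by (intro K_add K_mult[OF B] K_mult[OF D] dvd_K3 mk w)
    finally have Vl: "V * ?l \<in> K 3" .
    have "f \<in> K 3" if f: "f \<in> K 2" for f
    proof -
      obtain s t where st: "f - (of_int s * U + of_int t * V) * ?l \<in> K 3" using thin_linear[OF mk(1) f] by blast
      have "f = (f - (of_int s * U + of_int t * V) * ?l) + of_int s * (U * ?l) + of_int t * (V * ?l)"
        by (simp add: algebra_simps)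
      also have "\<dots> \<in> K 3" by (intro K_add st K_mult[OF Ul] K_mult[OF Vl])
      finally show ?thesis .
    qed
    then show False using K_strict[of 2] C_ge by auto
  qed
  \<comment> \<open>Proportionality to \<open>w\<close> gives three quadratic relations; their
    multiples by \<open>U\<close> and \<open>V\<close> are the cubic ones.\<close>
  have R1: "of_int B * (U * U) - of_int A * (U * V) \<in> K 3"
  proof -
    have "of_int B * (U * U) - of_int A * (U * V) =
       of_int B * (U * U - of_int A * w) - of_int A * (U * V - of_int B * w)" by (simp add: algebra_simps)
    also have "\<dots> \<in> K 3" by (intro K_diff K_mult A B)
    finally show ?thesis .
  qed
  have R2: "of_int D * (U * V) - of_int B * (V * V) \<in> K 3"
  proof -
    have "of_int D * (U * V) - of_int B * (V * V) =
       of_int D * (U * V - of_int B * w) - of_int B * (V * V - of_int D * w)" by (simp add: algebra_simps)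
    also have "\<dots> \<in> K 3" by (intro K_diff K_mult B D)
    finally show ?thesis .
  qed
  have R3: "of_int D * (U * U) - of_int A * (V * V) \<in> K 3"
  proof -
    have "of_int D * (U * U) - of_int A * (V * V) =
       of_int D * (U * U - of_int A * w) - of_int A * (V * V - of_int D * w)" by (simp add: algebra_simps)
    also have "\<dots> \<in> K 3" by (intro K_diff K_mult A D)
    finally show ?thesis .
  qed
  \<comment> \<open>Eliminating one mixed cubic monomial leaves the other with the determinant as
    coefficient, which can be cancelled.\<close>
  have "of_int (B * B - A * D) * (V * (U * U)) =
      of_int B * (V * (of_int B * (U * U) - of_int A * (U * V))) - of_int A * (U * (of_int D * (U * V) - of_int B * (V * V)))"
    by (simp add: algebra_simps)
  also have "\<dots> \<in> K 4" by (intro K_diff K_mult K3_U K3_V R1 R2)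
  finally have UUV: "V * (U * U) \<in> K 4" by (rule cancel_K4[OF nd _ K2_V[OF UU_K]])
  have "of_int (B * B - A * D) * (V * (U * V)) =
      of_int D * (V * (of_int B * (U * U) - of_int A * (U * V))) - of_int B * (U * (of_int D * (U * V) - of_int B * (V * V)))"
    by (simp add: algebra_simps)
  also have "\<dots> \<in> K 4" by (intro K_diff K_mult K3_U K3_V R1 R2)
  finally have UVV: "V * (U * V) \<in> K 4" by (rule cancel_K4[OF nd _ K2_V[OF UV_K]])
  have "of_int B * (U * (U * U)) = U * (of_int B * (U * U) - of_int A * (U * V)) + of_int A * (V * (U * U))"
    by (simp add: algebra_simps)
  also have "\<dots> \<in> K 4" by (intro K_add K_mult K3_U R1 UUV)
  finally have b1: "of_int B * (U * (U * U)) \<in> K 4" .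
  have "of_int D * (U * (U * U)) = U * (of_int D * (U * U) - of_int A * (V * V)) + of_int A * (V * (U * V))"
    by (simp add: algebra_simps)
  also have "\<dots> \<in> K 4" by (intro K_add K_mult K3_U R3 UVV)
  finally have d1: "of_int D * (U * (U * U)) \<in> K 4" .
  have "of_int B * (V * (V * V)) = of_int D * (V * (U * V)) - V * (of_int D * (U * V) - of_int B * (V * V))"
    by (simp add: algebra_simps)
  also have "\<dots> \<in> K 4" by (intro K_diff K_mult[OF UVV] K3_V R2)
  finally have b2: "of_int B * (V * (V * V)) \<in> K 4" .
  have "of_int A * (V * (V * V)) = of_int D * (V * (U * U)) - V * (of_int D * (U * U) - of_int A * (V * V))"
    by (simp add: algebra_simps)
  also have "\<dots> \<in> K 4" by (intro K_diff K_mult[OF UUV] K3_V R3)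
  finally have a2: "of_int A * (V * (V * V)) \<in> K 4" .
  \<comment> \<open>Since the determinant is prime to p, some available coefficient of each pure
    cube is too.\<close>
  have "\<not> int p dvd B \<or> \<not> int p dvd D" using nd by auto
  then have UUU: "U * (U * U) \<in> K 4" using b1 d1 cancel_K4 K2_U[OF UU_K] by blast
  have "\<not> int p dvd B \<or> \<not> int p dvd A" using nd by auto
  then have VVV: "V * (V * V) \<in> K 4" using b2 a2 cancel_K4 K2_V[OF VV_K] by blast
  have "f \<in> K 4" if "f \<in> K 3" for f
  proof -
    have "f \<in> K (Suc 2)" using that by simp
    then obtain g h where gh: "g \<in> K 2" "h \<in> K 2" "f - (U * g + V * h) \<in> I"
      using K_Suc_decomp by blast
    obtain u v t where g: "g - (of_int u * (U * U) + of_int v * (U * V) + of_int t * (V * V)) \<in> K 3"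
      using K2_quadratic gh by blast
    obtain u' v' t' where h: "h - (of_int u' * (U * U) + of_int v' * (U * V) + of_int t' * (V * V)) \<in> K 3"
      using K2_quadratic gh by blast
    have "f = (f - (U * g + V * h)) + U * (g - (of_int u * (U * U) + of_int v * (U * V) + of_int t * (V * V)))
       + V * (h - (of_int u' * (U * U) + of_int v' * (U * V) + of_int t' * (V * V)))
       + of_int u * (U * (U * U)) + of_int (v + u') * (V * (U * U)) + of_int (t + v') * (V * (U * V))
       + of_int t' * (V * (V * V))"
      by (simp add: algebra_simps)
    also have "\<dots> \<in> K 4"
      by (intro K_add I_subset_K[OF gh(3)] K3_U[OF g] K3_V[OF h] K_mult[OF UUU] K_mult[OF UUV] K_mult[OF UVV] K_mult[OF VVV])
    finally show ?thesis .
  qed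
  then show False using K_strict[of 3] C_ge by auto
qed

lemma no_factor:
  assumes "\<not> (int p dvd u \<and> int p dvd v)" "\<not> (int p dvd u' \<and> int p dvd v')"
  shows "(of_int u' * U + of_int v' * V) * (of_int u * U + of_int v * V) \<notin> K 3"
  using factor_spans[OF assms] K2_not_cyclic by blast

text \<open>A zero of the form modulo p splits off a linear factor, and the relation becomes a
  vanishing product of two linear forms, which \<open>no_factor\<close> forbids.\<close>

lemma irreducible_relation:
  obtains \<alpha> \<beta> \<gamma> where
    "of_int \<alpha> * (U * U) + of_int \<beta> * (U * V) + of_int \<gamma> * (V * V) \<in> K 3"
    "\<And>u v. int p dvd \<alpha> * (u * u) + \<beta> * (u * v) + \<gamma> * (v * v) \<Longrightarrow> int p dvd u \<and> int p dvd v"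
proof -
  obtain \<alpha> \<beta> \<gamma> where nz: "\<not> (int p dvd \<alpha> \<and> int p dvd \<beta> \<and> int p dvd \<gamma>)"
    and rel: "of_int \<alpha> * (U * U) + of_int \<beta> * (U * V) + of_int \<gamma> * (V * V) \<in> K 3"
    using degree_two_relation by blast
  have "int p dvd u \<and> int p dvd v" if dvd: "int p dvd \<alpha> * (u * u) + \<beta> * (u * v) + \<gamma> * (v * v)" for u v
  proof (rule ccontr)
    assume neg: "\<not> (int p dvd u \<and> int p dvd v)"
    show False
    proof (cases "int p dvd v")
      case False
      \<comment> \<open>Division of the form by v U - u V, with denominators cleared by v^2: the
        remainder is the value at (u, v) times V^2.\<close>
      have "(of_int (\<alpha> * v) * U + of_int (\<beta> * v + \<alpha> * u) * V) * (of_int v * U + of_int (- u) * V) =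
         of_int (v * v) * (of_int \<alpha> * (U * U) + of_int \<beta> * (U * V) + of_int \<gamma> * (V * V))
         - of_int (\<alpha> * (u * u) + \<beta> * (u * v) + \<gamma> * (v * v)) * (V * V)"
        by (simp add: algebra_simps)
      also have "\<dots> \<in> K 3" by (intro K_diff K_mult[OF rel] dvd_K3 dvd VV_K)
      finally have "int p dvd \<alpha> * v \<and> int p dvd \<beta> * v + \<alpha> * u"
        using no_factor[of v "- u" "\<alpha> * v" "\<beta> * v + \<alpha> * u"] False by auto
      then have \<alpha>: "int p dvd \<alpha>" and "int p dvd \<beta> * v + \<alpha> * u"
        using False prime_int_p prime_dvd_mult_iff by blast+
      then have "int p dvd \<beta> * v" using dvd_add_left_iff[of "int p" "\<alpha> * u" "\<beta> * v"] by simp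
      then have \<beta>: "int p dvd \<beta>" using False prime_int_p prime_dvd_mult_iff by blast
      have "int p dvd \<gamma> * (v * v)"
        using dvd \<alpha> \<beta> dvd_add_right_iff[of "int p" "\<alpha> * (u * u) + \<beta> * (u * v)" "\<gamma> * (v * v)"] by simp
      then have "int p dvd \<gamma>" using False prime_int_p prime_dvd_mult_iff by blast
      then show False using nz \<alpha> \<beta> by blast
    next
      case True
      then have u: "\<not> int p dvd u" using neg by blast
      have "(of_int (\<beta> * u + \<gamma> * v) * U + of_int (\<gamma> * u) * V) * (of_int (- v) * U + of_int u * V) =
         of_int (u * u) * (of_int \<alpha> * (U * U) + of_int \<beta> * (U * V) + of_int \<gamma> * (V * V))
         - of_int (\<alpha> * (u * u) + \<beta> * (u * v) + \<gamma> * (v * v)) * (U * U)"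
        by (simp add: algebra_simps)
      also have "\<dots> \<in> K 3" by (intro K_diff K_mult[OF rel] dvd_K3 dvd UU_K)
      finally have "int p dvd \<gamma> * u \<and> int p dvd \<beta> * u + \<gamma> * v"
        using no_factor[of "- v" u "\<beta> * u + \<gamma> * v" "\<gamma> * u"] u by auto
      then have \<gamma>: "int p dvd \<gamma>" and "int p dvd \<beta> * u + \<gamma> * v"
        using u prime_int_p prime_dvd_mult_iff by blast+
      then have "int p dvd \<beta> * u" using dvd_add_left_iff[of "int p" "\<gamma> * v" "\<beta> * u"] by simp
      then have \<beta>: "int p dvd \<beta>" using u prime_int_p prime_dvd_mult_iff by blast
      have "int p dvd \<alpha> * (u * u)"
        using dvd \<gamma> \<beta> dvd_add_left_iff[of "int p" "\<beta> * (u * v) + \<gamma> * (v * v)" "\<alpha> * (u * u)"] by (simp add: add.assoc)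
      then have "int p dvd \<alpha>" using u prime_int_p prime_dvd_mult_iff by blast
      then show False using nz \<gamma> \<beta> by blast
    qed
  qed
  then show ?thesis using that rel by blast
qed

text \<open>As [x y^l, y] = [x, y], the same \<open>\<Phi>\<close> serves the new
  generators.\<close>

lemma change_generator: "thin_action G (x \<otimes> y [^] l) y \<Phi> (a * b ^ l) b p" for l :: nat
proof -
  have "generate G {x \<otimes> y [^] l, y} = carrier G"
  proof
    let ?H = "generate G {x \<otimes> y [^] l, y}"
    have H: "subgroup ?H G" by (rule generate_is_subgroup) auto
    show "?H \<subseteq> carrier G" using subgroup.subset[OF H] .
    have yH: "y \<in> ?H" and "x \<otimes> y [^] l \<in> ?H" by (auto intro: generate.incl)
    moreover have "y [^] l \<in> ?H"
      using subgroup_int_pow_closed[OF H yH, of "int l"] by (simp add: int_pow_int)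
    ultimately have "x \<otimes> y [^] l \<otimes> inv (y [^] l) \<in> ?H"
      using subgroup.m_closed[OF H] subgroup.m_inv_closed[OF H] by blast
    then have "x \<in> ?H" by (simp add: m_assoc)
    then show "carrier G \<subseteq> ?H" using yH by (intro generated_subset[OF gen H]) auto
  qed
  moreover have "\<Phi> 1 = cmt (x \<otimes> y [^] l) y"
  proof -
    have "cmt (y [^] l) y = \<one>"
      using nat_pow_comm[of y l 1] by (simp add: cmt_def m_assoc)
    then show ?thesis by (simp add: cmt_mult_left phi_one)
  qed
  moreover have "\<Phi> (a * b ^ l * f) = x \<otimes> y [^] l \<otimes> \<Phi> f \<otimes> inv (x \<otimes> y [^] l)" for f
    using acts_mult[OF acts_x acts_pow[OF acts_y]] by (simp add: acts_def)
  moreover have "\<exists>n f g. r = of_int n + (a * b ^ l - 1) * f + (b - 1) * g" for r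
  proof -
    obtain n f g where r: "r = of_int n + (a - 1) * f + (b - 1) * g" using decomp by blast
    have "b ^ l - 1 = (b - 1) * (\<Sum>i<l. b ^ i)" by (rule power_diff_1_eq)
    \<comment> \<open>From a - 1 = (a b^l - 1) - a (b^l - 1).\<close>
    then have "(a - 1) * f = (a * b ^ l - 1) * f - (b - 1) * ((\<Sum>i<l. b ^ i) * a * f)"
      by (simp add: mult.assoc[symmetric] flip: \<open>b ^ l - 1 = (b - 1) * (\<Sum>i<l. b ^ i)\<close>) (simp add: algebra_simps)
    then have "r = of_int n + (a * b ^ l - 1) * f + (b - 1) * (g - (\<Sum>i<l. b ^ i) * a * f)"
      by (simp add: r right_diff_distrib)
    then show ?thesis by blast
  qed
  ultimately have "metabelian_action G (x \<otimes> y [^] l) y \<Phi> (a * b ^ l) b"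
    using fin phi_add phi_b phi_normal by unfold_locales auto
  then show ?thesis
    using thin_metabelian_axioms thin_action_axioms by (simp add: thin_action_def)
qed

end

text \<open>\<open>norm_nonzero\<close> makes u^2 - d v^2 the norm form of a quadratic field
  extension: d is not a square modulo p.\<close>

locale thin_normalized = thin_action +
  fixes d :: int
  assumes UU_VV: "U * U - of_int d * (V * V) \<in> K 3"
    and norm_nonzero: "int p dvd u * u - d * (v * v) \<Longrightarrow> int p dvd u \<and> int p dvd v"

context thin_action
begin

text \<open>Completing the square: modulo p, l is \<beta> / (2 \<alpha>) and d is the discriminant
  divided by 4 \<alpha>^2.\<close>

lemma normalize: "\<exists>l d. thin_normalized G (x \<otimes> y [^] (l::nat)) y \<Phi> (a * b ^ l) b p d"
proof -
  obtain \<alpha> \<beta> \<gamma> where rel: "of_int \<alpha> * (U * U) + of_int \<beta> * (U * V) + of_int \<gamma> * (V * V) \<in> K 3"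
    and irr: "\<And>u v. int p dvd \<alpha> * (u * u) + \<beta> * (u * v) + \<gamma> * (v * v) \<Longrightarrow> int p dvd u \<and> int p dvd v"
    using irreducible_relation by blast
  have "\<not> int p dvd 1" using p_gt_1 by auto
  then have \<alpha>: "\<not> int p dvd \<alpha>" using irr[of 1 0] by auto
  have two: "\<not> int p dvd 2" using p5 zdvd_not_zless[of 2 "int p"] by auto
  note two_\<alpha> = not_dvd_mult[OF two \<alpha>]
  obtain l where l: "int p dvd (2 * \<alpha>) * int l - \<beta>" using exists_mod_solution[OF prime_p two_\<alpha>] .
  \<comment> \<open>\<open>e\<close> and, below, \<open>k\<close> are the errors of the two
    congruences; being multiples of p they vanish in the layer.\<close>
  define e where "e = 2 * \<alpha> * int l - \<beta>"
  define \<Delta> where "\<Delta> = \<beta> * \<beta> - 4 * \<alpha> * \<gamma>"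
  have n4: "\<not> int p dvd 4 * \<alpha> * \<alpha>" using not_dvd_mult[OF two_\<alpha> two_\<alpha>] by (simp add: algebra_simps)
  obtain dd where d: "int p dvd (4 * \<alpha> * \<alpha>) * int dd - \<Delta>" using exists_mod_solution[OF prime_p n4] .
  define d where "d = int dd"
  define k where "k = 4 * \<alpha> * \<alpha> * d - \<Delta>"
  have e: "int p dvd e" and k: "int p dvd k" using l d by (auto simp: e_def k_def d_def)
  interpret N: thin_action G "x \<otimes> y [^] l" y \<Phi> "a * b ^ l" b p by (rule change_generator)
  obtain q where q: "b ^ l = 1 + of_nat l * V + V * V * q" using one_plus_power_expand[of V l] by (auto simp: V_def)
  define s where "s = U + of_nat l * V"
  have "N.U - s = a * b ^ l - 1 - s" by (simp only: N.U_def)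
  also have "\<dots> = (1 + U) * (1 + of_nat l * V + V * V * q) - 1 - s" by (simp only: q U_def) simp
  also have "\<dots> = V * V * q + U * (of_nat l * V + V * V * q)" by (simp add: s_def algebra_simps)
  also have "\<dots> = (V * V) * q + (U * V) * (of_nat l + V * q)" by (simp add: algebra_simps)
  also have "\<dots> \<in> K 2" by (intro K_add K_mult_right UV_K VV_K)
  finally have NU: "N.U - s \<in> K 2" .
  have s: "s \<in> K (Suc 0)" unfolding s_def by (intro K_add K_mult U_in_K V_in_K)
  have NU1: "N.U \<in> K (Suc 0)" using N.U_in_K .
  have "of_int (4 * \<alpha> * \<alpha>) * (s * s - of_int d * (V * V)) =
      of_int (4 * \<alpha>) * (of_int \<alpha> * (U * U) + of_int \<beta> * (U * V) + of_int \<gamma> * (V * V))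
      + of_int e * (of_int (4 * \<alpha>) * (U * V) + of_int (2 * \<beta> + e) * (V * V)) - of_int k * (V * V)"
    unfolding s_def e_def k_def \<Delta>_def by (simp add: algebra_simps)
  also have "\<dots> \<in> K 3" by (intro K_add K_diff K_mult[OF rel] dvd_K3 e k VV_K K_mult[OF VV_K] K_mult[OF UV_K])
  finally have ss: "s * s - of_int d * (V * V) \<in> K 3"
    by (rule cancel_K3[OF n4]) (intro K_diff K_mult[OF VV_K] K11 s)
  have "N.U * N.U - of_int d * (N.V * N.V) = (s * s - of_int d * (V * V)) + (N.U - s) * (N.U + s)"
    by (simp add: algebra_simps)
  also have "\<dots> \<in> K 3" by (intro K_add ss K21 NU NU1 s)
  finally have 1: "N.U * N.U - of_int d * (N.V * N.V) \<in> K 3" .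
  have 2: "int p dvd u \<and> int p dvd v" if uv: "int p dvd u * u - d * (v * v)" for u v
  proof -
    \<comment> \<open>Undoing the substitution: up to factors prime to p, the norm form at (u, v) is
      the original form at (u - l v, v).\<close>
    let ?t = "u - int l * v"
    have "4 * \<alpha> * (\<alpha> * (?t * ?t) + \<beta> * (?t * v) + \<gamma> * (v * v)) =
       4 * \<alpha> * \<alpha> * (u * u - d * (v * v)) + k * (v * v) - e * (v * (4 * \<alpha> * u - e * v))"
      unfolding e_def k_def \<Delta>_def by (simp add: algebra_simps)
    also have "int p dvd \<dots>" using uv k e by (intro dvd_diff dvd_add) auto
    finally have "int p dvd 4 * \<alpha> * (\<alpha> * (?t * ?t) + \<beta> * (?t * v) + \<gamma> * (v * v))" .
    moreover have "\<not> int p dvd 4 * \<alpha>" using not_dvd_mult[OF two two_\<alpha>] by simp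
    ultimately have "int p dvd \<alpha> * (?t * ?t) + \<beta> * (?t * v) + \<gamma> * (v * v)"
      using prime_int_p prime_dvd_mult_iff by blast
    then have "int p dvd ?t" "int p dvd v" using irr by blast+
    then show ?thesis using dvd_add[of "int p" ?t "int l * v"] by simp
  qed
  have "thin_normalized G (x \<otimes> y [^] l) y \<Phi> (a * b ^ l) b p d"
  proof (intro thin_normalized.intro thin_normalized_axioms.intro)
    show "thin_action G (x \<otimes> y [^] l) y \<Phi> (a * b ^ l) b p" by (rule change_generator)
    show "N.U * N.U - of_int d * (N.V * N.V) \<in> K 3" by (rule 1)
    show "int p dvd u \<and> int p dvd v" if "int p dvd u * u - d * (v * v)" for u v using that by (rule 2)
  qed
  then show ?thesis by blast
qed

end

section \<open>Coordinates and the position of the powers\<close>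

text \<open>The sum is ((1 + z)^p - 1) / z, whose binomial coefficients are all divisible by p
  except the last; the first is p itself.\<close>

lemma geometric_sum_prime:
  fixes z :: "'r::comm_ring_1"
  assumes p: "Factorial_Ring.prime p"
  shows "\<exists>s. (\<Sum>k<p. (1 + z) ^ k) = z ^ (p - 1) + of_nat p * (1 + z * s)"
proof -
  have binom: "(\<Sum>k<n. (1 + z) ^ k) = (\<Sum>k<n. of_nat (n choose Suc k) * z ^ k)" for n
  proof (induction n)
    case (Suc n)
    have "(1 + z) ^ n = (\<Sum>k\<le>n. of_nat (n choose k) * z ^ k)"
      using binomial_ring[of z 1 n] by (simp add: add.commute)
    also have "\<dots> = (\<Sum>k<Suc n. of_nat (n choose k) * z ^ k)" by (simp add: lessThan_Suc_atMost)
    finally have "(\<Sum>k<Suc n. (1 + z) ^ k) =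
        (\<Sum>k<n. of_nat (n choose Suc k) * z ^ k) + (\<Sum>k<Suc n. of_nat (n choose k) * z ^ k)"
      using Suc by simp
    also have "(\<Sum>k<n. of_nat (n choose Suc k) * z ^ k) = (\<Sum>k<Suc n. of_nat (n choose Suc k) * z ^ k)"
      by (simp add: binomial_eq_0)
    also have "(\<Sum>k<Suc n. of_nat (n choose Suc k) * z ^ k) + (\<Sum>k<Suc n. of_nat (n choose k) * z ^ k) =
        (\<Sum>k<Suc n. of_nat (Suc n choose Suc k) * z ^ k)"
      by (simp only: sum.distrib[symmetric]) (simp add: algebra_simps)
    finally show ?case .
  qed simp
  have "p \<ge> 2" using p by (rule prime_ge_2_nat)
  then obtain m where m: "p = Suc (Suc m)" by (metis Suc_1 Suc_le_D numeral_2_eq_2 Suc_le_mono)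
  have dvd: "\<exists>q. p choose Suc k = p * q" if "Suc k < p" for k
    using dvd_choose_prime[of "Suc k" p] that p by (auto simp: dvd_def)
  then obtain q where q: "\<And>k. Suc k < p \<Longrightarrow> p choose Suc k = p * q k" by metis
  have "(\<Sum>k<p. of_nat (p choose Suc k) * z ^ k) =
      z ^ (p - 1) + (\<Sum>k<Suc m. of_nat (p choose Suc k) * z ^ k)"
    by (simp add: m binomial_eq_0)
  also have "(\<Sum>k<Suc m. of_nat (p choose Suc k) * z ^ k) =
      of_nat p + (\<Sum>k<m. of_nat (p choose Suc (Suc k)) * z ^ Suc k)"
    by (simp add: sum.lessThan_Suc_shift del: sum.lessThan_Suc)
  also have "(\<Sum>k<m. of_nat (p choose Suc (Suc k)) * z ^ Suc k) = (\<Sum>k<m. of_nat p * (z * (of_nat (q (Suc k)) * z ^ k)))"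
  proof (rule sum.cong)
    fix k assume "k \<in> {..<m}"
    then have "p choose Suc (Suc k) = p * q (Suc k)" using q[of "Suc k"] m by simp
    then show "of_nat (p choose Suc (Suc k)) * z ^ Suc k = of_nat p * (z * (of_nat (q (Suc k)) * z ^ k))"
      by (simp only: of_nat_mult power_Suc ac_simps)
  qed simp
  finally have "(\<Sum>k<p. (1 + z) ^ k) = z ^ (p - 1) + of_nat p * (1 + z * (\<Sum>k<m. of_nat (q (Suc k)) * z ^ k))"
    unfolding binom by (simp add: distrib_left sum_distrib_left)
  then show ?thesis by blast
qed

context thin_normalized
begin

text \<open>\<open>rep i f \<alpha> \<beta>\<close> gives the coordinates of \<open>f\<close> in degree \<open>i + 1\<close>, where multiplication by \<open>s U + t V\<close>
  becomes multiplication by \<open>t + s \<surd>d\<close>.\<close>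

definition rep where
  "rep i f \<alpha> \<beta> \<longleftrightarrow> f - (of_int \<alpha> * V ^ Suc i + of_int \<beta> * (U * V ^ i)) \<in> K (Suc (Suc i))"

lemma V_pow: "V ^ n \<in> K n"
  by (rule K_power[OF V_in_K])

lemma UV_pow: "U * V ^ n \<in> K (Suc n)"
  by (rule K_U[OF V_pow])

lemma basis_K: "of_int \<alpha> * V ^ Suc i + of_int \<beta> * (U * V ^ i) \<in> K (Suc i)"
  by (intro K_add K_mult V_pow UV_pow)

lemma rep_basis: "rep i (of_int \<alpha> * V ^ Suc i + of_int \<beta> * (U * V ^ i)) \<alpha> \<beta>"
  by (simp add: rep_def)

lemma rep_K: "rep i f \<alpha> \<beta> \<Longrightarrow> f \<in> K (Suc i)"
proof -
  assume "rep i f \<alpha> \<beta>"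
  then have "f - (of_int \<alpha> * V ^ Suc i + of_int \<beta> * (U * V ^ i)) \<in> K (Suc i)"
    unfolding rep_def by (rule K_antimono[rotated]) simp
  from K_add[OF this basis_K[of \<alpha> i \<beta>]] show ?thesis by simp
qed

lemma rep_dvd: "\<lbrakk>rep i f \<alpha> \<beta>; int p dvd \<alpha>; int p dvd \<beta>\<rbrakk> \<Longrightarrow> f \<in> K (Suc (Suc i))"
proof -
  assume r: "rep i f \<alpha> \<beta>" and "int p dvd \<alpha>" "int p dvd \<beta>"
  then have "of_int \<alpha> * V ^ Suc i + of_int \<beta> * (U * V ^ i) \<in> K (Suc (Suc i))"
    by (intro K_add int_dvd_K V_pow UV_pow)
  from K_add[OF r[unfolded rep_def] this] show ?thesis by simp
qed

lemma rep_cong: "\<lbrakk>rep i f \<alpha> \<beta>; g - f \<in> K (Suc (Suc i))\<rbrakk> \<Longrightarrow> rep i g \<alpha> \<beta>"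
  unfolding rep_def
  by (drule K_add[where f = "g - f"], assumption) (simp add: algebra_simps)

lemma rep_add: "\<lbrakk>rep i f \<alpha> \<beta>; rep i g \<alpha>' \<beta>'\<rbrakk> \<Longrightarrow> rep i (f + g) (\<alpha> + \<alpha>') (\<beta> + \<beta>')"
  unfolding rep_def by (drule K_add, assumption) (simp add: algebra_simps)

lemma rep_int: "rep i f \<alpha> \<beta> \<Longrightarrow> rep i (of_int n * f) (n * \<alpha>) (n * \<beta>)"
  unfolding rep_def by (drule K_mult[where r = "of_int n"]) (simp add: algebra_simps)

lemma rel_pow: "(U * U - of_int d * (V * V)) * V ^ i \<in> K (Suc (Suc (Suc i)))"
  using K_mult_add[OF UU_VV V_pow, of i] by (simp add: numeral_3_eq_3)

text \<open>Multiplication by sqrt d on the basis 1, sqrt d: the relation replaces U^2 by d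
  V^2.\<close>

lemma rep_U: "rep i f \<alpha> \<beta> \<Longrightarrow> rep (Suc i) (U * f) (d * \<beta>) \<alpha>"
proof -
  assume r: "rep i f \<alpha> \<beta>"
  have "U * f - (of_int (d * \<beta>) * V ^ Suc (Suc i) + of_int \<alpha> * (U * V ^ Suc i)) =
     U * (f - (of_int \<alpha> * V ^ Suc i + of_int \<beta> * (U * V ^ i))) + of_int \<beta> * ((U * U - of_int d * (V * V)) * V ^ i)"
    by (simp add: algebra_simps)
  also have "\<dots> \<in> K (Suc (Suc (Suc i)))"
    by (intro K_add K_U K_mult[OF rel_pow] r[unfolded rep_def])
  finally show ?thesis unfolding rep_def .
qed

lemma rep_V: "rep i f \<alpha> \<beta> \<Longrightarrow> rep (Suc i) (V * f) \<alpha> \<beta>"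
proof -
  assume r: "rep i f \<alpha> \<beta>"
  have "V * f - (of_int \<alpha> * V ^ Suc (Suc i) + of_int \<beta> * (U * V ^ Suc i)) =
     V * (f - (of_int \<alpha> * V ^ Suc i + of_int \<beta> * (U * V ^ i)))"
    by (simp add: algebra_simps)
  also have "\<dots> \<in> K (Suc (Suc (Suc i)))"
    by (intro K_V r[unfolded rep_def])
  finally show ?thesis unfolding rep_def .
qed

lemma rep_lin:
  assumes Z: "Z - (of_int s * U + of_int t * V) \<in> K 2" and r: "rep i f \<alpha> \<beta>"
  shows "rep (Suc i) (Z * f) (t * \<alpha> + d * s * \<beta>) (s * \<alpha> + t * \<beta>)"
proof (rule rep_cong)
  show "rep (Suc i) (of_int s * (U * f) + of_int t * (V * f)) (t * \<alpha> + d * s * \<beta>) (s * \<alpha> + t * \<beta>)"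
    using rep_add[OF rep_int[OF rep_U[OF r], of s] rep_int[OF rep_V[OF r], of t]] by (simp add: algebra_simps)
  have "Z * f - (of_int s * (U * f) + of_int t * (V * f)) = (Z - (of_int s * U + of_int t * V)) * f"
    by (simp add: algebra_simps)
  then show "Z * f - (of_int s * (U * f) + of_int t * (V * f)) \<in> K (Suc (Suc (Suc i)))"
    using K_mult_add[OF Z rep_K[OF r]] by (simp add: numeral_2_eq_2)
qed

lemma rep_exists: "f \<in> K (Suc i) \<Longrightarrow> \<exists>\<alpha> \<beta>. rep i f \<alpha> \<beta>"
proof (induction i arbitrary: f)
  case 0
  then obtain u v where "f - (of_int u * U + of_int v * V) \<in> K 2" using K1_linear by blast
  then have "rep 0 f v u" by (simp add: rep_def numeral_2_eq_2 add.commute)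
  then show ?case by blast
next
  case (Suc i)
  obtain g h where gh: "g \<in> K (Suc i)" "h \<in> K (Suc i)" "f - (U * g + V * h) \<in> I"
    using K_Suc_decomp[OF Suc(2)] by blast
  obtain \<alpha> \<beta> \<alpha>' \<beta>' where "rep i g \<alpha> \<beta>" "rep i h \<alpha>' \<beta>'" using Suc(1) gh by metis
  from rep_add[OF rep_U[OF this(1)] rep_V[OF this(2)]] I_subset_K[OF gh(3)]
  show ?case using rep_cong by blast
qed

text \<open>Multiplication by the conjugate t - s sqrt d produces the norm, which is prime to
  p.\<close>

lemma norm_dvd: "\<lbrakk>\<not> (int p dvd s \<and> int p dvd t); int p dvd t * \<alpha> + d * s * \<beta>; int p dvd s * \<alpha> + t * \<beta>\<rbrakk>
    \<Longrightarrow> int p dvd \<alpha> \<and> int p dvd \<beta>"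
proof -
  assume nz: "\<not> (int p dvd s \<and> int p dvd t)" and 1: "int p dvd t * \<alpha> + d * s * \<beta>" and 2: "int p dvd s * \<alpha> + t * \<beta>"
  have n: "\<not> int p dvd t * t - d * (s * s)" using norm_nonzero nz by blast
  have "(t * t - d * (s * s)) * \<alpha> = t * (t * \<alpha> + d * s * \<beta>) - d * s * (s * \<alpha> + t * \<beta>)"
    "(t * t - d * (s * s)) * \<beta> = t * (s * \<alpha> + t * \<beta>) - s * (t * \<alpha> + d * s * \<beta>)"
    by (simp_all add: algebra_simps)
  then have "int p dvd (t * t - d * (s * s)) * \<alpha>" "int p dvd (t * t - d * (s * s)) * \<beta>"
    using 1 2 by (auto intro!: dvd_diff)
  then show ?thesis using n prime_int_p prime_dvd_mult_iff by blast
qed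

text \<open>For a nonzero pair the images under \<open>U\<close> and \<open>V\<close> have the norm
  as determinant, so they would span the next layer; both vanish, and that layer would be zero. Only
  nontriviality of the next layer counts, so it may be the last one, of order p.\<close>

lemma basis_kernel:
  assumes U: "U * f \<in> K (Suc (Suc (Suc i)))" and V: "V * f \<in> K (Suc (Suc (Suc i)))"
    and i: "Suc (Suc (Suc i)) < C" and r: "rep i f \<alpha> \<beta>"
  shows "int p dvd \<alpha> \<and> int p dvd \<beta>"
proof (rule ccontr)
  assume nz: "\<not> (int p dvd \<alpha> \<and> int p dvd \<beta>)"
  let ?n = "\<alpha> * \<alpha> - d * (\<beta> * \<beta>)"
  have n: "\<not> int p dvd ?n" using norm_nonzero nz by blast
  have rU: "U * f - (of_int (d * \<beta>) * V ^ Suc (Suc i) + of_int \<alpha> * (U * V ^ Suc i)) \<in> K (Suc (Suc (Suc i)))"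
    using rep_U[OF r] by (simp only: rep_def)
  have rV: "V * f - (of_int \<alpha> * V ^ Suc (Suc i) + of_int \<beta> * (U * V ^ Suc i)) \<in> K (Suc (Suc (Suc i)))"
    using rep_V[OF r] by (simp only: rep_def)
  have bU: "of_int (d * \<beta>) * V ^ Suc (Suc i) + of_int \<alpha> * (U * V ^ Suc i) \<in> K (Suc (Suc (Suc i)))"
    using K_diff[OF U rU] by simp
  have bV: "of_int \<alpha> * V ^ Suc (Suc i) + of_int \<beta> * (U * V ^ Suc i) \<in> K (Suc (Suc (Suc i)))"
    using K_diff[OF V rV] by simp
  have "of_int ?n * V ^ Suc (Suc i) =
      of_int \<alpha> * (of_int \<alpha> * V ^ Suc (Suc i) + of_int \<beta> * (U * V ^ Suc i))
      - of_int \<beta> * (of_int (d * \<beta>) * V ^ Suc (Suc i) + of_int \<alpha> * (U * V ^ Suc i))"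
    by (simp add: algebra_simps)
  also have "\<dots> \<in> K (Suc (Suc (Suc i)))" by (intro K_diff K_mult bU bV)
  finally have 1: "V ^ Suc (Suc i) \<in> K (Suc (Suc (Suc i)))" by (rule cancel_K[OF n _ V_pow])
  have "of_int ?n * (U * V ^ Suc i) =
      of_int \<alpha> * (of_int (d * \<beta>) * V ^ Suc (Suc i) + of_int \<alpha> * (U * V ^ Suc i))
      - of_int (d * \<beta>) * (of_int \<alpha> * V ^ Suc (Suc i) + of_int \<beta> * (U * V ^ Suc i))"
    by (simp add: algebra_simps)
  also have "\<dots> \<in> K (Suc (Suc (Suc i)))" by (intro K_diff K_mult bU bV)
  finally have 2: "U * V ^ Suc i \<in> K (Suc (Suc (Suc i)))" by (rule cancel_K[OF n _ UV_pow])
  have "g \<in> K (Suc (Suc (Suc i)))" if g: "g \<in> K (Suc (Suc i))" for g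
  proof -
    obtain \<gamma> \<delta> where gd: "rep (Suc i) g \<gamma> \<delta>" using rep_exists[OF g] by blast
    have "of_int \<gamma> * V ^ Suc (Suc i) + of_int \<delta> * (U * V ^ Suc i) \<in> K (Suc (Suc (Suc i)))"
      by (intro K_add K_mult 1 2)
    from K_add[OF gd[unfolded rep_def] this] show ?thesis by simp
  qed
  then show False using K_strict[OF i] by blast
qed

lemma basis_independent:
  assumes "f \<in> K (Suc (Suc i))" "rep i f \<alpha> \<beta>" "Suc (Suc (Suc i)) < C"
  shows "int p dvd \<alpha> \<and> int p dvd \<beta>"
  by (rule basis_kernel[OF K_U K_V]) (use assms in auto)

text \<open>By \<open>card_top\<close> below, this says that the last term of the lower central series has order \<open>p\<^sup>2\<close>.\<close>

definition top2 :: bool where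
  "top2 \<longleftrightarrow> (\<forall>f \<alpha> \<beta>. f \<in> I \<longrightarrow> rep (C - 3) f \<alpha> \<beta> \<longrightarrow> int p dvd \<alpha> \<and> int p dvd \<beta>)"

lemma C3: "Suc (Suc (Suc (C - 3))) = C" "Suc (Suc (C - 3)) = C - 1" "Suc (C - 3) = C - 2" "Suc (C - 4) = C - 3"
  using C_ge by auto

text \<open>Multiplication by t + s sqrt d is injective, which raises the degree of \<open>w\<close>
  by one. If the product falls into the last layer, this needs that layer in full size.\<close>

lemma linear_step:
  assumes Z: "Z - (of_int s * U + of_int t * V) \<in> K 2" and nz: "\<not> (int p dvd s \<and> int p dvd t)"
    and w: "Z * w \<in> I" "w \<in> K i" and i: "Suc (Suc (Suc i)) < C \<or> (Suc (Suc (Suc i)) = C \<and> top2)"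
  shows "w \<in> K (Suc i)"
proof (cases i)
  \<comment> \<open>Degree 0 is spanned by 1 alone and is not covered by \<open>rep\<close>;
    independence of \<open>U\<close> and \<open>V\<close> takes its place.\<close>
  case 0
  obtain n where n: "w - of_int n \<in> K (Suc 0)" using decomp_int by blast
  have sl: "of_int s * U + of_int t * V \<in> K (Suc 0)" by (intro K_add K_mult U_in_K V_in_K)
  have "Z \<in> K (Suc 0)"
    using K_add[OF K_antimono[OF _ Z] sl] by simp
  then have "Z * (w - of_int n) \<in> K 2" using n by (rule K11)
  from K_diff[OF I_subset_K[OF w(1), of 2] this] have "of_int n * Z \<in> K 2"
    by (simp add: algebra_simps)
  then have "of_int n * Z - of_int n * (Z - (of_int s * U + of_int t * V)) \<in> K 2"
    by (intro K_diff K_mult[OF Z])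
  then have "of_int (n * s) * U + of_int (n * t) * V \<in> K 2" by (simp add: algebra_simps)
  then have "int p dvd n * s \<and> int p dvd n * t" by (rule linear_independent)
  then have "int p dvd n" using nz prime_int_p prime_dvd_mult_iff by blast
  then have "of_int n * 1 \<in> K (Suc 0)" by (rule int_dvd_K) (simp add: K_0)
  from K_add[OF n this] show ?thesis using 0 by simp
next
  case (Suc j)
  obtain \<alpha> \<beta> where r: "rep j w \<alpha> \<beta>" using rep_exists w(2) Suc by blast
  note r' = rep_lin[OF Z r]
  have "int p dvd t * \<alpha> + d * s * \<beta> \<and> int p dvd s * \<alpha> + t * \<beta>"
    using i
  proof
    assume "Suc (Suc (Suc i)) < C"
    then show ?thesis using Suc by (intro basis_independent[OF I_subset_K[OF w(1)] r']) simp
  next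
    assume "Suc (Suc (Suc i)) = C \<and> top2"
    moreover from this have "Suc j = C - 3" using Suc by linarith
    ultimately show ?thesis using r' w(1) unfolding top2_def by metis
  qed
  then have "int p dvd \<alpha> \<and> int p dvd \<beta>" using norm_dvd nz by blast
  then show ?thesis using rep_dvd[OF r] Suc by simp
qed

lemma linear_kernel:
  assumes Z: "Z - (of_int s * U + of_int t * V) \<in> K 2" and nz: "\<not> (int p dvd s \<and> int p dvd t)"
    and w: "Z * w \<in> I"
  shows "w \<in> K (C - 3)" and "top2 \<Longrightarrow> w \<in> K (C - 2)"
proof -
  have "i \<le> C - 3 \<Longrightarrow> w \<in> K i" for i
    by (induction i) (auto simp: K_0 intro!: linear_step[OF Z nz w])
  then show 1: "w \<in> K (C - 3)" by simp
  show "w \<in> K (C - 2)" if top2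
    using linear_step[OF Z nz w 1] that by (simp add: C3(1)) (simp add: C3(3))
qed

text \<open>When the last term has order p, one operator gives only \<open>K (C - 3)\<close>; two
  independent ones gain the missing step through \<open>basis_kernel\<close>.\<close>

lemma joint_kernel:
  assumes U: "U * w \<in> I" and V: "V * w \<in> I" shows "w \<in> K (C - 2)"
proof -
  have "\<not> int p dvd 1" using p_gt_1 by auto
  then have w: "w \<in> K (C - 3)" using linear_kernel(1)[of U 1 0 w] U by simp
  then obtain \<alpha> \<beta> where r: "rep (C - 4) w \<alpha> \<beta>" using rep_exists[of w "C - 4"] C3 by auto
  have "int p dvd \<alpha> \<and> int p dvd \<beta>"
    by (rule basis_kernel[OF I_subset_K[OF U] I_subset_K[OF V] _ r]) (use C_ge in simp)
  then have "w \<in> K (Suc (Suc (C - 4)))" using rep_dvd[OF r] by blast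
  then show ?thesis by (simp add: C3)
qed

text \<open>1 + j is invertible modulo \<open>I\<close>: the geometric series in -j stops at degree
  C.\<close>

lemma unit_cancel:
  assumes j: "j \<in> K (Suc 0)" and f: "f * (1 + j) \<in> I" shows "f \<in> I"
proof -
  have "1 - (- j) ^ C = (1 + j) * (\<Sum>i<C. (- j) ^ i)" using one_diff_power_eq[of "- j" C] by simp
  then have "f * ((1 + j) * (\<Sum>i<C. (- j) ^ i)) = f * (1 - (- j) ^ C)" by simp
  then have "f = (\<Sum>i<C. (- j) ^ i) * (f * (1 + j)) + f * (- j) ^ C"
    by (simp only: right_diff_distrib mult_1_right ac_simps) simp
  moreover have "(- j) ^ C \<in> I" by (rule K_C[OF _ K_power]) (auto intro: K_minus j)
  ultimately show ?thesis using I_add[OF I_mult[OF f] I_mult] by metis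
qed

text \<open>As g^p lies in M it acts trivially, so (1 + Z)^p - 1, which is Z^p plus p Z times a
  unit, annihilates. By the bound on the class Z^p does so already.\<close>

lemma p_mult_linear:
  assumes g: "acts g (1 + Z)" and Z: "Z \<in> K (Suc 0)" shows "of_nat p * Z \<in> I"
proof -
  obtain w where w: "g [^] p = \<Phi> w" using pow_p_in_M[OF acts_closed[OF g]] range_phi by (metis imageE)
  have "\<Phi> ((1 + Z) ^ p * 1) = \<Phi> 1"
  proof -
    have "\<Phi> ((1 + Z) ^ p * 1) = \<Phi> w \<otimes> \<Phi> 1 \<otimes> inv (\<Phi> w)"
      using acts_pow[OF g, of p] unfolding acts_def w by blast
    then show ?thesis using phi_comm[of w 1] by (simp add: m_assoc)
  qed
  then have 1: "(1 + Z) ^ p - 1 \<in> I" by (simp add: phi_eq_iff I_def)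
  obtain s where s: "(\<Sum>k<p. (1 + Z) ^ k) = Z ^ (p - 1) + of_nat p * (1 + Z * s)"
    using geometric_sum_prime[OF prime_p] by blast
  have "(1 + Z) ^ p - 1 = Z * (\<Sum>k<p. (1 + Z) ^ k)" using power_diff_1_eq[of "1 + Z" p] by simp
  also have "\<dots> = Z ^ p + of_nat p * Z * (1 + Z * s)"
    using p_gt_1 power_minus_mult[of p Z] by (simp add: s algebra_simps)
  finally have "of_nat p * Z * (1 + Z * s) = ((1 + Z) ^ p - 1) - Z ^ p" by simp
  moreover have "Z ^ p \<in> I" by (rule K_C[OF _ K_power[OF Z]]) (use C_cases in auto)
  ultimately have "of_nat p * Z * (1 + Z * s) \<in> I" using I_diff[OF 1] by simp
  then show ?thesis using unit_cancel[OF K_mult_right[OF Z]] by blast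
qed

lemma p_mult_K1: "f \<in> K (Suc 0) \<Longrightarrow> of_nat p * f \<in> I"
proof -
  assume "f \<in> K (Suc 0)"
  then obtain g h where gh: "f - (U * g + V * h) \<in> I" using K_Suc_decomp by blast
  have "acts x (1 + U)" "acts y (1 + V)" using acts_x acts_y by (simp_all add: U_def V_def)
  then have "of_nat p * U \<in> I" "of_nat p * V \<in> I" using p_mult_linear U_in_K V_in_K by blast+
  moreover have "of_nat p * f = of_nat p * (f - (U * g + V * h)) + g * (of_nat p * U) + h * (of_nat p * V)"
    by (simp add: algebra_simps)
  ultimately show ?thesis using gh by (simp add: I_add I_mult)
qed

lemma cancel_I1: "\<lbrakk>\<not> int p dvd n; of_int n * f \<in> I; f \<in> K (Suc 0)\<rbrakk> \<Longrightarrow> f \<in> I"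
  using cancel_I p_mult_K1 by blast

lemma p_dvd_I: "\<lbrakk>int p dvd n; f \<in> K (Suc 0)\<rbrakk> \<Longrightarrow> of_int n * f \<in> I"
proof -
  assume "int p dvd n" "f \<in> K (Suc 0)"
  then obtain k where "n = int p * k" by auto
  then have "of_int n * f = of_int k * (of_nat p * f)" by (simp add: algebra_simps)
  then show ?thesis using p_mult_K1[OF \<open>f \<in> K (Suc 0)\<close>] by (simp add: I_mult)
qed

lemma pow_p_phi: "g \<in> carrier G \<Longrightarrow> \<exists>w. g [^] p = \<Phi> w"
  using pow_p_in_M range_phi by (metis imageE)

lemma power_kernel:
  assumes g: "acts g (1 + Z)" and w: "g [^] p = \<Phi> w" shows "Z * w \<in> I"
proof -
  have gc: "g \<in> carrier G" using g by (rule acts_closed)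
  have "\<Phi> ((1 + Z) * w) = g \<otimes> g [^] p \<otimes> inv g" using g w by (simp add: acts_def)
  also have "\<dots> = \<Phi> w" using gc nat_pow_comm[of g 1 p] w by (simp add: m_assoc)
  finally show ?thesis by (simp add: phi_eq_iff I_def algebra_simps)
qed

lemma cmt_phi_left: "acts h (1 + Z) \<Longrightarrow> cmt (\<Phi> w) h = \<Phi> (- (Z * w))"
proof -
  assume h: "acts h (1 + Z)"
  have "cmt (\<Phi> w) h = \<Phi> w \<otimes> inv (h \<otimes> \<Phi> w \<otimes> inv h)"
    using acts_closed[OF h] by (simp add: cmt_def m_assoc inv_mult_group)
  also have "\<dots> = \<Phi> (w - (1 + Z) * w)" using h by (simp add: acts_def phi_diff)
  finally show ?thesis by (simp add: algebra_simps)
qed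

lemma acts_x1: "acts x (1 + U)" and acts_y1: "acts y (1 + V)"
  using acts_x acts_y by (simp_all add: U_def V_def)

lemma cmt_y_direction:
  assumes "dir g s t" shows "\<exists>e. cmt g y = \<Phi> e \<and> e - of_nat s \<in> K (Suc 0)"
proof -
  obtain f where f: "g = \<Phi> f \<otimes> (x [^] s \<otimes> y [^] t)" using assms by (auto simp: dir_def)
  have "cmt (y [^] t) y = \<one>" using nat_pow_comm[of y t 1] by (simp add: cmt_def m_assoc)
  then have "cmt (x [^] s \<otimes> y [^] t) y = cmt (x [^] s) y" by (simp add: cmt_mult_left)
  also have "\<dots> = \<Phi> (\<Sum>k<s. (1 + U) ^ k)"
    using cmt_pow[OF acts_x1 y_closed phi_one[symmetric], of s] by simp
  finally have "cmt g y = \<Phi> f \<otimes> \<Phi> (\<Sum>k<s. (1 + U) ^ k) \<otimes> inv (\<Phi> f) \<otimes> cmt (\<Phi> f) y"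
    unfolding f by (simp add: cmt_mult_left)
  also have "\<dots> = \<Phi> ((\<Sum>k<s. (1 + U) ^ k) + - (V * f))"
    using phi_comm[of f] by (simp add: cmt_phi_left[OF acts_y1] m_assoc phi_add del: add_uminus_conv_diff)
  finally have "cmt g y = \<Phi> ((\<Sum>k<s. (1 + U) ^ k) + - (V * f))" .
  moreover have "(\<Sum>k<s. (1 + U) ^ k) + - (V * f) - of_nat s \<in> K (Suc 0)"
    using K_diff[OF geometric_sum_K[OF U_in_K, of s] K_mult_right[OF V_in_K, of f]] by (simp add: algebra_simps)
  ultimately show ?thesis by blast
qed

lemma cmt_x_direction:
  assumes "dir g s t" shows "\<exists>e. cmt g x = \<Phi> e \<and> e + of_nat t \<in> K (Suc 0)"
proof -
  obtain f where f: "g = \<Phi> f \<otimes> (x [^] s \<otimes> y [^] t)" using assms by (auto simp: dir_def)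
  define e where "e = (\<Sum>k<t. (1 + V) ^ k)"
  obtain j where j: "j \<in> aug" "acts (x [^] s) (1 + j)" using exists_acts[of "x [^] s"] by auto
  have xx: "cmt (x [^] s) x = \<one>" using nat_pow_comm[of x s 1] by (simp add: cmt_def m_assoc)
  have "cmt y x = \<Phi> (- 1)" using inv_cmt[of x y] by (simp add: phi_minus phi_one)
  then have yt: "cmt (y [^] t) x = \<Phi> (e * - 1)"
    unfolding e_def by (rule cmt_pow[OF acts_y1 x_closed])
  have "cmt (x [^] s \<otimes> y [^] t) x = x [^] s \<otimes> \<Phi> (e * - 1) \<otimes> inv (x [^] s)"
    by (simp add: cmt_mult_left xx yt)
  also have "\<dots> = \<Phi> ((1 + j) * (e * - 1))" using j by (simp only: acts_def)
  finally have "cmt g x = \<Phi> f \<otimes> \<Phi> ((1 + j) * (e * - 1)) \<otimes> inv (\<Phi> f) \<otimes> cmt (\<Phi> f) x"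
    unfolding f by (simp add: cmt_mult_left)
  also have "\<dots> = \<Phi> ((1 + j) * (e * - 1) + - (U * f))"
    unfolding phi_add cmt_phi_left[OF acts_x1] using phi_comm[of f] by (simp add: m_assoc)
  finally have "cmt g x = \<Phi> ((1 + j) * (e * - 1) + - (U * f))" .
  moreover have "(1 + j) * (e * - 1) + - (U * f) + of_nat t = - (e - of_nat t) - j * e - U * f"
    by (simp add: algebra_simps)
  moreover have "- (e - of_nat t) - j * e - U * f \<in> K (Suc 0)"
    unfolding e_def
    by (intro K_diff K_minus K_mult_right[OF aug_K[OF j(1)]] K_mult_right[OF U_in_K] geometric_sum_K[OF V_in_K])
  ultimately show ?thesis by metis
qed

text \<open>[g^p, h] is computed twice, from the powers of g and from the action of h on g^p. Taking
  h = y isolates s, and h = x isolates t.\<close>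

lemma power_commutators:
  assumes g: "dir g s t" "acts g (1 + Z)" and Z: "Z - (of_nat s * U + of_nat t * V) \<in> K 2"
    and w: "g [^] p = \<Phi> w"
  shows "of_nat s * (Z ^ (p - 1) + of_nat p) + V * w \<in> I"
    and "U * w - of_nat t * (Z ^ (p - 1) + of_nat p) \<in> I"
proof -
  have "of_nat s * U + of_nat t * V \<in> K (Suc 0)" by (intro K_add K_mult U_in_K V_in_K)
  from K_add[OF K_antimono[OF _ Z, of "Suc 0"] this] have Z1: "Z \<in> K (Suc 0)" by simp
  obtain q where q: "(\<Sum>k<p. (1 + Z) ^ k) = Z ^ (p - 1) + of_nat p * (1 + Z * q)"
    using geometric_sum_prime[OF prime_p] by blast
  let ?N = "Z ^ (p - 1) + of_nat p"
  \<comment> \<open>\<open>?N\<close> kills positive degree, so only the constant term of the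
    commutator of g and h matters.\<close>
  have N: "?N * k \<in> I" if "k \<in> K (Suc 0)" for k
  proof -
    have "Z ^ (p - 1) * k \<in> I"
      by (rule K_C[OF _ K_mult_add[OF K_power[OF Z1] that]]) (use C_cases p_gt_1 in auto)
    from I_add[OF this p_mult_K1[OF that]] show ?thesis by (simp add: algebra_simps)
  qed
  have main: "?N * of_int n + W * w \<in> I"
    if h: "acts h (1 + W)" and e: "cmt g h = \<Phi> e" "e - of_int n \<in> K (Suc 0)" for h W e n
  proof -
    have "\<Phi> ((\<Sum>k<p. (1 + Z) ^ k) * e) = \<Phi> (- (W * w))"
      using cmt_pow[OF g(2) acts_closed[OF h] e(1), of p] cmt_phi_left[OF h, of w] w by simp
    then have 1: "(\<Sum>k<p. (1 + Z) ^ k) * e + W * w \<in> I" by (simp add: phi_eq_iff I_def)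
    have "?N * of_int n + W * w =
       ((\<Sum>k<p. (1 + Z) ^ k) * e + W * w) - (e * q) * (of_nat p * Z) - ?N * (e - of_int n)"
      by (simp add: q algebra_simps)
    also have "\<dots> \<in> I" by (intro I_diff 1 I_mult[OF p_mult_K1[OF Z1]] N[OF e(2)])
    finally show ?thesis .
  qed
  obtain e where "cmt g y = \<Phi> e" "e - of_nat s \<in> K (Suc 0)" using cmt_y_direction[OF g(1)] by blast
  then show "of_nat s * ?N + V * w \<in> I" using main[OF acts_y1, of e "int s"] by (simp add: mult.commute)
  obtain e' where "cmt g x = \<Phi> e'" "e' + of_nat t \<in> K (Suc 0)" using cmt_x_direction[OF g(1)] by blast
  then show "U * w - of_nat t * ?N \<in> I" using main[OF acts_x1, of e' "- int t"] by (simp add: algebra_simps)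
qed

end

section \<open>Power formulas\<close>

lemma binomial_prime_power:
  fixes u v :: "'r::comm_ring_1"
  assumes p: "Factorial_Ring.prime p"
  shows "\<exists>r. (u + v) ^ p = u ^ p + v ^ p + of_nat p * r"
proof -
  have p0: "p > 0" using p prime_gt_0_nat by auto
  have "\<exists>q. p choose k = p * q" if "0 < k" "k < p" for k
    using dvd_choose_prime[of k p] that p by (auto simp: dvd_def)
  then obtain q where q: "\<And>k. 0 < k \<Longrightarrow> k < p \<Longrightarrow> p choose k = p * q k" by metis
  let ?f = "\<lambda>k. of_nat (p choose k) * u ^ k * v ^ (p - k)"
  have "{..p} = insert 0 (insert p {0<..<p})" using p0 by auto
  then have "(u + v) ^ p = ?f 0 + (?f p + (\<Sum>k\<in>{0<..<p}. ?f k))"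
    using p0 by (simp add: binomial_ring)
  also have "(\<Sum>k\<in>{0<..<p}. ?f k) = (\<Sum>k\<in>{0<..<p}. of_nat p * (of_nat (q k) * u ^ k * v ^ (p - k)))"
    by (rule sum.cong) (auto simp: q mult.assoc)
  finally have "(u + v) ^ p = u ^ p + v ^ p + of_nat p * (\<Sum>k\<in>{0<..<p}. of_nat (q k) * u ^ k * v ^ (p - k))"
    by (simp add: sum_distrib_left)
  then show ?thesis by blast
qed

lemma fermat_int:
  fixes t :: int
  assumes p: "Factorial_Ring.prime p" shows "[t ^ p = t] (mod int p)"
proof -
  have p0: "p > 0" using p prime_gt_0_nat by auto
  define n where "n = nat (t mod int p)"
  have n: "[int n = t] (mod int p)" using p0 by (simp add: n_def cong_def)
  have "[n ^ p = n] (mod p)"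
  proof (cases "p dvd n")
    case True
    moreover have "p dvd n ^ p" using dvd_trans[OF True dvd_power[of p n]] p0 by simp
    ultimately show ?thesis by (simp add: cong_def)
  next
    case False
    then have "[n ^ (p - 1) * n = 1 * n] (mod p)" using fermat_theorem[OF p] by (intro cong_mult) auto
    then show ?thesis using power_minus_mult[OF p0, of n] by (simp only: mult_1)
  qed
  then have "[int n ^ p = int n] (mod int p)" using cong_int_iff by (metis of_nat_power)
  then show ?thesis using n cong_pow[OF n, of p] by (meson cong_sym cong_trans)
qed

text \<open>\<open>quad_pow d t s n\<close> is the coordinate pair of \<open>(t + s \<surd>d)\<^sup>n\<close>.\<close>

primrec quad_pow :: "int \<Rightarrow> int \<Rightarrow> int \<Rightarrow> nat \<Rightarrow> int \<times> int" where
  "quad_pow d t s 0 = (1, 0)"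
| "quad_pow d t s (Suc n) =
     (t * fst (quad_pow d t s n) + d * s * snd (quad_pow d t s n),
      s * fst (quad_pow d t s n) + t * snd (quad_pow d t s n))"

text \<open>Frobenius is conjugation: the p-th power of sqrt d is d^((p-1)/2) sqrt d = - sqrt d. The
  computation takes place in the integer polynomials modulo X^2 - d.\<close>

lemma quad_pow_frobenius:
  assumes p: "Factorial_Ring.prime p" and "odd p" and d: "[d ^ ((p - 1) div 2) = - 1] (mod int p)"
  shows "int p dvd fst (quad_pow d t s p) - t" and "int p dvd snd (quad_pow d t s p) + s"
proof -
  define m :: "int poly" where "m = [:- d, 0, 1:]"
  have 1: "m dvd [:t, s:] ^ n - [:fst (quad_pow d t s n), snd (quad_pow d t s n):]" for n
  proof (induction n)
    case 0
    then show ?case by (simp add: one_pCons)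
  next
    case (Suc n)
    define A where "A = fst (quad_pow d t s n)"
    define B where "B = snd (quad_pow d t s n)"
    have "[:t, s:] ^ Suc n - [:fst (quad_pow d t s (Suc n)), snd (quad_pow d t s (Suc n)):] =
        [:t, s:] * ([:t, s:] ^ n - [:A, B:]) + smult (s * B) m"
      unfolding right_diff_distrib by (simp add: A_def B_def m_def algebra_simps)
    moreover have "m dvd [:t, s:] * ([:t, s:] ^ n - [:A, B:]) + smult (s * B) m"
      using Suc unfolding A_def B_def by (intro dvd_add dvd_mult dvd_smult) auto
    ultimately show ?case by (simp only:)
  qed
  define h where "h = (p - 1) div 2"
  have ph: "p = Suc (2 * h)" using \<open>odd p\<close> by (auto simp: h_def elim!: oddE)
  obtain r :: "int poly" where r: "([:t:] + [:0, s:]) ^ p = [:t:] ^ p + [:0, s:] ^ p + of_nat p * r"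
    using binomial_prime_power[OF p] by blast
  \<comment> \<open>Reducing the binomial remainder to degree 1 keeps its factor p visible in the
    coordinates.\<close>
  have red: "\<exists>\<alpha> \<beta>. m dvd f - [:\<alpha>, \<beta>:]" for f :: "int poly"
  proof (induction f)
    case 0
    show ?case by (intro exI[of _ 0]) simp
  next
    case (pCons c f)
    then obtain \<alpha> \<beta> where *: "m dvd f - [:\<alpha>, \<beta>:]" by blast
    have "pCons c f - [:c + d * \<beta>, \<alpha>:] = [:0, 1:] * (f - [:\<alpha>, \<beta>:]) + smult \<beta> m"
      by (simp add: m_def algebra_simps)
    moreover have "m dvd [:0, 1:] * (f - [:\<alpha>, \<beta>:]) + smult \<beta> m"
      using * by (intro dvd_add dvd_mult dvd_smult) auto
    ultimately have "m dvd pCons c f - [:c + d * \<beta>, \<alpha>:]" by (simp only:)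
    then show ?case by blast
  qed
  obtain \<alpha> \<beta> where ab: "m dvd r - [:\<alpha>, \<beta>:]" using red by blast
  have c: "[:c:] ^ n = [:c ^ n:]" for c :: int and n by (induction n) (auto simp: one_pCons)
  have xh: "m dvd ([:0, 1:] ^ 2) ^ h - [:d:] ^ h"
  proof -
    have "([:0, 1:] ^ 2) - [:d:] = m" by (simp add: m_def power2_eq_square)
    then show ?thesis using power_diff_sumr2[of "[:0, 1:] ^ 2" h "[:d:]"] by simp
  qed
  have "[:0, s:] ^ p - [:0, s ^ p * d ^ h:] = [:s ^ p:] * ([:0, 1:] * (([:0, 1:] ^ 2) ^ h - [:d:] ^ h))"
  proof -
    have "[:0, s:] = [:s:] * [:0, 1:]" by simp
    then have "[:0, s:] ^ p = [:s ^ p:] * [:0, 1:] ^ p" by (metis power_mult_distrib c)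
    also have "[:0, 1:] ^ p = [:0, 1:] * ([:0, 1:] ^ 2) ^ h" by (simp add: ph power_mult)
    finally have "[:0, s:] ^ p = [:s ^ p:] * ([:0, 1:] * ([:0, 1:] ^ 2) ^ h)" .
    moreover have "[:0, s ^ p * d ^ h:] = [:s ^ p:] * ([:0, 1:] * [:d:] ^ h)" by (simp add: c)
    ultimately show ?thesis by (simp only: right_diff_distrib)
  qed
  then have zp: "m dvd [:0, s:] ^ p - [:0, s ^ p * d ^ h:]" using xh by (metis dvd_mult)
  let ?A = "fst (quad_pow d t s p)" and ?B = "snd (quad_pow d t s p)"
  have tp: "[:t:] + [:0, s:] = [:t, s:]" by simp
  have rp: "of_nat p * [:\<alpha>, \<beta>:] = [:int p * \<alpha>, int p * \<beta>:]" by (simp add: of_nat_poly)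
  have "[:?A - (t ^ p + int p * \<alpha>), ?B - (s ^ p * d ^ h + int p * \<beta>):] =
     - ([:t, s:] ^ p - [:?A, ?B:]) + ([:0, s:] ^ p - [:0, s ^ p * d ^ h:]) + of_nat p * (r - [:\<alpha>, \<beta>:])"
    using r[unfolded tp c] unfolding right_diff_distrib rp by (simp add: algebra_simps)
  also have "m dvd \<dots>" using 1[of p] zp ab by (intro dvd_add) (auto simp del: minus_diff_eq intro: dvd_mult)
  finally have dvd: "m dvd [:?A - (t ^ p + int p * \<alpha>), ?B - (s ^ p * d ^ h + int p * \<beta>):]" .
  \<comment> \<open>A multiple of a monic quadratic that has degree at most 1 is zero.\<close>
  have "[:?A - (t ^ p + int p * \<alpha>), ?B - (s ^ p * d ^ h + int p * \<beta>):] = 0"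
  proof (rule ccontr)
    assume "\<not> ?thesis"
    then have "degree m \<le> degree [:?A - (t ^ p + int p * \<alpha>), ?B - (s ^ p * d ^ h + int p * \<beta>):]"
      using dvd_imp_degree_le[OF dvd] by simp
    then show False by (simp add: m_def split: if_splits)
  qed
  then have eq: "?A = t ^ p + int p * \<alpha>" "?B = s ^ p * d ^ h + int p * \<beta>" by auto
  have "[t ^ p = t] (mod int p)" by (rule fermat_int[OF p])
  then show "int p dvd ?A - t" unfolding eq cong_iff_dvd_diff
    by (metis add.commute add_diff_eq dvd_add dvd_triv_left)
  have "[s ^ p * d ^ h = s * - 1] (mod int p)"
    by (intro cong_mult fermat_int[OF p] d[folded h_def])
  then have "int p dvd (s ^ p * d ^ h - s * - 1) + int p * \<beta>" unfolding cong_iff_dvd_diff by (intro dvd_add) auto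
  then show "int p dvd ?B + s" unfolding eq by (simp add: algebra_simps)
qed

text \<open>Complete homogeneous symmetric polynomials in two variables.\<close>

primrec homog :: "'r::comm_ring_1 \<Rightarrow> 'r \<Rightarrow> nat \<Rightarrow> 'r" where
  "homog T Z 0 = 1"
| "homog T Z (Suc m) = T * homog T Z m + Z ^ Suc m"

text \<open>If \<open>g\<close> acts as \<open>1 + Z\<close> and \<open>gh\<close> acts as \<open>1 + T\<close>, then \<open>(gh)\<^sup>n\<close> differs from \<open>g\<^sup>n h\<^sup>n\<close> by
  \<open>- (1 + Z)\<close> times this ring element applied to \<open>[g, h]\<close>.\<close>

primrec power_defect :: "'r::comm_ring_1 \<Rightarrow> 'r \<Rightarrow> nat \<Rightarrow> 'r" where
  "power_defect T Z 0 = 0"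
| "power_defect T Z (Suc n) = (1 + T) * power_defect T Z n + (\<Sum>i<n. (1 + Z) ^ i)"

lemma power_defect_homog:
  "power_defect T Z n = (\<Sum>m<n. of_nat (n choose (m + 2)) * homog T Z m)"
proof (induction n)
  case (Suc n)
  have geo: "(\<Sum>i<n. (1 + Z) ^ i) = (\<Sum>m<n. of_nat (n choose (m + 1)) * Z ^ m)" for n
  proof (induction n)
    case (Suc n)
    have "(1 + Z) ^ n = (\<Sum>k\<le>n. of_nat (n choose k) * Z ^ k)"
      using binomial_ring[of Z 1 n] by (simp add: add.commute)
    then have "(\<Sum>i<Suc n. (1 + Z) ^ i) =
       (\<Sum>m<Suc n. of_nat (n choose (m + 1)) * Z ^ m) + (\<Sum>k<Suc n. of_nat (n choose k) * Z ^ k)"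
      using Suc by (simp add: lessThan_Suc_atMost[symmetric] binomial_eq_0)
    also have "\<dots> = (\<Sum>m<Suc n. of_nat (Suc n choose (m + 1)) * Z ^ m)"
      by (simp only: sum.distrib[symmetric]) (simp add: algebra_simps)
    finally show ?case .
  qed simp
  \<comment> \<open>Multiplication by T shifts the degree at the cost of pure powers of Z, and these
    cancel the geometric sum; Pascal's rule does the rest.\<close>
  have T: "T * homog T Z m = homog T Z (Suc m) - Z ^ Suc m" for m by simp
  let ?c = "\<lambda>m. of_nat (n choose m) :: 'a"
  have "power_defect T Z (Suc n) =
     (\<Sum>m<n. ?c (m + 2) * homog T Z m) + (\<Sum>m<n. ?c (m + 2) * (T * homog T Z m)) + (\<Sum>m<n. ?c (m + 1) * Z ^ m)"
    using Suc geo[of n] by (simp add: distrib_right sum_distrib_left sum.distrib mult.left_commute)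
  also have "(\<Sum>m<n. ?c (m + 2) * (T * homog T Z m)) =
     (\<Sum>m<n. ?c (Suc m + 1) * homog T Z (Suc m)) - (\<Sum>m<n. ?c (Suc m + 1) * Z ^ Suc m)"
    unfolding T by (simp add: right_diff_distrib sum_subtractf del: homog.simps)
  also have "(\<Sum>m<n. ?c (Suc m + 1) * homog T Z (Suc m)) = (\<Sum>m<Suc n. ?c (m + 1) * homog T Z m) - ?c 1"
    by (subst sum.lessThan_Suc_shift) (simp del: homog.simps(2))
  also have "(\<Sum>m<n. ?c (Suc m + 1) * Z ^ Suc m) = (\<Sum>m<Suc n. ?c (m + 1) * Z ^ m) - ?c 1"
    by (subst sum.lessThan_Suc_shift) simp
  also have "(\<Sum>m<Suc n. ?c (m + 1) * Z ^ m) = (\<Sum>m<n. ?c (m + 1) * Z ^ m)"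
    by (simp add: binomial_eq_0)
  also have "(\<Sum>m<n. ?c (m + 2) * homog T Z m) = (\<Sum>m<Suc n. ?c (m + 2) * homog T Z m)"
    by (simp add: binomial_eq_0)
  finally have "power_defect T Z (Suc n) =
     (\<Sum>m<Suc n. ?c (m + 2) * homog T Z m) + (\<Sum>m<Suc n. ?c (m + 1) * homog T Z m)"
    by (simp add: algebra_simps)
  also have "\<dots> = (\<Sum>m<Suc n. of_nat (Suc n choose (m + 2)) * homog T Z m)"
    by (simp only: sum.distrib[symmetric]) (simp add: algebra_simps)
  finally show ?case .
qed simp

lemma power_defect_prime:
  assumes p: "Factorial_Ring.prime p"
  shows "\<exists>r. power_defect T Z p = homog T Z (p - 2) + of_nat p * r"
proof -
  have "p \<ge> 2" using p by (rule prime_ge_2_nat)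
  then obtain m where m: "p = Suc (Suc m)" by (metis Suc_1 Suc_le_D numeral_2_eq_2 Suc_le_mono)
  have "\<exists>q. p choose (k + 2) = p * q" if "k < m" for k
    using dvd_choose_prime[of "k + 2" p] that p m by (auto simp: dvd_def)
  then obtain q where q: "\<And>k. k < m \<Longrightarrow> p choose (k + 2) = p * q k" by metis
  have "power_defect T Z p = (\<Sum>k<m. of_nat (p choose (k + 2)) * homog T Z k) + homog T Z (p - 2)"
    unfolding power_defect_homog by (simp add: m binomial_eq_0)
  also have "(\<Sum>k<m. of_nat (p choose (k + 2)) * homog T Z k) = (\<Sum>k<m. of_nat p * (of_nat (q k) * homog T Z k))"
    by (rule sum.cong) (auto simp: q mult.assoc simp del: add_2_eq_Suc')
  finally have "power_defect T Z p = homog T Z (p - 2) + of_nat p * (\<Sum>k<m. of_nat (q k) * homog T Z k)"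
    by (simp add: sum_distrib_left add.commute)
  then show ?thesis by blast
qed

text \<open>The coordinates of \<open>homog T Z n\<close> for T = t + s sqrt d and Z = s sqrt d, the
  leading parts of the operators of x^s y^t and of x^s.\<close>

primrec quad_homog :: "int \<Rightarrow> int \<Rightarrow> int \<Rightarrow> nat \<Rightarrow> int \<times> int" where
  "quad_homog d t s 0 = (1, 0)"
| "quad_homog d t s (Suc n) =
     (t * fst (quad_homog d t s n) + d * s * snd (quad_homog d t s n) + fst (quad_pow d 0 s (Suc n)),
      s * fst (quad_homog d t s n) + t * snd (quad_homog d t s n) + snd (quad_pow d 0 s (Suc n)))"

text \<open>This is (T - Z) h_n(T, Z) = T^(n+1) - Z^(n+1) with T - Z = t.\<close>

lemma quad_homog_pow:
  "t * fst (quad_homog d t s n) = fst (quad_pow d t s (Suc n)) - fst (quad_pow d 0 s (Suc n)) \<and>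
   t * snd (quad_homog d t s n) = snd (quad_pow d t s (Suc n)) - snd (quad_pow d 0 s (Suc n))"
proof (induction n)
  case (Suc n)
  define A where "A = fst (quad_homog d t s n)"
  define B where "B = snd (quad_homog d t s n)"
  define P where "P = quad_pow d t s (Suc n)"
  define Q where "Q = quad_pow d 0 s (Suc n)"
  have AB: "t * A = fst P - fst Q" "t * B = snd P - snd Q"
    using Suc unfolding A_def B_def P_def Q_def by blast+
  have H: "quad_homog d t s (Suc n) = (t * A + d * s * B + fst Q, s * A + t * B + snd Q)"
    by (simp only: quad_homog.simps A_def B_def Q_def)
  have P': "quad_pow d t s (Suc (Suc n)) = (t * fst P + d * s * snd P, s * fst P + t * snd P)"
    unfolding P_def by (rule quad_pow.simps(2))
  have Q': "quad_pow d 0 s (Suc (Suc n)) = (d * s * snd Q, s * fst Q)"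
    unfolding Q_def by (subst quad_pow.simps(2)) simp
  have "t * (t * A + d * s * B + fst Q) = t * (t * A) + d * s * (t * B) + t * fst Q"
    "t * (s * A + t * B + snd Q) = s * (t * A) + t * (t * B) + t * snd Q"
    by (simp_all add: algebra_simps)
  then show ?case unfolding H P' Q' fst_conv snd_conv AB by (simp add: algebra_simps)
qed simp

context metabelian_action
begin

text \<open>A new factor gh enters from the left: it acts on the old defect, and moving h past g^n
  costs a commutator, which is a geometric sum.\<close>

lemma mult_pow_defect:
  fixes n :: nat
  assumes g: "acts g (1 + Z)" and h: "acts h (1 + W)" and T: "1 + T = (1 + Z) * (1 + W)"
    and e: "cmt g h = \<Phi> e"
  shows "(g \<otimes> h) [^] n = \<Phi> (- ((1 + Z) * e * power_defect T Z n)) \<otimes> (g [^] n \<otimes> h [^] n)"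
proof (induction n)
  case (Suc n)
  have gc: "g \<in> carrier G" and hc: "h \<in> carrier G" using g h acts_closed by auto
  have gh: "acts (g \<otimes> h) (1 + T)" unfolding T by (rule acts_mult[OF g h])
  define \<theta> where "\<theta> = - ((1 + Z) * e * power_defect T Z n)"
  define E where "E = (\<Sum>k<n. (1 + Z) ^ k) * e"
  have 1: "(g \<otimes> h) \<otimes> \<Phi> \<theta> = \<Phi> ((1 + T) * \<theta>) \<otimes> (g \<otimes> h)"
    using gh gc hc by (simp add: acts_def m_assoc inv_mult_group)
  have "cmt h (g [^] n) = \<Phi> (- E)"
    using inv_cmt[of "g [^] n" h] gc hc cmt_pow[OF g hc e, of n] by (simp add: E_def phi_minus)
  then have 2: "h \<otimes> g [^] n = \<Phi> (- E) \<otimes> (g [^] n \<otimes> h)"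
    using gc hc by (simp add: cmt_def m_assoc flip: \<open>cmt h (g [^] n) = \<Phi> (- E)\<close>)
  have 3: "g \<otimes> \<Phi> (- E) = \<Phi> ((1 + Z) * - E) \<otimes> g"
  proof -
    have "\<Phi> ((1 + Z) * - E) = g \<otimes> \<Phi> (- E) \<otimes> inv g" using g unfolding acts_def by blast
    then show ?thesis using gc by (simp only: m_assoc phi_closed inv_closed l_inv r_one m_closed)
  qed
  have "(g \<otimes> h) [^] Suc n = ((g \<otimes> h) \<otimes> \<Phi> \<theta>) \<otimes> (g [^] n \<otimes> h [^] n)"
    using gc hc Suc unfolding \<theta>_def by (subst nat_pow_Suc2) (auto simp: m_assoc)
  also have "\<dots> = \<Phi> ((1 + T) * \<theta>) \<otimes> (g \<otimes> (h \<otimes> g [^] n) \<otimes> h [^] n)"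
    unfolding 1 using gc hc by (simp add: m_assoc)
  also have "\<dots> = \<Phi> ((1 + T) * \<theta>) \<otimes> ((g \<otimes> \<Phi> (- E)) \<otimes> (g [^] n \<otimes> (h \<otimes> h [^] n)))"
    unfolding 2 using gc hc by (simp add: m_assoc)
  also have "\<dots> = \<Phi> ((1 + T) * \<theta> + (1 + Z) * - E) \<otimes> ((g \<otimes> g [^] n) \<otimes> (h \<otimes> h [^] n))"
    unfolding 3 phi_add using gc hc by (simp add: m_assoc)
  also have "(1 + T) * \<theta> + (1 + Z) * - E = - ((1 + Z) * e * power_defect T Z (Suc n))"
    by (simp add: \<theta>_def E_def algebra_simps)
  finally show ?case using gc hc by (simp only: nat_pow_Suc2)
qed (use g h acts_closed in auto)

end

context thin_normalized
begin

lemma not_dvd_1: "\<not> int p dvd 1"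
  using p_gt_1 by auto

lemma not_dvd_2: "\<not> int p dvd 2"
  using p5 zdvd_not_zless[of 2 "int p"] by auto

lemma not_dvd_d: "\<not> int p dvd d"
  using norm_nonzero[of 0 1] not_dvd_1 by auto

lemma odd_p: "odd p"
  using prime_p p5 prime_odd_nat by auto

lemma d_half: "[d ^ ((p - 1) div 2) = - 1] (mod int p)"
proof -
  have "\<not> QuadRes (int p) d"
  proof
    assume "QuadRes (int p) d"
    then obtain y where "[y\<^sup>2 = d] (mod int p)" by (auto simp: QuadRes_def)
    then have "int p dvd y * y - d * (1 * 1)" by (simp add: cong_iff_dvd_diff power2_eq_square)
    then show False using norm_nonzero not_dvd_1 by blast
  qed
  moreover have "\<not> [d = 0] (mod int p)" using not_dvd_d by (simp add: cong_0_iff)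
  ultimately have "Legendre d (int p) = - 1" by (simp add: Legendre_def)
  moreover have "[Legendre d (int p) = d ^ ((p - 1) div 2)] (mod int p)"
    using euler_criterion[of p d] prime_p p5 by simp
  ultimately show ?thesis by (simp add: cong_sym)
qed

lemma prime_dvd_cancel: "\<lbrakk>int p dvd m * n; \<not> int p dvd m\<rbrakk> \<Longrightarrow> int p dvd n"
  using prime_int_p prime_dvd_mult_iff by blast

text \<open>z^(p-1) is the conjugate of z divided by z, that is, the square of the conjugate divided
  by the norm \<open>D\<close>; here the denominator is cleared.\<close>

lemma quad_pow_formula:
  fixes s t :: int
  defines "A \<equiv> fst (quad_pow d t s (p - 1))" and "B \<equiv> snd (quad_pow d t s (p - 1))"
    and "D \<equiv> t * t - d * (s * s)"
  shows "int p dvd D * A - (t * t + d * (s * s))" and "int p dvd D * B + 2 * s * t"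
proof -
  have "Suc (p - 1) = p" using p_gt_1 by simp
  then have "quad_pow d t s p = (t * A + d * s * B, s * A + t * B)"
    using quad_pow.simps(2)[of d t s "p - 1"] by (simp add: A_def B_def)
  then have 1: "int p dvd t * A + d * s * B - t" and 2: "int p dvd s * A + t * B + s"
    using quad_pow_frobenius[OF prime_p odd_p d_half, of t s] by simp_all
  have "D * A - (t * t + d * (s * s)) = t * (t * A + d * s * B - t) - d * s * (s * A + t * B + s)"
    "D * B + 2 * s * t = t * (s * A + t * B + s) - s * (t * A + d * s * B - t)"
    by (simp_all add: D_def algebra_simps)
  then show "int p dvd D * A - (t * t + d * (s * s))" "int p dvd D * B + 2 * s * t"
    using 1 2 by (auto intro!: dvd_diff)
qed

text \<open>h_(p-2) is (T^(p-1) - Z^(p-1)) / t, and Z^(p-1) = -1 for Z = s sqrt d with s nonzero.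
  The factors t and \<open>D\<close> clear denominators, the factor s makes the case of s divisible
  by p trivial.\<close>

lemma quad_homog_formula:
  fixes s t :: int
  defines "A \<equiv> fst (quad_homog d t s (p - 2))" and "B \<equiv> snd (quad_homog d t s (p - 2))"
    and "D \<equiv> t * t - d * (s * s)"
  shows "int p dvd s * t * D * A - 2 * s * t * t" and "int p dvd s * t * D * B + 2 * s * s * t"
proof -
  have "int p dvd s * t * D * A - 2 * s * t * t \<and> int p dvd s * t * D * B + 2 * s * s * t"
  proof (cases "int p dvd s")
    case True
    then show ?thesis by (auto simp: mult.assoc intro!: dvd_diff dvd_add)
  next
    case s: False
    have Suc: "Suc (p - 2) = p - 1" using p5 by simp
    define A1 B1 A0 B0 where "A1 = fst (quad_pow d t s (p - 1))" and "B1 = snd (quad_pow d t s (p - 1))"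
      and "A0 = fst (quad_pow d 0 s (p - 1))" and "B0 = snd (quad_pow d 0 s (p - 1))"
    have tA: "t * A = A1 - A0" and tB: "t * B = B1 - B0"
      using quad_homog_pow[of t d s "p - 2"] unfolding Suc A_def B_def A1_def B1_def A0_def B0_def by auto
    have 1: "int p dvd D * A1 - (t * t + d * (s * s))" "int p dvd D * B1 + 2 * s * t"
      unfolding A1_def B1_def D_def by (rule quad_pow_formula)+
    have 0: "int p dvd (0 * 0 - d * (s * s)) * A0 - (0 * 0 + d * (s * s))" "int p dvd (0 * 0 - d * (s * s)) * B0 + 2 * s * 0"
      unfolding A0_def B0_def by (rule quad_pow_formula)+
    have n: "\<not> int p dvd - (d * (s * s))" using not_dvd_mult[OF not_dvd_d not_dvd_mult[OF s s]] by simp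
    have "int p dvd - (d * (s * s)) * (A0 + 1)" "int p dvd - (d * (s * s)) * B0"
    proof -
      have "- (d * (s * s)) * (A0 + 1) = (0 * 0 - d * (s * s)) * A0 - (0 * 0 + d * (s * s))"
        "- (d * (s * s)) * B0 = (0 * 0 - d * (s * s)) * B0 + 2 * s * 0" by (simp_all add: algebra_simps)
      then show "int p dvd - (d * (s * s)) * (A0 + 1)" "int p dvd - (d * (s * s)) * B0" using 0 by (simp_all only:)
    qed
    then have A0: "int p dvd A0 + 1" and B0: "int p dvd B0" using prime_dvd_cancel n by blast+
    have "s * t * D * A - 2 * s * t * t = s * ((D * A1 - (t * t + d * (s * s))) - D * (A0 + 1))
        + s * (t * t + d * (s * s) + D - 2 * t * t)"
    proof -
      have "s * t * D * A = s * D * (t * A)" by (simp add: algebra_simps)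
      then show ?thesis unfolding tA by (simp add: algebra_simps)
    qed
    also have "t * t + d * (s * s) + D - 2 * t * t = 0" by (simp add: D_def)
    finally have "s * t * D * A - 2 * s * t * t = s * ((D * A1 - (t * t + d * (s * s))) - D * (A0 + 1))" by simp
    moreover have "s * t * D * B + 2 * s * s * t = s * ((D * B1 + 2 * s * t) - D * B0)"
    proof -
      have "s * t * D * B = s * D * (t * B)" by (simp add: algebra_simps)
      then show ?thesis unfolding tB by (simp add: algebra_simps)
    qed
    ultimately show ?thesis using 1 A0 B0 by (auto intro!: dvd_mult dvd_diff)
  qed
  then show "int p dvd s * t * D * A - 2 * s * t * t" and "int p dvd s * t * D * B + 2 * s * s * t" by blast+
qed

lemma rep_mod: "\<lbrakk>rep i f \<alpha> \<beta>; int p dvd \<alpha> - \<alpha>'; int p dvd \<beta> - \<beta>'\<rbrakk> \<Longrightarrow> rep i f \<alpha>' \<beta>'"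
proof -
  assume r: "rep i f \<alpha> \<beta>" and dvd: "int p dvd \<alpha> - \<alpha>'" "int p dvd \<beta> - \<beta>'"
  have "f - (of_int \<alpha>' * V ^ Suc i + of_int \<beta>' * (U * V ^ i)) =
     (f - (of_int \<alpha> * V ^ Suc i + of_int \<beta> * (U * V ^ i))) + (of_int (\<alpha> - \<alpha>') * V ^ Suc i + of_int (\<beta> - \<beta>') * (U * V ^ i))"
    by (simp add: algebra_simps)
  also have "\<dots> \<in> K (Suc (Suc i))"
    by (intro K_add r[unfolded rep_def] int_dvd_K dvd V_pow UV_pow)
  finally show ?thesis by (simp add: rep_def)
qed

lemma rep_linear: "Z - (of_int s * U + of_int t * V) \<in> K 2 \<Longrightarrow> rep 0 Z t s"
  by (simp add: rep_def numeral_2_eq_2 add.commute)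

lemma rep_pow:
  assumes Z: "Z - (of_int s * U + of_int t * V) \<in> K 2"
  shows "rep n (Z ^ Suc n) (fst (quad_pow d t s (Suc n))) (snd (quad_pow d t s (Suc n)))"
proof (induction n)
  case 0
  then show ?case using rep_linear[OF Z] by simp
next
  case (Suc n)
  then show ?case using rep_lin[OF Z Suc] by (simp only: power_Suc quad_pow.simps(2)[of d t s "Suc n"] fst_conv snd_conv)
qed

lemma rep_homog:
  assumes T: "T - (of_int s * U + of_int t * V) \<in> K 2" and Z: "Z - of_int s * U \<in> K 2"
  shows "rep n (homog T Z (Suc n)) (fst (quad_homog d t s (Suc n))) (snd (quad_homog d t s (Suc n)))"
proof (induction n)
  case 0
  have "rep 0 Z 0 s" using rep_linear[of Z s 0] Z by simp
  from rep_add[OF rep_linear[OF T] this] show ?case by simp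
next
  case (Suc n)
  have Z': "Z - (of_int s * U + of_int 0 * V) \<in> K 2" using Z by simp
  show ?case
    using rep_add[OF rep_lin[OF T Suc] rep_pow[OF Z', of "Suc n"]]
    by (simp only: homog.simps(2)[of T Z "Suc n"] quad_homog.simps(2)[of d t s "Suc n"] fst_conv snd_conv)
qed

lemma K1_of_linear: "Z - (of_int s * U + of_int t * V) \<in> K 2 \<Longrightarrow> Z \<in> K (Suc 0)"
  by (rule rep_K[OF rep_linear])

lemma power_in_K_top:
  assumes g: "dir g s t" and nz: "\<not> (p dvd s \<and> p dvd t)" and w: "g [^] p = \<Phi> w"
  shows "w \<in> K (C - 3)" and "top2 \<Longrightarrow> w \<in> K (C - 2)"
proof -
  obtain Z where Z: "acts g (1 + Z)" "Z - (of_nat s * U + of_nat t * V) \<in> K 2" using dir_acts[OF g] by blast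
  have "Z - (of_int (int s) * U + of_int (int t) * V) \<in> K 2" using Z by simp
  moreover have "\<not> (int p dvd int s \<and> int p dvd int t)" using nz by simp
  ultimately show "w \<in> K (C - 3)" "top2 \<Longrightarrow> w \<in> K (C - 2)"
    using linear_kernel power_kernel[OF Z(1) w] by blast+
qed

lemma K_top_I: "f \<in> K (C - 1) \<Longrightarrow> f \<in> I"
  by (rule K_C) auto

lemma K_top_mult: "\<lbrakk>f \<in> K (C - 2); g \<in> K (Suc 0)\<rbrakk> \<Longrightarrow> g * f \<in> I"
  using K_mult_add[of g "Suc 0" f "C - 2"] C_ge by (intro K_top_I) (simp add: Suc_diff_Suc numeral_2_eq_2)

lemma p_cancel_nat: "\<lbrakk>\<not> p dvd n; of_nat n * f \<in> I; of_nat p * f \<in> I\<rbrakk> \<Longrightarrow> f \<in> I"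
  using cancel_I[of "int n" f] by simp

text \<open>\<open>w\<close> lies in the last term iff \<open>U\<close> and \<open>V\<close> kill
  it, and \<open>power_commutators\<close> expresses both products by Z^(p-1) + p.\<close>

lemma power_top_iff:
  assumes g: "dir g s t" "acts g (1 + Z)" and Z: "Z - (of_nat s * U + of_nat t * V) \<in> K 2"
    and nz: "\<not> (p dvd s \<and> p dvd t)" and w: "g [^] p = \<Phi> w"
  shows "w \<in> K (C - 2) \<longleftrightarrow> Z ^ (p - 1) + of_nat p \<in> I"
proof
  note pc = power_commutators[OF g Z w]
  have Z1: "Z \<in> K (Suc 0)" using K1_of_linear[of Z "int s" "int t"] Z by simp
  let ?N = "Z ^ (p - 1) + of_nat p"
  have "Z ^ (p - 1) \<in> K (Suc 0)"
    by (rule K_antimono[OF _ K_power[OF Z1]]) (use p5 in simp)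
  then have pN: "of_nat p * ?N \<in> I" by (intro p_mult_K1 K_add p_in_K)
  assume "w \<in> K (C - 2)"
  then have "U * w \<in> I" "V * w \<in> I" by (auto intro: K_top_mult)
  then have "of_nat s * ?N \<in> I" "of_nat t * ?N \<in> I"
    using I_diff[OF pc(1) \<open>V * w \<in> I\<close>] I_diff[OF \<open>U * w \<in> I\<close> pc(2)] by simp_all
  then show "?N \<in> I" using nz pN p_cancel_nat by blast
next
  note pc = power_commutators[OF g Z w]
  let ?N = "Z ^ (p - 1) + of_nat p"
  assume N: "?N \<in> I"
  have "U * w \<in> I" using I_add[OF pc(2) I_mult[OF N, of "of_nat t"]] by simp
  moreover have "V * w \<in> I" using I_diff[OF pc(1) I_mult[OF N, of "of_nat s"]] by simp
  ultimately show "w \<in> K (C - 2)" by (rule joint_kernel)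
qed

lemma power_top_iff_class_p:
  assumes C: "C = p" and g: "dir g s t" and nz: "\<not> (p dvd s \<and> p dvd t)" and w: "g [^] p = \<Phi> w"
  shows "w \<in> K (C - 2) \<longleftrightarrow> of_nat p \<in> I"
proof -
  obtain Z where Z: "acts g (1 + Z)" "Z - (of_nat s * U + of_nat t * V) \<in> K 2" using dir_acts[OF g] by blast
  have "Z \<in> K (Suc 0)" using K1_of_linear[of Z "int s" "int t"] Z by simp
  then have "Z ^ (p - 1) \<in> I" using C by (intro K_top_I) (simp add: K_power)
  then have "Z ^ (p - 1) + of_nat p \<in> I \<longleftrightarrow> of_nat p \<in> I"
    using I_add I_diff by (metis add_diff_cancel_left')
  then show ?thesis using power_top_iff[OF g Z nz w] by blast
qed

text \<open>In class p + 1 both x^p and y^p would lie in the last term, so U^(p-1) = -p = V^(p-1).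
  But U^(p-1) = d^((p-1)/2) V^(p-1) = -V^(p-1) in that layer, and p would divide 2.\<close>

lemma top2_imp: assumes top2 shows "C = p" and "of_nat p \<in> I"
proof -
  obtain wx where wx: "x [^] p = \<Phi> wx" using pow_p_phi[OF x_closed] by blast
  obtain wy where wy: "y [^] p = \<Phi> wy" using pow_p_phi[OF y_closed] by blast
  have nz: "\<not> (p dvd Suc 0 \<and> p dvd 0)" "\<not> (p dvd 0 \<and> p dvd Suc 0)" using p_gt_1 by auto
  have kx: "wx \<in> K (C - 2)" and ky: "wy \<in> K (C - 2)"
    by (rule power_in_K_top(2)[OF dir_x nz(1) wx assms] power_in_K_top(2)[OF dir_y nz(2) wy assms])+
  show C: "C = p"
  proof (rule ccontr)
    assume "C \<noteq> p"
    then have C: "C = Suc p" using C_cases by blast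
    have "U ^ (p - 1) + of_nat p \<in> I"
      using power_top_iff[OF dir_x acts_x1 _ nz(1) wx] kx by simp
    moreover have "V ^ (p - 1) + of_nat p \<in> I"
      using power_top_iff[OF dir_y acts_y1 _ nz(2) wy] ky by simp
    ultimately have "U ^ (p - 1) - V ^ (p - 1) \<in> I" using I_diff by fastforce
    have Suc: "Suc (p - 2) = p - 1" using p5 by simp
    define A B where "A = fst (quad_pow d 0 1 (p - 1))" and "B = snd (quad_pow d 0 1 (p - 1))"
    have "rep (p - 2) (U ^ (p - 1)) A B" using rep_pow[of U 1 0 "p - 2"] unfolding Suc A_def B_def by simp
    from rep_add[OF this rep_basis[of "p - 2" "- 1" 0]]
    have "rep (p - 2) (U ^ (p - 1) - V ^ (p - 1)) (A - 1) B" unfolding Suc by simp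
    then have "rep (C - 3) (U ^ (p - 1) - V ^ (p - 1)) (A - 1) B" using C by simp
    then have A1: "int p dvd A - 1"
      using assms \<open>U ^ (p - 1) - V ^ (p - 1) \<in> I\<close> unfolding top2_def by blast
    have "int p dvd (0 * 0 - d * (1 * 1)) * A - (0 * 0 + d * (1 * 1))"
      unfolding A_def by (rule quad_pow_formula)
    moreover have "(0 * 0 - d * (1 * 1)) * A - (0 * 0 + d * (1 * 1)) = - (d * (A + 1))" by (simp add: algebra_simps)
    ultimately have "int p dvd d * (A + 1)" by (simp only: dvd_minus_iff)
    then have "int p dvd A + 1" using prime_dvd_cancel not_dvd_d by blast
    then have "int p dvd (A + 1) - (A - 1)" using A1 by (rule dvd_diff)
    then show False using not_dvd_2 by simp
  qed
  show "of_nat p \<in> I" using power_top_iff_class_p[OF C dir_x nz(1) wx] kx by simp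
qed

section \<open>The last term of the lower central series and the power map\<close>

lemma rep_top: "rep (C - 3) f \<alpha> \<beta> \<longleftrightarrow> f - (of_int \<alpha> * V ^ (C - 2) + of_int \<beta> * (U * V ^ (C - 3))) \<in> I"
proof -
  have "Suc (Suc (C - 3)) = C - 1" "Suc (C - 3) = C - 2" using C_ge by auto
  then show ?thesis unfolding rep_def using K_top_I I_subset_K by metis
qed

lemma top_dvd_I: "\<lbrakk>rep (C - 3) f \<alpha> \<beta>; int p dvd \<alpha>; int p dvd \<beta>\<rbrakk> \<Longrightarrow> f \<in> I"
  using rep_dvd C3 K_top_I by metis

lemma K_top_K1: "f \<in> K (C - 2) \<Longrightarrow> f \<in> K (Suc 0)"
  by (erule K_antimono[rotated]) (use C_ge in auto)

lemma rep_top_exists: "f \<in> K (C - 2) \<Longrightarrow> \<exists>\<alpha> \<beta>. rep (C - 3) f \<alpha> \<beta>"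
  using rep_exists C3 by metis

text \<open>The last layer is the field modulo a line: \<open>z\<close> spans it, and (e1, e2) is a
  functional whose kernel is that line.\<close>

lemma top1_generator:
  assumes "\<not> top2"
  obtains z e1 e2 where "z \<in> K (C - 2)" "\<not> (int p dvd e1 \<and> int p dvd e2)"
    "\<And>n. of_int n * z \<in> I \<longleftrightarrow> int p dvd n"
    "\<And>f \<alpha> \<beta>. rep (C - 3) f \<alpha> \<beta> \<Longrightarrow> f - of_int (\<alpha> * e1 + \<beta> * e2) * z \<in> I"
proof -
  obtain f \<alpha> \<beta> where f: "f \<in> I" "rep (C - 3) f \<alpha> \<beta>" "\<not> (int p dvd \<alpha> \<and> int p dvd \<beta>)"
    using assms unfolding top2_def by blast
  let ?v = "V ^ (C - 2)" and ?u = "U * V ^ (C - 3)"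
  have v: "?v \<in> K (C - 2)" and u: "?u \<in> K (C - 2)" using V_pow UV_pow[of "C - 3"] C3 by auto
  have rel: "of_int \<alpha> * ?v + of_int \<beta> * ?u \<in> I"
    using I_diff[OF f(1) f(2)[unfolded rep_top]] by simp
  have "\<exists>z e1 e2. z \<in> K (C - 2) \<and> \<not> (int p dvd e1 \<and> int p dvd e2) \<and> ?v - of_int e1 * z \<in> I \<and> ?u - of_int e2 * z \<in> I"
  proof (cases "int p dvd \<alpha>")
    case False
    obtain l where l: "int p dvd \<alpha> * int l - (- \<beta>)" using exists_mod_solution[OF prime_p False] .
    have "of_int \<alpha> * (?v - of_int (int l) * ?u) = (of_int \<alpha> * ?v + of_int \<beta> * ?u) - of_int (\<alpha> * int l - (- \<beta>)) * ?u"
      by (simp add: algebra_simps)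
    also have "\<dots> \<in> I" by (intro I_diff rel p_dvd_I[OF l] K_top_K1 u)
    finally have "?v - of_int (int l) * ?u \<in> I"
      by (rule cancel_I1[OF False]) (intro K_diff K_mult K_top_K1 u v)
    then show ?thesis using u I_zero not_dvd_1 by (intro exI[of _ ?u] exI[of _ "int l"] exI[of _ 1]) auto
  next
    case True
    then have \<beta>: "\<not> int p dvd \<beta>" using f by blast
    have "of_int \<beta> * ?u = (of_int \<alpha> * ?v + of_int \<beta> * ?u) - of_int \<alpha> * ?v" by simp
    also have "\<dots> \<in> I" by (intro I_diff rel p_dvd_I[OF True] K_top_K1 v)
    finally have "?u \<in> I" by (rule cancel_I1[OF \<beta>]) (intro K_top_K1 u)
    then show ?thesis using v I_zero not_dvd_1 by (intro exI[of _ ?v] exI[of _ 1] exI[of _ 0]) auto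
  qed
  then obtain z e1 e2 where z: "z \<in> K (C - 2)" and e: "\<not> (int p dvd e1 \<and> int p dvd e2)"
    and ve: "?v - of_int e1 * z \<in> I" and ue: "?u - of_int e2 * z \<in> I" by blast
  have rep: "f - of_int (\<alpha> * e1 + \<beta> * e2) * z \<in> I" if "rep (C - 3) f \<alpha> \<beta>" for f \<alpha> \<beta>
  proof -
    have "f - of_int (\<alpha> * e1 + \<beta> * e2) * z = (f - (of_int \<alpha> * ?v + of_int \<beta> * ?u))
        + of_int \<alpha> * (?v - of_int e1 * z) + of_int \<beta> * (?u - of_int e2 * z)"
      by (simp add: algebra_simps)
    also have "\<dots> \<in> I" by (intro I_add I_mult ve ue that[unfolded rep_top])
    finally show ?thesis .
  qed
  have zI: "z \<notin> I"
  proof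
    assume zI: "z \<in> I"
    have "f \<in> I" if f: "f \<in> K (C - 2)" for f
    proof -
      obtain \<alpha> \<beta> where "rep (C - 3) f \<alpha> \<beta>" using rep_top_exists[OF f] by blast
      from I_add[OF rep[OF this] I_mult[OF zI, of "of_int (\<alpha> * e1 + \<beta> * e2)"]] show ?thesis by simp
    qed
    moreover have "Suc (C - 2) < C" using C_ge by linarith
    ultimately show False using K_nontrivial by blast
  qed
  have "of_int n * z \<in> I \<longleftrightarrow> int p dvd n" for n
    using zI cancel_I1[OF _ _ K_top_K1[OF z]] p_dvd_I[OF _ K_top_K1[OF z]] by blast
  then show ?thesis using that z e rep by blast
qed

lemma card_top: "card (lower_central G C) = (if top2 then p\<^sup>2 else p)"
proof -
  let ?L = "lower_central G C"
  have L: "?L = \<Phi> ` K (C - 2)" using phi_image_K[of "C - 2"] C_ge by (simp add: Suc_diff_Suc numeral_2_eq_2)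
  define h where "h = (\<lambda>(i::nat, j::nat). \<Phi> (of_nat i * V ^ (C - 2) + of_nat j * (U * V ^ (C - 3))))"
  let ?D = "{..<p} \<times> {..<p}"
  have bK: "of_nat i * V ^ (C - 2) + of_nat j * (U * V ^ (C - 3)) \<in> K (C - 2)" for i j :: nat
    using basis_K[of "int i" "C - 3" "int j"] C3 by simp
  have eq: "h (i, j) = h (i', j') \<longleftrightarrow>
      of_int (int i - int i') * V ^ (C - 2) + of_int (int j - int j') * (U * V ^ (C - 3)) \<in> I" for i j i' j'
    unfolding h_def prod.case phi_eq_iff I_def mem_Collect_eq by (simp add: algebra_simps)
  have img: "h ` ?D = ?L"
  proof
    show "h ` ?D \<subseteq> ?L" unfolding L h_def using bK by auto
    show "?L \<subseteq> h ` ?D"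
    proof
      fix g assume "g \<in> ?L"
      then obtain f where f: "f \<in> K (C - 2)" "g = \<Phi> f" unfolding L by auto
      obtain \<alpha> \<beta> where ab: "rep (C - 3) f \<alpha> \<beta>" using rep_top_exists[OF f(1)] by blast
      define i j where "i = nat (\<alpha> mod int p)" and "j = nat (\<beta> mod int p)"
      have ij: "int i = \<alpha> mod int p" "int j = \<beta> mod int p" "i < p" "j < p"
        using p_gt_1 by (auto simp: i_def j_def nat_less_iff)
      then have "int p dvd \<alpha> - int i" "int p dvd \<beta> - int j" by (simp_all add: mod_eq_dvd_iff[symmetric])
      then have "rep (C - 3) f (int i) (int j)" using rep_mod[OF ab] by blast
      then have "\<Phi> f = h (i, j)" by (simp add: rep_top h_def phi_eq_iff I_def)
      then show "g \<in> h ` ?D" using f ij by auto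
    qed
  qed
  show ?thesis
  proof (cases top2)
    case True
    have "inj_on h ?D"
    proof (rule inj_onI)
      fix v v' assume "v \<in> ?D" "v' \<in> ?D" and hv: "h v = h v'"
      then obtain i j i' j' where v: "v = (i, j)" "v' = (i', j')" and
        ij: "i \<in> {..<p}" "j \<in> {..<p}" "i' \<in> {..<p}" "j' \<in> {..<p}" by auto
      have *: "i \<in> {..<p}" "j \<in> {..<p}" "i' \<in> {..<p}" "j' \<in> {..<p}" "h (i, j) = h (i', j')"
        using ij hv v by auto
      let ?f = "of_int (int i - int i') * V ^ (C - 2) + of_int (int j - int j') * (U * V ^ (C - 3))"
      have "?f \<in> I" using * eq by blast
      moreover have "rep (C - 3) ?f (int i - int i') (int j - int j')" using rep_basis[of "C - 3"] C3 by metis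
      ultimately have "int p dvd int i - int i'" "int p dvd int j - int j'" using True unfolding top2_def by blast+
      then have "int i mod int p = int i' mod int p" "int j mod int p = int j' mod int p" by (simp_all add: mod_eq_dvd_iff)
      then show "v = v'" using * v by simp
    qed
    then have "card ?L = card ?D" using img card_image by metis
    then show ?thesis using True by (simp add: card_cartesian_product power2_eq_square)
  next
    case False
    obtain z e1 e2 where z: "z \<in> K (C - 2)" "\<And>n. of_int n * z \<in> I \<longleftrightarrow> int p dvd n"
      "\<And>f \<alpha> \<beta>. rep (C - 3) f \<alpha> \<beta> \<Longrightarrow> f - of_int (\<alpha> * e1 + \<beta> * e2) * z \<in> I"
      using top1_generator[OF False] by metis
    define k where "k = (\<lambda>n::nat. \<Phi> (of_nat n * z))"
    have keq: "k m = k n \<longleftrightarrow> int p dvd int m - int n" for m n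
      using z(2)[of "int m - int n"] by (simp add: k_def phi_eq_iff I_def algebra_simps)
    have "inj_on k {..<p}"
    proof (rule inj_onI)
      fix m n assume *: "m \<in> {..<p}" "n \<in> {..<p}" "k m = k n"
      then have "int m mod int p = int n mod int p" using keq[of m n] unfolding mod_eq_dvd_iff by blast
      then show "m = n" using *(1,2) by simp
    qed
    moreover have "k ` {..<p} = ?L"
    proof
      show "k ` {..<p} \<subseteq> ?L" unfolding L k_def using K_mult[OF z(1)] by auto
      show "?L \<subseteq> k ` {..<p}"
      proof
        fix g assume "g \<in> ?L"
        then obtain f where f: "f \<in> K (C - 2)" "g = \<Phi> f" unfolding L by auto
        obtain \<alpha> \<beta> where ab: "rep (C - 3) f \<alpha> \<beta>" using rep_top_exists[OF f(1)] by blast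
        define n where "n = \<alpha> * e1 + \<beta> * e2"
        define m where "m = nat (n mod int p)"
        have m: "int m = n mod int p" "m < p" using p_gt_1 by (auto simp: m_def nat_less_iff)
        then have "int p dvd n - int m" by (simp add: mod_eq_dvd_iff[symmetric])
        then have "of_int (n - int m) * z \<in> I" using z(2) by blast
        from I_add[OF z(3)[OF ab, folded n_def] this] have "f - of_nat m * z \<in> I" by (simp add: algebra_simps)
        then have "g = k m" using f by (simp add: k_def phi_eq_iff I_def)
        then show "g \<in> k ` {..<p}" using m by auto
      qed
    qed
    ultimately have "card ?L = card {..<p}" using card_image by metis
    then show ?thesis using False by simp
  qed
qed

text \<open>An exceptional power means Z^(p-1) + p = 0 in the last layer. Applying the functional
  and clearing the norm leaves a quadratic form.\<close>

lemma bad_directions_quadratic: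
  assumes C: "C = Suc p"
  obtains q0 q1 q2 where "\<not> (int p dvd q0 \<and> int p dvd q1 \<and> int p dvd q2)"
    "\<And>g s t w. \<lbrakk>dir g s t; \<not> (p dvd s \<and> p dvd t); g [^] p = \<Phi> w; w \<in> K (C - 2)\<rbrakk>
       \<Longrightarrow> int p dvd q0 * (int s * int s) + q1 * (int s * int t) + q2 * (int t * int t)"
proof -
  have "\<not> top2" using top2_imp(1) C by auto
  then obtain z e1 e2 where e: "\<not> (int p dvd e1 \<and> int p dvd e2)"
    and z: "\<And>n. of_int n * z \<in> I \<longleftrightarrow> int p dvd n"
    and rz: "\<And>f \<alpha> \<beta>. rep (C - 3) f \<alpha> \<beta> \<Longrightarrow> f - of_int (\<alpha> * e1 + \<beta> * e2) * z \<in> I"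
    using top1_generator by metis
  have "of_nat p \<in> K (C - 2)"
    using p_mult_K1[OF U_in_K] p_mult_K1[OF V_in_K] by (intro joint_kernel) (auto simp: mult.commute)
  then obtain \<pi>1 \<pi>2 where "rep (C - 3) (of_nat p) \<pi>1 \<pi>2" using rep_top_exists by blast
  from rz[OF this] obtain \<pi> where \<pi>: "of_nat p - of_int \<pi> * z \<in> I" by blast
  \<comment> \<open>The coefficients of e1 (t^2 + d s^2) - 2 e2 s t + \<pi> (t^2 - d s^2), where
    \<pi> is the value of p in the last layer.\<close>
  let ?q0 = "d * (e1 - \<pi>)" and ?q1 = "- 2 * e2" and ?q2 = "e1 + \<pi>"
  have "\<not> (int p dvd ?q0 \<and> int p dvd ?q1 \<and> int p dvd ?q2)"
  proof
    assume *: "int p dvd ?q0 \<and> int p dvd ?q1 \<and> int p dvd ?q2"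
    then have "int p dvd e1 - \<pi>" using prime_dvd_cancel not_dvd_d by blast
    then have "int p dvd (e1 - \<pi>) + (e1 + \<pi>)" using * dvd_add by blast
    moreover have "(e1 - \<pi>) + (e1 + \<pi>) = 2 * e1" by simp
    ultimately have "int p dvd 2 * e1" by (simp only:)
    then have 1: "int p dvd e1" using prime_dvd_cancel not_dvd_2 by blast
    have "int p dvd 2 * e2" using * by simp
    then have "int p dvd e2" using prime_dvd_cancel not_dvd_2 by blast
    then show False using 1 e by blast
  qed
  moreover have "int p dvd ?q0 * (int s * int s) + ?q1 * (int s * int t) + ?q2 * (int t * int t)"
    if g: "dir g s t" and nz: "\<not> (p dvd s \<and> p dvd t)" and w: "g [^] p = \<Phi> w" "w \<in> K (C - 2)" for g s t w
  proof -
    obtain Z where Z: "acts g (1 + Z)" "Z - (of_nat s * U + of_nat t * V) \<in> K 2" using dir_acts[OF g] by blast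
    have N: "Z ^ (p - 1) + of_nat p \<in> I" using power_top_iff[OF g Z nz w(1)] w(2) by blast
    define A B where "A = fst (quad_pow d t s (p - 1))" and "B = snd (quad_pow d t s (p - 1))"
    have Suc: "Suc (p - 2) = p - 1" using p5 by simp
    have "rep (p - 2) (Z ^ (p - 1)) A B"
      using rep_pow[of Z "int s" "int t" "p - 2"] Z(2) unfolding Suc A_def B_def by simp
    then have "rep (C - 3) (Z ^ (p - 1)) A B" using C by simp
    note r = rz[OF this]
    have "of_int (A * e1 + B * e2 + \<pi>) * z =
       (Z ^ (p - 1) + of_nat p) - (Z ^ (p - 1) - of_int (A * e1 + B * e2) * z) - (of_nat p - of_int \<pi> * z)"
      by (simp add: algebra_simps)
    also have "\<dots> \<in> I" by (intro I_diff N r \<pi>)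
    finally have dvd: "int p dvd A * e1 + B * e2 + \<pi>" using z by blast
    let ?D = "int t * int t - d * (int s * int s)"
    have 1: "int p dvd ?D * A - (int t * int t + d * (int s * int s))" and 2: "int p dvd ?D * B + 2 * int s * int t"
      unfolding A_def B_def by (rule quad_pow_formula)+
    have "?q0 * (int s * int s) + ?q1 * (int s * int t) + ?q2 * (int t * int t) =
       ?D * (A * e1 + B * e2 + \<pi>) - (?D * A - (int t * int t + d * (int s * int s))) * e1 - (?D * B + 2 * int s * int t) * e2"
      by (simp add: algebra_simps)
    then show ?thesis using dvd 1 2 by (auto intro!: dvd_diff)
  qed
  ultimately show ?thesis by (rule that)
qed

text \<open>The sum from \<open>phi_mult_pow\<close> is Z^(p-1) plus a multiple of p, and both
  annihilate.\<close>

lemma power_mod_derived: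
  assumes C: "C = p" and pI: "of_nat p \<in> I" and g: "g \<in> carrier G"
  shows "(\<Phi> f \<otimes> g) [^] p = g [^] p"
proof -
  obtain Z where Z: "Z \<in> aug" "acts g (1 + Z)" using exists_acts[OF g] by blast
  obtain q where q: "(\<Sum>k<p. (1 + Z) ^ k) = Z ^ (p - 1) + of_nat p * (1 + Z * q)"
    using geometric_sum_prime[OF prime_p] by blast
  have "Z ^ (p - 1) \<in> I" using C K_power[OF aug_K[OF Z(1)]] by (intro K_top_I) simp
  then have "(\<Sum>k<p. (1 + Z) ^ k) \<in> I" unfolding q using I_add[OF _ I_mult[OF pI, of "1 + Z * q"]] by (simp add: mult.commute)
  then have "f * (\<Sum>k<p. (1 + Z) ^ k) \<in> I" by (rule I_mult)
  then have "\<Phi> ((\<Sum>k<p. (1 + Z) ^ k) * f) = \<one>" by (simp add: I_def mult.commute)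
  then show ?thesis using phi_mult_pow[OF Z(2), of f p] g by simp
qed

text \<open>The defect formula for x^s times y^t in the last layer: the commutator contributes its
  constant term s t, the defect its leading part h_(p-2).\<close>

lemma power_xy:
  assumes C: "C = p" and pI: "of_nat p \<in> I" and wx: "x [^] p = \<Phi> wx" and wy: "y [^] p = \<Phi> wy"
  shows "\<exists>H. rep (C - 3) H (fst (quad_homog d (int t) (int s) (p - 2))) (snd (quad_homog d (int t) (int s) (p - 2)))
     \<and> (x [^] s \<otimes> y [^] t) [^] p = \<Phi> (of_nat s * wx + of_nat t * wy - of_nat (s * t) * H)"
proof -
  define Z W where "Z = (1 + U) ^ s - 1" and "W = (1 + V) ^ t - 1"
  define T where "T = (1 + Z) * (1 + W) - 1"
  have aZ: "acts (x [^] s) (1 + Z)" and aW: "acts (y [^] t) (1 + W)"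
    using acts_pow[OF acts_x1] acts_pow[OF acts_y1] by (simp_all add: Z_def W_def)
  obtain u where u: "(1 + U) ^ s = 1 + of_nat s * U + U * U * u" using one_plus_power_expand by blast
  obtain v where v: "(1 + V) ^ t = 1 + of_nat t * V + V * V * v" using one_plus_power_expand by blast
  have Z2: "Z - of_nat s * U \<in> K 2" using K_mult_right[OF UU_K, of u] by (simp add: Z_def u)
  have W2: "W - of_nat t * V \<in> K 2" using K_mult_right[OF VV_K, of v] by (simp add: W_def v)
  have Z1: "Z \<in> K (Suc 0)" using K1_of_linear[of Z "int s" 0] Z2 by simp
  have W1: "W \<in> K (Suc 0)" using K1_of_linear[of W 0 "int t"] W2 by simp
  have "T - (of_nat s * U + of_nat t * V) = (Z - of_nat s * U) + (W - of_nat t * V) + Z * W"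
    by (simp add: T_def algebra_simps)
  also have "\<dots> \<in> K 2" by (intro K_add Z2 W2 K11 Z1 W1)
  finally have T2: "T - (of_nat s * U + of_nat t * V) \<in> K 2" .
  define e where "e = (\<Sum>k<t. (1 + V) ^ k) * (\<Sum>k<s. (1 + U) ^ k)"
  have "cmt (x [^] s) y = \<Phi> (\<Sum>k<s. (1 + U) ^ k)"
    using cmt_pow[OF acts_x1 y_closed phi_one[symmetric], of s] by simp
  then have "cmt y (x [^] s) = \<Phi> (- (\<Sum>k<s. (1 + U) ^ k))" using inv_cmt[of "x [^] s" y] by (simp add: phi_minus)
  from cmt_pow[OF acts_y1 _ this, of t] have "cmt (y [^] t) (x [^] s) = \<Phi> (- e)" by (simp add: e_def)
  then have ce: "cmt (x [^] s) (y [^] t) = \<Phi> e" using inv_cmt[of "y [^] t" "x [^] s"] by (simp add: phi_minus)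
  have e1: "e - of_nat (s * t) \<in> K (Suc 0)"
  proof -
    have "e - of_nat (s * t) = ((\<Sum>k<t. (1 + V) ^ k) - of_nat t) * (\<Sum>k<s. (1 + U) ^ k)
        + of_nat t * ((\<Sum>k<s. (1 + U) ^ k) - of_nat s)"
      by (simp add: e_def algebra_simps)
    also have "\<dots> \<in> K (Suc 0)"
      by (intro K_add K_mult_right[OF geometric_sum_K[OF V_in_K]] K_mult[OF geometric_sum_K[OF U_in_K]])
    finally show ?thesis .
  qed
  define H where "H = homog T Z (p - 2)"
  have Suc: "Suc (p - 3) = p - 2" using p5 by simp
  have rH: "rep (p - 3) H (fst (quad_homog d (int t) (int s) (p - 2))) (snd (quad_homog d (int t) (int s) (p - 2)))"
    using rep_homog[of T "int s" "int t" Z "p - 3"] T2 Z2 unfolding Suc H_def by simp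
  obtain r where r: "power_defect T Z p = H + of_nat p * r" using power_defect_prime[OF prime_p] unfolding H_def by blast
  have HK: "H \<in> K (p - 2)" using rep_K[OF rH] Suc by simp
  have "- ((1 + Z) * e * power_defect T Z p) - - (of_nat (s * t) * H) =
     - (((e - of_nat (s * t)) + Z * e) * H) - ((1 + Z) * e * r) * of_nat p"
    by (simp add: r algebra_simps)
  also have "\<dots> \<in> I"
  proof (intro I_diff I_minus I_mult[OF pI])
    have "(e - of_nat (s * t)) + Z * e \<in> K (Suc 0)" by (intro K_add e1 K_mult_right[OF Z1])
    then show "((e - of_nat (s * t)) + Z * e) * H \<in> I" using K_top_mult HK C by simp
  qed
  finally have "\<Phi> (- ((1 + Z) * e * power_defect T Z p)) = \<Phi> (- (of_nat (s * t) * H))"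
    by (simp add: phi_eq_iff I_def)
  moreover have "(x [^] s \<otimes> y [^] t) [^] p =
      \<Phi> (- ((1 + Z) * e * power_defect T Z p)) \<otimes> ((x [^] s) [^] p \<otimes> (y [^] t) [^] p)"
    by (rule mult_pow_defect[OF aZ aW _ ce]) (simp add: T_def)
  moreover have "(x [^] s) [^] p = \<Phi> (of_nat s * wx)" "(y [^] t) [^] p = \<Phi> (of_nat t * wy)"
    unfolding phi_of_nat wx[symmetric] wy[symmetric] by (simp_all add: nat_pow_pow mult.commute)
  ultimately have "(x [^] s \<otimes> y [^] t) [^] p = \<Phi> (- (of_nat (s * t) * H) + (of_nat s * wx + of_nat t * wy))"
    by (simp only: phi_add)
  then show ?thesis using rH C by (intro exI[of _ H]) (simp add: algebra_simps)
qed

text \<open>Multiplying by the norm \<open>D\<close> clears the denominator of h_(p-2), so both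
  coordinates become cubic forms.\<close>

lemma power_cubic:
  fixes s t :: nat and a1 a2 b1 b2 :: int
  defines "D \<equiv> int t * int t - d * (int s * int s)"
  assumes C: "C = p" and pI: "of_nat p \<in> I" and wx: "x [^] p = \<Phi> wx" and wy: "y [^] p = \<Phi> wy"
    and rx: "rep (C - 3) wx a1 a2" and ry: "rep (C - 3) wy b1 b2"
    and g: "dir g s t" and w: "g [^] p = \<Phi> w"
  shows "rep (C - 3) (of_int D * w) (D * (s * a1 + t * b1) - 2 * s * t * t) (D * (s * a2 + t * b2) + 2 * s * s * t)"
proof -
  obtain f where f: "g = \<Phi> f \<otimes> (x [^] s \<otimes> y [^] t)" using g by (auto simp: dir_def)
  define A B where "A = fst (quad_homog d (int t) (int s) (p - 2))" and "B = snd (quad_homog d (int t) (int s) (p - 2))"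
  obtain H where H: "rep (C - 3) H A B" "(x [^] s \<otimes> y [^] t) [^] p = \<Phi> (of_nat s * wx + of_nat t * wy - of_nat (s * t) * H)"
    using power_xy[OF C pI wx wy] unfolding A_def B_def by metis
  have "\<Phi> w = \<Phi> (of_nat s * wx + of_nat t * wy - of_nat (s * t) * H)"
    using power_mod_derived[OF C pI, of "x [^] s \<otimes> y [^] t" f] f w H by simp
  then have wI: "w - (of_nat s * wx + of_nat t * wy - of_nat (s * t) * H) \<in> I" by (simp add: phi_eq_iff I_def)
  let ?f = "of_int (D * s) * wx + of_int (D * t) * wy + of_int (- (s * t * D)) * H"
  have "rep (C - 3) ?f (D * s * a1 + D * t * b1 + - (s * t * D) * A) (D * s * a2 + D * t * b2 + - (s * t * D) * B)"
    by (intro rep_add rep_int rx ry H)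
  moreover have "of_int D * w - ?f = of_int D * (w - (of_nat s * wx + of_nat t * wy - of_nat (s * t) * H))"
    by (simp add: algebra_simps)
  then have "of_int D * w - ?f \<in> K (Suc (Suc (C - 3)))" using I_mult[OF wI] I_subset_K by simp
  ultimately have r: "rep (C - 3) (of_int D * w) (D * s * a1 + D * t * b1 + - (s * t * D) * A) (D * s * a2 + D * t * b2 + - (s * t * D) * B)"
    by (rule rep_cong)
  have q: "int p dvd int s * int t * D * A - 2 * int s * int t * int t" "int p dvd int s * int t * D * B + 2 * int s * int s * int t"
    unfolding A_def B_def D_def by (rule quad_homog_formula)+
  show ?thesis
  proof (rule rep_mod[OF r])
    have "D * s * a1 + D * t * b1 + - (s * t * D) * A - (D * (s * a1 + t * b1) - 2 * s * t * t) =
      - (int s * int t * D * A - 2 * int s * int t * int t)" by (simp add: algebra_simps)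
    then show "int p dvd D * s * a1 + D * t * b1 + - (s * t * D) * A - (D * (s * a1 + t * b1) - 2 * s * t * t)"
      using q(1) by (simp only: dvd_minus_iff)
    have "D * s * a2 + D * t * b2 + - (s * t * D) * B - (D * (s * a2 + t * b2) + 2 * s * s * t) =
      - (int s * int t * D * B + 2 * int s * int s * int t)" by (simp add: algebra_simps)
    then show "int p dvd D * s * a2 + D * t * b2 + - (s * t * D) * B - (D * (s * a2 + t * b2) + 2 * s * s * t)"
      using q(2) by (simp only: dvd_minus_iff)
  qed
qed

end

section \<open>Directions\<close>

text \<open>Lagrange's bound over the integers: \<open>[:int p:] dvd f\<close> means that f vanishes
  modulo p. Synthetic division splits off a root up to a constant divisible by p.\<close>

lemma card_poly_roots_mod_prime:
  fixes f :: "int poly"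
  assumes p: "Factorial_Ring.prime p"
  shows "\<not> [:int p:] dvd f \<Longrightarrow> card {i \<in> {..<p}. int p dvd poly f (int i)} \<le> degree f"
proof (induction "degree f" arbitrary: f rule: less_induct)
  case less
  show ?case
  proof (cases "{i \<in> {..<p}. int p dvd poly f (int i)} = {}")
    case False
    then obtain r where r: "r < p" "int p dvd poly f (int r)" by auto
    define g where "g = synthetic_div f (int r)"
    have f: "f = [:- int r, 1:] * g + [:poly f (int r):]"
      unfolding g_def by (rule synthetic_div_correct'[symmetric])
    have c: "[:int p:] dvd [:poly f (int r):]" using r by (simp add: const_poly_dvd_const_poly_iff)
    have g: "\<not> [:int p:] dvd g"
    proof
      assume "[:int p:] dvd g"
      then have "[:int p:] dvd [:- int r, 1:] * g + [:poly f (int r):]" using c by (intro dvd_add dvd_mult)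
      then show False using less(2) f by simp
    qed
    have "degree f \<noteq> 0"
    proof
      assume "degree f = 0"
      then have "g = 0" by (simp add: g_def synthetic_div_eq_0_iff)
      then show False using g by simp
    qed
    moreover have dg: "degree g = degree f - 1" by (simp add: g_def degree_synthetic_div)
    ultimately have IH: "card {i \<in> {..<p}. int p dvd poly g (int i)} \<le> degree f - 1"
      using less(1)[OF _ g] by simp
    have "{i \<in> {..<p}. int p dvd poly f (int i)} \<subseteq> insert r {i \<in> {..<p}. int p dvd poly g (int i)}"
    proof
      fix i assume i: "i \<in> {i \<in> {..<p}. int p dvd poly f (int i)}"
      have "poly f (int i) = (int i - int r) * poly g (int i) + poly f (int r)"
        by (subst f) (simp add: algebra_simps)
      then have "int p dvd (int i - int r) * poly g (int i)" using i r dvd_add_left_iff[of "int p"] by auto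
      then have "int p dvd int i - int r \<or> int p dvd poly g (int i)"
        using p prime_dvd_mult_iff[of "int p"] by simp
      moreover have "i = r" if "int p dvd int i - int r"
      proof -
        have "int i mod int p = int r mod int p" using that by (simp add: mod_eq_dvd_iff)
        then show ?thesis using i r by simp
      qed
      ultimately show "i \<in> insert r {i \<in> {..<p}. int p dvd poly g (int i)}" using i by auto
    qed
    then have "card {i \<in> {..<p}. int p dvd poly f (int i)} \<le> card (insert r {i \<in> {..<p}. int p dvd poly g (int i)})"
      by (intro card_mono) auto
    also have "\<dots> \<le> Suc (card {i \<in> {..<p}. int p dvd poly g (int i)})" by (rule card_insert_le_m1) auto
    also have "\<dots> \<le> degree f" using IH \<open>degree f \<noteq> 0\<close> by simp
    finally show ?thesis .
  next
    case True
    then show ?thesis by (metis card.empty zero_le)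
  qed
qed

text \<open>Representatives of the points of the projective line over the field with \<open>p\<close> elements.\<close>

definition proj_line :: "nat \<Rightarrow> (nat \<times> nat) set" where
  "proj_line p = insert (0, 1) ((\<lambda>i. (1, i)) ` {..<p})"

lemma finite_proj_line [simp]: "finite (proj_line p)"
  by (simp add: proj_line_def)

lemma card_proj_line: "card (proj_line p) = Suc p"
proof -
  have "card ((\<lambda>i. (1::nat, i)) ` {..<p}) = p" by (subst card_image) (auto simp: inj_on_def)
  then show ?thesis unfolding proj_line_def by (subst card_insert_disjoint) auto
qed

definition cross :: "nat \<times> nat \<Rightarrow> nat \<times> nat \<Rightarrow> int" where
  "cross v w = int (fst v) * int (snd w) - int (fst w) * int (snd v)"

lemma cross_proj_line:
  assumes "p > 1" "v \<in> proj_line p" "w \<in> proj_line p" "v \<noteq> w"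
  shows "\<not> int p dvd cross v w"
proof -
  have eq: "j = i" if "int p dvd int i - int j" "i < p" "j < p" for i j
  proof -
    have "int i mod int p = int j mod int p" unfolding mod_eq_dvd_iff by (rule that(1))
    then show ?thesis using that(2,3) by simp
  qed
  show ?thesis using assms by (auto simp: proj_line_def cross_def intro: eq)
qed

text \<open>A binary form of degree n has at most n zeros. \<open>f\<close> is its restriction to s
  = 1, and the point at infinity is read off from the coefficient of degree n.\<close>

lemma card_form_roots:
  fixes f :: "int poly" and R :: "nat \<times> nat \<Rightarrow> bool"
  assumes p: "Factorial_Ring.prime p" and deg: "degree f \<le> n" and f: "\<not> [:int p:] dvd f"
    and aff: "\<And>i. R (1, i) \<Longrightarrow> int p dvd poly f (int i)" and inf: "R (0, 1) \<Longrightarrow> int p dvd coeff f n"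
  shows "card {v \<in> proj_line p. R v} \<le> n"
proof (cases "R (0, 1)")
  case False
  have "{v \<in> proj_line p. R v} \<subseteq> (\<lambda>i. (1, i)) ` {i \<in> {..<p}. int p dvd poly f (int i)}"
    using False aff by (auto simp: proj_line_def)
  then have "card {v \<in> proj_line p. R v} \<le> card {i \<in> {..<p}. int p dvd poly f (int i)}"
    by (rule surj_card_le[rotated]) simp
  then show ?thesis using card_poly_roots_mod_prime[OF p f] deg by linarith
next
  case True
  \<comment> \<open>A zero at infinity makes the top coefficient vanish modulo p; dropping it leaves
    room for one root fewer.\<close>
  define g where "g = f - monom (coeff f n) n"
  have c: "int p dvd coeff f n" using inf True .
  have mono: "[:int p:] dvd monom (coeff f n) n"
    using c by (auto simp: const_poly_dvd_iff coeff_monom)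
  have g: "\<not> [:int p:] dvd g"
  proof
    assume "[:int p:] dvd g"
    then have "[:int p:] dvd g + monom (coeff f n) n" using mono by (rule dvd_add)
    then show False using f by (simp add: g_def)
  qed
  then have g0: "g \<noteq> 0" by auto
  have "coeff g k = 0" if "k \<ge> n" for k
    using that deg by (cases "k = n") (auto simp: g_def coeff_eq_0)
  then have dg: "degree g < n" using g0 by (meson leading_coeff_0_iff not_le)
  have "int p dvd poly g (int i)" if "R (1, i)" for i
    using aff[OF that] c by (auto simp: g_def poly_monom intro!: dvd_diff)
  then have "{v \<in> proj_line p. R v} \<subseteq> insert (0, 1) ((\<lambda>i. (1, i)) ` {i \<in> {..<p}. int p dvd poly g (int i)})"
    by (auto simp: proj_line_def)
  then have "card {v \<in> proj_line p. R v} \<le> card (insert (0, 1) ((\<lambda>i. (1::nat, i)) ` {i \<in> {..<p}. int p dvd poly g (int i)}))"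
    by (intro card_mono) auto
  also have "\<dots> \<le> Suc (card ((\<lambda>i. (1::nat, i)) ` {i \<in> {..<p}. int p dvd poly g (int i)}))"
    by (rule card_insert_le_m1) auto
  also have "\<dots> \<le> Suc (card {i \<in> {..<p}. int p dvd poly g (int i)})" by (simp add: card_image_le)
  finally show ?thesis using card_poly_roots_mod_prime[OF p g] dg by linarith
qed

text \<open>\<open>par\<close> stands for proportionality; zero vectors are parallel to everything
  but impose no condition. One triple is placed in a union of fibres that leaves three elements
  outside. Three fibres of size two admit no such union, which \<open>ex\<close> excludes.\<close>

lemma choose_separated_triples:
  fixes L :: "'v set" and zero :: "'v \<Rightarrow> bool" and par :: "'v \<Rightarrow> 'v \<Rightarrow> bool"
  assumes fin: "finite L" and L6: "card L \<ge> 6"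
    and refl: "\<And>v. par v v" and sym: "\<And>v w. par v w \<Longrightarrow> par w v"
    and trans: "\<And>u v w. \<lbrakk>\<not> zero v; par u v; par v w\<rbrakk> \<Longrightarrow> par u w" and zero: "\<And>v w. zero v \<Longrightarrow> par v w"
    and fib3: "\<And>v. \<lbrakk>v \<in> L; \<not> zero v\<rbrakk> \<Longrightarrow> card {w \<in> L. par v w} \<le> 3"
    and ex: "card L \<ge> 7 \<or> (\<exists>v\<in>L. card {w \<in> L. par v w} \<noteq> 2)"
  shows "\<exists>T1 T2. T1 \<subseteq> L \<and> T2 \<subseteq> L \<and> card T1 = 3 \<and> card T2 = 3 \<and> T1 \<inter> T2 = {} \<and>
           (\<forall>v\<in>T1. \<forall>w\<in>T2. zero v \<or> zero w \<or> \<not> par v w)"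
proof -
  let ?fib = "\<lambda>v. {w \<in> L. par v w}"
  \<comment> \<open>The elements that \<open>v\<close> forbids in the other triple, with
    \<open>v\<close> itself added; a zero vector forbids none.\<close>
  define bl where "bl v = (if zero v then {v} else ?fib v)" for v
  have finite: "finite (?fib v)" for v using fin by simp
  have core: ?thesis if T1: "T1 \<subseteq> L" "card T1 = 3" and B: "B \<subseteq> L" "T1 \<subseteq> B" "card B + 3 \<le> card L"
      and cl: "\<And>v. v \<in> T1 \<Longrightarrow> bl v \<subseteq> B" for T1 B
  proof -
    have "card (L - B) \<ge> 3" using B fin finite_subset by (subst card_Diff_subset) auto
    then obtain T2 where T2: "T2 \<subseteq> L - B" "card T2 = 3" by (rule obtain_subset_with_card_n)
    have "zero v \<or> zero w \<or> \<not> par v w" if "v \<in> T1" "w \<in> T2" for v w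
      using that cl[of v] T2 by (auto simp: bl_def split: if_splits)
    then show ?thesis using T1 T2 B by (intro exI[of _ T1] exI[of _ T2]) auto
  qed
  show ?thesis
  proof (cases "\<exists>v\<in>L. \<not> zero v \<and> card (?fib v) = 3")
    case True
    then obtain v where v: "v \<in> L" "\<not> zero v" "card (?fib v) = 3" by blast
    have "card (L - ?fib v) \<ge> 3" using v L6 finite by (subst card_Diff_subset) auto
    then obtain T2 where T2: "T2 \<subseteq> L - ?fib v" "card T2 = 3" by (rule obtain_subset_with_card_n)
    have "zero u \<or> zero w \<or> \<not> par u w" if "u \<in> ?fib v" "w \<in> T2" for u w
      using that T2 trans[of u v w] by auto
    then show ?thesis using v T2 by (intro exI[of _ "?fib v"] exI[of _ T2]) auto
  next
    case False
    have fib2: "card (?fib v) \<le> 2" if "v \<in> L" "\<not> zero v" for v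
      using fib3[OF that] False that by force
    have self: "v \<in> ?fib v" if "v \<in> L" for v using that refl by simp
    have pair: "?fib v = {v, w}" if "v \<in> L" "\<not> zero v" "w \<in> ?fib v" "w \<noteq> v" for v w
    proof -
      have "{v, w} \<subseteq> ?fib v" using that self by auto
      moreover have "card (?fib v) \<le> card {v, w}" using fib2[OF that(1,2)] that(4) by simp
      ultimately show ?thesis using card_seteq[OF finite] by metis
    qed
    show ?thesis
    proof (cases "\<forall>v\<in>L. bl v = {v}")
      case True
      obtain T1 where T1: "T1 \<subseteq> L" "card T1 = 3" using obtain_subset_with_card_n[of 3 L] L6 by auto
      show ?thesis by (rule core[OF T1, of T1]) (use True T1 L6 in auto)
    next
      case False
      then obtain a where a: "a \<in> L" "bl a \<noteq> {a}" by blast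
      then have nza: "\<not> zero a" by (auto simp: bl_def)
      then have "?fib a \<noteq> {a}" using a by (simp add: bl_def)
      then obtain b where b: "b \<in> ?fib a" "b \<noteq> a" using self[OF a(1)] by blast
      have fa: "?fib a = {a, b}" using pair[OF a(1) nza b] .
      have bL: "b \<in> L" using b by simp
      have fb: "?fib b = {a, b}" if "\<not> zero b"
        using pair[of b a] that b sym a by auto
      then have blab: "bl a \<subseteq> {a, b}" "bl b \<subseteq> {a, b}" using fa nza by (auto simp: bl_def)
      have "card (L - {a, b}) \<ge> 4" using L6 a bL b by (subst card_Diff_subset) auto
      then obtain c0 where c0: "c0 \<in> L - {a, b}" by (metis card.empty equals0I not_numeral_le_zero)
      have fin3: ?thesis if c: "c \<in> L" "c \<notin> {a, b}" "bl c \<subseteq> {a, b, c}" for c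
      proof (rule core[of "{a, b, c}" "{a, b, c}"])
        show "bl v \<subseteq> {a, b, c}" if "v \<in> {a, b, c}" for v using that c blab by blast
      qed (use a b bL c L6 in auto)
      show ?thesis
      proof (cases "zero b")
        case True
        \<comment> \<open>The zero vector \<open>b\<close> lies in every fibre, so it already is the
          second element of the fibre of \<open>c0\<close>.\<close>
        have "bl c0 \<subseteq> {a, b, c0}"
        proof (cases "zero c0")
          case False
          have "b \<in> ?fib c0" using zero[OF True] sym bL by blast
          then have "?fib c0 = {c0, b}" using pair[of c0 b] False c0 by auto
          then show ?thesis using False by (auto simp: bl_def)
        qed (simp add: bl_def)
        then show ?thesis using fin3[of c0] c0 by blast
      next
        case nzb: False
        show ?thesis
        proof (cases "card L \<ge> 7")
          case True
          \<comment> \<open>Two fibres of size at most two leave three of seven elements.\<close>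
          show ?thesis
          proof (rule core[of "{a, b, c0}" "insert a (insert b (insert c0 (bl c0)))"])
            have "card (bl c0) \<le> 2" using fib2[of c0] c0 by (simp add: bl_def)
            moreover have "c0 \<in> bl c0" using self[of c0] c0 by (simp add: bl_def)
            moreover have "finite (bl c0)" using finite by (simp add: bl_def)
            ultimately have "card (insert a (insert b (insert c0 (bl c0)))) \<le> 4"
              by (simp add: insert_absorb card_insert_if)
            then show "card (insert a (insert b (insert c0 (bl c0)))) + 3 \<le> card L" using True by simp
            show "bl v \<subseteq> insert a (insert b (insert c0 (bl c0)))" if "v \<in> {a, b, c0}" for v using that blab by auto
          qed (use a b bL c0 in \<open>auto simp: bl_def split: if_splits\<close>)
        next
          case False
          then obtain v where v: "v \<in> L" "card (?fib v) \<noteq> 2" using ex by blast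
          have vab: "v \<notin> {a, b}" using v fa fb[OF nzb] b by auto
          have "bl v \<subseteq> {a, b, v}"
          proof (cases "zero v")
            case nzv: False
            have "?fib v = {v}"
            proof (rule ccontr)
              assume "?fib v \<noteq> {v}"
              then obtain w where "w \<in> ?fib v" "w \<noteq> v" using self[OF v(1)] by blast
              then show False using pair[OF v(1) nzv, of w] v(2) by simp
            qed
            then show ?thesis using nzv by (simp add: bl_def)
          qed (simp add: bl_def)
          then show ?thesis using fin3 v vab by blast
        qed
      qed
    qed
  qed
qed

text \<open>For \<open>p = 5\<close> there are six directions, and this excludes that they fall into three fibres of size two.
  A vanishing value \<open>(u, w)\<close> is counted as parallel to all six, hence it also satisfies the inequality.\<close>

definition quintic_fibres :: "int \<Rightarrow> int \<Rightarrow> int \<Rightarrow> int \<Rightarrow> int \<Rightarrow> bool" where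
  "quintic_fibres d a1 a2 b1 b2 =
   (let F = map (\<lambda>(s, t). let D = t * t - d * (s * s)
                  in ((D * (s * a1 + t * b1) - 2 * s * t * t) mod 5, (D * (s * a2 + t * b2) + 2 * s * s * t) mod 5))
          [(1, 0), (1, 1), (1, 2), (1, 3), (1, 4), (0, 1)]
    in list_ex (\<lambda>(u, w). length (filter (\<lambda>(u', w'). (u * w' - w * u') mod 5 = 0) F) \<noteq> 2) F)"

text \<open>2 and 3 are the nonresidues modulo 5, the possible residues of \<open>d\<close>; with
  four free coordinates this is a table of 1250 cases.\<close>

lemma quintic_fibres_all:
  "list_all (\<lambda>d. list_all (\<lambda>a1. list_all (\<lambda>a2. list_all (\<lambda>b1. list_all (\<lambda>b2. quintic_fibres d a1 a2 b1 b2)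
     [0, 1, 2, 3, 4]) [0, 1, 2, 3, 4]) [0, 1, 2, 3, 4]) [0, 1, 2, 3, 4]) [2, 3]"
  by code_simp

text \<open>What remains of the Beauville condition for elements of independent directions, with n =
  p. Natural exponents suffice in a finite group.\<close>

definition (in group) pow_sep :: "nat \<Rightarrow> 'a \<Rightarrow> 'a \<Rightarrow> bool" where
  "pow_sep n g h \<longleftrightarrow> (\<forall>(k::nat) (l::nat). \<forall>u\<in>carrier G. \<forall>v\<in>carrier G.
     u \<otimes> (g [^] n) [^] k \<otimes> inv u = v \<otimes> (h [^] n) [^] l \<otimes> inv v \<longrightarrow> u \<otimes> (g [^] n) [^] k \<otimes> inv u = \<one>)"

section \<open>From separated directions to Beauville structures\<close>

context thin_normalized
begin

lemma range_phi_M: "m \<in> M \<longleftrightarrow> (\<exists>f. m = \<Phi> f)"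
  using range_phi by auto

lemma phi_in_M: "\<Phi> f \<in> M"
  using range_phi_M by blast

lemma dir_in_M_iff: "dir m s t \<Longrightarrow> m \<in> M \<longleftrightarrow> p dvd s \<and> p dvd t"
proof
  assume m: "dir m s t"
  then obtain f where f: "m = \<Phi> f \<otimes> (x [^] s \<otimes> y [^] t)" by (auto simp: dir_def)
  {
    assume "m \<in> M"
    then have "inv (\<Phi> f) \<otimes> m \<in> M"
      using phi_in_M subgroup.m_closed[OF M_subgroup] subgroup.m_inv_closed[OF M_subgroup] by blast
    then have "x [^] s \<otimes> y [^] t \<in> M" using f by simp
    then show "p dvd s \<and> p dvd t" by (rule generators_independent[OF x_closed y_closed gen])
  next
    assume "p dvd s \<and> p dvd t"
    then obtain i j where ij: "s = p * i" "t = p * j" by blast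
    have "(x [^] p) [^] i \<in> M" "(y [^] p) [^] j \<in> M"
      using subgroup_int_pow_closed[OF M_subgroup pow_p_in_M[OF x_closed], of "int i"]
        subgroup_int_pow_closed[OF M_subgroup pow_p_in_M[OF y_closed], of "int j"] by (simp_all add: int_pow_int)
    then have "x [^] s \<in> M" "y [^] t \<in> M" using ij by (simp_all add: nat_pow_pow)
    then show "m \<in> M" unfolding f using phi_in_M subgroup.m_closed[OF M_subgroup] by blast
  }
qed

text \<open>One representation is used for g, the other for g^(p-1). As g^p lies in M, p divides s +
  (p - 1) s', hence s - s'.\<close>

lemma dir_unique:
  assumes "dir g s t" "dir g s' t'" shows "int p dvd int s - int s'" and "int p dvd int t - int t'"
proof -
  have p1: "p = Suc (p - 1)" using p_gt_1 by simp
  have g: "g \<in> carrier G" using assms dir_closed by blast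
  have "g [^] p = g \<otimes> g [^] (p - 1)" using nat_pow_Suc2[OF g, of "p - 1"] p1 by simp
  then have "dir (g [^] p) (s + (p - 1) * s') (t + (p - 1) * t')"
    using dir_mult[OF assms(1) dir_pow[OF assms(2), of "p - 1"]] by simp
  then have "p dvd s + (p - 1) * s'" "p dvd t + (p - 1) * t'"
    using dir_in_M_iff pow_p_in_M[OF g] by blast+
  then have "int p dvd int (s + (p - 1) * s')" "int p dvd int (t + (p - 1) * t')" by (simp_all only: of_nat_dvd_iff)
  moreover have "int (p - 1) = int p - 1" using p_gt_1 by simp
  ultimately have "int p dvd int s + (int p - 1) * int s'" "int p dvd int t + (int p - 1) * int t'" by simp_all
  then have "int p dvd int s + (int p - 1) * int s' - int p * int s'"
    "int p dvd int t + (int p - 1) * int t' - int p * int t'" by (intro dvd_diff; simp)+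
  then show "int p dvd int s - int s'" "int p dvd int t - int t'" by (simp_all add: algebra_simps)
qed

text \<open>The (p-1)-st power of the target element is its inverse modulo M, so the quotient lies
  in M.\<close>

lemma dir_change:
  assumes g: "dir g s t" and "int p dvd int s - int s'" "int p dvd int t - int t'" shows "dir g s' t'"
proof -
  let ?h = "x [^] s' \<otimes> y [^] t'"
  have p1: "p = Suc (p - 1)" using p_gt_1 by simp
  have gc: "g \<in> carrier G" using g dir_closed by blast
  have "dir (g \<otimes> ?h [^] (p - 1)) (s + (p - 1) * s') (t + (p - 1) * t')"
    by (rule dir_mult[OF g dir_pow[OF dir_xy]])
  moreover have "p dvd s + (p - 1) * s'" "p dvd t + (p - 1) * t'"
  proof -
    have i: "int (p - 1) = int p - 1" using p_gt_1 by simp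
    have "int (s + (p - 1) * s') = (int s - int s') + int p * int s'"
      "int (t + (p - 1) * t') = (int t - int t') + int p * int t'" 
      unfolding of_nat_add of_nat_mult i by (simp_all add: algebra_simps)
    then have "int p dvd int (s + (p - 1) * s')" "int p dvd int (t + (p - 1) * t')"
      using assms by (metis dvd_add dvd_triv_left)+
    then show "p dvd s + (p - 1) * s'" "p dvd t + (p - 1) * t'" by (simp_all only: of_nat_dvd_iff)
  qed
  ultimately have "g \<otimes> ?h [^] (p - 1) \<in> M" using dir_in_M_iff by blast
  then have "g \<otimes> ?h [^] (p - 1) \<otimes> inv (?h [^] p) \<in> M"
    using pow_p_in_M[of ?h] subgroup.m_closed[OF M_subgroup] subgroup.m_inv_closed[OF M_subgroup] by auto
  moreover have "?h [^] p = ?h [^] (p - 1) \<otimes> ?h"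
    using nat_pow_Suc[of ?h "p - 1"] p1 by simp
  then have "?h [^] p = ?h \<otimes> ?h [^] (p - 1)" using nat_pow_comm[of ?h "p - 1" 1] by simp
  then have "g \<otimes> ?h [^] (p - 1) \<otimes> inv (?h [^] p) = g \<otimes> inv ?h"
  proof -
    define k where "k = ?h [^] (p - 1)"
    define h where "h = ?h"
    have kc: "k \<in> carrier G" "h \<in> carrier G" by (auto simp: k_def h_def)
    have "g \<otimes> k \<otimes> inv (h \<otimes> k) = g \<otimes> inv h" using kc gc by (simp add: m_assoc inv_mult_group)
    then show ?thesis using \<open>?h [^] p = ?h \<otimes> ?h [^] (p - 1)\<close> by (simp add: k_def h_def)
  qed
  ultimately obtain f where "g \<otimes> inv ?h = \<Phi> f" using range_phi_M by auto
  then have "g = \<Phi> f \<otimes> ?h" using gc by (metis inv_solve_right m_closed nat_pow_closed phi_closed x_closed y_closed)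
  then show ?thesis unfolding dir_def by blast
qed

lemma dir_conj:
  assumes "dir g s t" "u \<in> carrier G" shows "dir (u \<otimes> g \<otimes> inv u) s t"
proof -
  have g: "g \<in> carrier G" using assms dir_closed by blast
  obtain e where e: "cmt u g = \<Phi> e" using cmt_phi assms g by blast
  have "u \<otimes> g \<otimes> inv u = \<Phi> e \<otimes> g" using assms g by (simp add: cmt_def m_assoc flip: e)
  then show ?thesis using dir_mult[OF dir_phi assms(1), of e] by simp
qed

lemma generate_of_directions:
  assumes g: "dir g s t" and h: "dir h s' t'" and ind: "\<not> int p dvd cross (s, t) (s', t')"
  shows "generate G {g, h} = carrier G"
proof -
  have gc: "g \<in> carrier G" and hc: "h \<in> carrier G" using g h dir_closed by auto
  let ?H = "generate G ({g, h} \<union> M)"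
  have H: "subgroup ?H G" using gc hc M_carrier by (intro generate_is_subgroup) auto
  have gH: "g \<in> ?H" and hH: "h \<in> ?H" and MH: "m \<in> M \<Longrightarrow> m \<in> ?H" for m by (auto intro: generate.incl)
  define \<Delta> where "\<Delta> = cross (s, t) (s', t')"
  have \<Delta>: "\<Delta> = int s * int t' - int s' * int t" by (simp add: \<Delta>_def cross_def)
  have mem: "x [^] i \<otimes> y [^] j \<in> ?H" for i j :: nat
  proof -
    obtain k where k: "int p dvd \<Delta> * int k - (int i * int t' - int j * int s')"
      using exists_mod_solution[OF prime_p ind[folded \<Delta>_def]] .
    obtain l where l: "int p dvd \<Delta> * int l - (int j * int s - int i * int t)"
      using exists_mod_solution[OF prime_p ind[folded \<Delta>_def]] .
    have d: "dir (g [^] k \<otimes> h [^] l) (k * s + l * s') (k * t + l * t')"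
      by (rule dir_mult[OF dir_pow[OF g] dir_pow[OF h]])
    have "\<Delta> * (int (k * s + l * s') - int i) =
        (\<Delta> * int k - (int i * int t' - int j * int s')) * int s + (\<Delta> * int l - (int j * int s - int i * int t)) * int s'"
      "\<Delta> * (int (k * t + l * t') - int j) =
        (\<Delta> * int k - (int i * int t' - int j * int s')) * int t + (\<Delta> * int l - (int j * int s - int i * int t)) * int t'"
      by (simp_all add: \<Delta> algebra_simps)
    then have "int p dvd \<Delta> * (int (k * s + l * s') - int i)" "int p dvd \<Delta> * (int (k * t + l * t') - int j)"
      using k l by (simp_all only: dvd_add dvd_mult2)
    then have "int p dvd int (k * s + l * s') - int i" "int p dvd int (k * t + l * t') - int j"
      using prime_dvd_cancel ind[folded \<Delta>_def] by blast+
    then have "dir (g [^] k \<otimes> h [^] l) i j" using dir_change[OF d] by blast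
    then obtain f where f: "g [^] k \<otimes> h [^] l = \<Phi> f \<otimes> (x [^] i \<otimes> y [^] j)" by (auto simp: dir_def)
    then have "x [^] i \<otimes> y [^] j = inv (\<Phi> f) \<otimes> (g [^] k \<otimes> h [^] l)" by simp
    moreover have "g [^] k \<in> ?H" "h [^] l \<in> ?H"
      using subgroup_int_pow_closed[OF H gH, of "int k"] subgroup_int_pow_closed[OF H hH, of "int l"]
      by (simp_all add: int_pow_int)
    ultimately show ?thesis
      using MH[OF phi_in_M[of f]] subgroup.m_closed[OF H] subgroup.m_inv_closed[OF H] by simp
  qed
  have "x \<in> ?H" "y \<in> ?H" using mem[of 1 0] mem[of 0 1] by simp_all
  then have "carrier G \<subseteq> ?H" by (intro generated_subset[OF gen H]) auto
  then have "?H = carrier G" using subgroup.subset[OF H] by blast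
  then show ?thesis using generate_mod_M[of "{g, h}"] gc hc by simp
qed

definition on_line :: "nat \<times> nat \<Rightarrow> 'a \<Rightarrow> bool" where
  "on_line v g \<longleftrightarrow> (\<exists>l. \<not> p dvd l \<and> dir g (l * fst v) (l * snd v))"

lemma on_line_closed: "on_line v g \<Longrightarrow> g \<in> carrier G"
  using dir_closed by (auto simp: on_line_def)

lemma exists_line:
  assumes g: "g \<in> carrier G" "g \<notin> M" shows "\<exists>v\<in>proj_line p. on_line v g"
proof -
  obtain s t where st: "dir g s t" using dir_exists g by blast
  have nz: "\<not> (p dvd s \<and> p dvd t)" using dir_in_M_iff[OF st] g by blast
  show ?thesis
  proof (cases "p dvd s")
    case False
    then have "\<not> int p dvd int s" by simp
    then obtain k where k: "int p dvd int s * int k - int t" using exists_mod_solution[OF prime_p] by blast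
    define i where "i = k mod p"
    have "int p dvd int t - int (s * i)"
    proof -
      have "int p dvd int k - int i" unfolding i_def by (simp add: zmod_int mod_eq_dvd_iff[symmetric])
      then have "int p dvd int s * (int k - int i)" by (rule dvd_mult)
      then have "int p dvd int s * (int k - int i) - (int s * int k - int t)" using k by (rule dvd_diff)
      then show ?thesis by (simp add: algebra_simps)
    qed
    then have "dir g (s * 1) (s * i)" using dir_change[OF st, of s "s * i"] by simp
    then have "on_line (1, i) g" using False by (auto simp: on_line_def)
    moreover have "(1, i) \<in> proj_line p" using p_gt_1 by (auto simp: proj_line_def i_def)
    ultimately show ?thesis by blast
  next
    case True
    then have "int p dvd int s - int 0" by simp
    then have "dir g (t * 0) (t * 1)" using dir_change[OF st, of 0 t] by simp
    then have "on_line (0, 1) g" using True nz by (auto simp: on_line_def)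
    then show ?thesis by (auto simp: proj_line_def)
  qed
qed

text \<open>Two directions are scaled so that they add up to the third. By Cramer's rule the scalars
  are quotients of determinants of different directions, hence nonzero modulo p.\<close>

lemma exists_generators_on_lines:
  assumes "\<not> int p dvd cross v1 v2" "\<not> int p dvd cross v1 v3" "\<not> int p dvd cross v2 v3"
  shows "\<exists>g h. on_line v1 g \<and> on_line v2 h \<and> on_line v3 (g \<otimes> h) \<and> generate G {g, h} = carrier G"
proof -
  obtain s1 t1 s2 t2 s3 t3 where v: "v1 = (s1, t1)" "v2 = (s2, t2)" "v3 = (s3, t3)" by (cases v1, cases v2, cases v3)
  define \<Delta> where "\<Delta> = int s1 * int t2 - int s2 * int t1"
  have \<Delta>: "\<not> int p dvd \<Delta>" using assms(1) by (simp add: \<Delta>_def cross_def v)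
  define A where "A = int s3 * int t2 - int s2 * int t3"
  define B where "B = int s1 * int t3 - int s3 * int t1"
  have "A = - cross v2 v3" by (simp add: A_def cross_def v)
  then have A: "\<not> int p dvd A" using assms(3) by simp
  have B: "\<not> int p dvd B" using assms(2) by (simp add: B_def cross_def v)
  obtain k where k: "int p dvd \<Delta> * int k - A" using exists_mod_solution[OF prime_p \<Delta>] .
  obtain l where l: "int p dvd \<Delta> * int l - B" using exists_mod_solution[OF prime_p \<Delta>] .
  have pk: "\<not> p dvd k"
  proof
    assume "p dvd k"
    then have "int p dvd \<Delta> * int k" by simp
    then have "int p dvd \<Delta> * int k - (\<Delta> * int k - A)" using k by (rule dvd_diff)
    then show False using A by simp
  qed
  have pl: "\<not> p dvd l"
  proof
    assume "p dvd l"
    then have "int p dvd \<Delta> * int l" by simp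
    then have "int p dvd \<Delta> * int l - (\<Delta> * int l - B)" using l by (rule dvd_diff)
    then show False using B by simp
  qed
  define g where "g = x [^] (k * s1) \<otimes> y [^] (k * t1)"
  define h where "h = x [^] (l * s2) \<otimes> y [^] (l * t2)"
  have g: "dir g (k * s1) (k * t1)" and h: "dir h (l * s2) (l * t2)" unfolding g_def h_def by (rule dir_xy)+
  have "\<Delta> * (int (k * s1 + l * s2) - int s3) = (\<Delta> * int k - A) * int s1 + (\<Delta> * int l - B) * int s2"
    "\<Delta> * (int (k * t1 + l * t2) - int t3) = (\<Delta> * int k - A) * int t1 + (\<Delta> * int l - B) * int t2"
    by (simp_all add: \<Delta>_def A_def B_def algebra_simps)
  then have "int p dvd \<Delta> * (int (k * s1 + l * s2) - int s3)" "int p dvd \<Delta> * (int (k * t1 + l * t2) - int t3)"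
    using k l by (simp_all only: dvd_add dvd_mult2)
  then have "int p dvd int (k * s1 + l * s2) - int s3" "int p dvd int (k * t1 + l * t2) - int t3"
    using prime_dvd_cancel \<Delta> by blast+
  then have gh: "dir (g \<otimes> h) s3 t3" using dir_change[OF dir_mult[OF g h]] by blast
  have "cross (k * s1, k * t1) (l * s2, l * t2) = int k * (int l * \<Delta>)"
    by (simp add: cross_def \<Delta>_def algebra_simps)
  moreover have "\<not> int p dvd int k * (int l * \<Delta>)" using pk pl \<Delta> by (intro not_dvd_mult) auto
  ultimately have "generate G {g, h} = carrier G" using generate_of_directions[OF g h] by simp
  moreover have "on_line v1 g" "on_line v2 h" using g h pk pl by (auto simp: on_line_def v)
  moreover have "on_line v3 (g \<otimes> h)" using gh p_gt_1 by (auto simp: on_line_def v intro!: exI[of _ 1])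
  ultimately show ?thesis by blast
qed

text \<open>A common element has both directions at once; independence makes both exponents
  divisible by p and leaves only p-th powers.\<close>

lemma sep_cyclic:
  assumes g: "on_line v g" and h: "on_line w h" and ind: "\<not> int p dvd cross v w" and sep: "pow_sep p g h"
    and z: "z = u \<otimes> g [^] (k::nat) \<otimes> inv u" "z = u' \<otimes> h [^] (l::nat) \<otimes> inv u'"
    and u: "u \<in> carrier G" "u' \<in> carrier G"
  shows "z = \<one>"
proof -
  obtain i where i: "\<not> p dvd i" "dir g (i * fst v) (i * snd v)" using g by (auto simp: on_line_def)
  obtain j where j: "\<not> p dvd j" "dir h (j * fst w) (j * snd w)" using h by (auto simp: on_line_def)
  have gc: "g \<in> carrier G" and hc: "h \<in> carrier G" using g h on_line_closed by auto
  have d1: "dir z (k * (i * fst v)) (k * (i * snd v))" unfolding z(1) by (intro dir_conj dir_pow i u)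
  have d2: "dir z (l * (j * fst w)) (l * (j * snd w))" unfolding z(2) by (intro dir_conj dir_pow j u)
  note du = dir_unique[OF d1 d2]
  have "int k * (int i * cross v w) =
      (int (k * (i * fst v)) - int (l * (j * fst w))) * int (snd w) - (int (k * (i * snd v)) - int (l * (j * snd w))) * int (fst w)"
    "int l * (int j * cross v w) =
      (int (k * (i * fst v)) - int (l * (j * fst w))) * int (snd v) - (int (k * (i * snd v)) - int (l * (j * snd w))) * int (fst v)"
    by (simp_all add: cross_def algebra_simps)
  then have "int p dvd int k * (int i * cross v w)" "int p dvd int l * (int j * cross v w)"
    using du by (simp_all only: dvd_diff dvd_mult2)
  moreover have "\<not> int p dvd int i * cross v w" "\<not> int p dvd int j * cross v w"
    using i j ind by (simp_all add: not_dvd_mult)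
  ultimately have "int p dvd int k" "int p dvd int l" using prime_int_p prime_dvd_mult_iff by blast+
  then have "p dvd k" "p dvd l" by simp_all
  then obtain k' l' where kl: "k = p * k'" "l = p * l'" unfolding dvd_def by blast
  then have "z = u \<otimes> (g [^] p) [^] k' \<otimes> inv u" "z = u' \<otimes> (h [^] p) [^] l' \<otimes> inv u'"
    using z gc hc by (simp_all add: nat_pow_pow)
  then show ?thesis using sep u unfolding pow_sep_def by metis
qed

lemma beauville_of_lines:
  assumes T1: "T1 \<subseteq> proj_line p" "card T1 = 3" and T2: "T2 \<subseteq> proj_line p" "card T2 = 3"
    and disj: "T1 \<inter> T2 = {}"
    and sep: "\<And>v w g h. \<lbrakk>v \<in> T1; w \<in> T2; on_line v g; on_line w h\<rbrakk> \<Longrightarrow> pow_sep p g h"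
  shows "\<exists>u v. beauville_structure G u v"
proof -
  obtain v1 v2 v3 where v: "T1 = {v1, v2, v3}" "v1 \<noteq> v2" "v1 \<noteq> v3" "v2 \<noteq> v3" using T1(2) card_3_iff[of T1] by blast
  obtain w1 w2 w3 where w: "T2 = {w1, w2, w3}" "w1 \<noteq> w2" "w1 \<noteq> w3" "w2 \<noteq> w3" using T2(2) card_3_iff[of T2] by blast
  have ind: "\<not> int p dvd cross v w" if "v \<in> T1 \<union> T2" "w \<in> T1 \<union> T2" "v \<noteq> w" for v w
    using cross_proj_line[OF p_gt_1] that T1 T2 by blast
  obtain g h where gh: "on_line v1 g" "on_line v2 h" "on_line v3 (g \<otimes> h)" "generate G {g, h} = carrier G"
    using exists_generators_on_lines[of v1 v2 v3] ind v by auto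
  obtain g' h' where gh': "on_line w1 g'" "on_line w2 h'" "on_line w3 (g' \<otimes> h')" "generate G {g', h'} = carrier G"
    using exists_generators_on_lines[of w1 w2 w3] ind w by auto
  have Sig: "\<exists>q\<in>{a, b, a \<otimes> b}. \<exists>k::nat. \<exists>u\<in>carrier G. z = u \<otimes> q [^] k \<otimes> inv u"
    if z: "z \<in> beauville_Sigma G a b" and ab: "a \<in> carrier G" "b \<in> carrier G" for z a b
  proof -
    have aux: "\<exists>k::nat. \<exists>u\<in>carrier G. z = u \<otimes> q [^] k \<otimes> inv u"
      if rq: "r \<in> carrier G" "q \<in> carrier G" "z \<in> conj_set G (generate G {q}) r" for r q
    proof -
      obtain k :: nat where "z = inv r \<otimes> q [^] k \<otimes> r"
        using rq generate_pow_on_finite_carrier[OF fin rq(2)] by (auto simp: conj_set_def)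
      then have "z = inv r \<otimes> q [^] k \<otimes> inv (inv r)" using rq by simp
      then show ?thesis using inv_closed[OF rq(1)] by blast
    qed
    obtain r where "r \<in> carrier G" "z \<in> conj_set G (generate G {a}) r \<union> conj_set G (generate G {b}) r \<union> conj_set G (generate G {a \<otimes> b}) r"
      using z by (auto simp: beauville_Sigma_def)
    then show ?thesis using aux[of r a] aux[of r b] aux[of r "a \<otimes> b"] ab m_closed[OF ab] by auto
  qed
  have gc: "g \<in> carrier G" "h \<in> carrier G" "g' \<in> carrier G" "h' \<in> carrier G" using gh gh' on_line_closed by auto
  have "z = \<one>" if z: "z \<in> beauville_Sigma G g h" "z \<in> beauville_Sigma G g' h'" for z
  proof -
    obtain q k u where q: "q \<in> {g, h, g \<otimes> h}" "u \<in> carrier G" "z = u \<otimes> q [^] (k::nat) \<otimes> inv u"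
      using Sig[OF z(1)] gc by blast
    obtain q' k' u' where q': "q' \<in> {g', h', g' \<otimes> h'}" "u' \<in> carrier G" "z = u' \<otimes> q' [^] (k'::nat) \<otimes> inv u'"
      using Sig[OF z(2)] gc by blast
    obtain v where vq: "v \<in> T1" "on_line v q" using q(1) gh(1-3) unfolding v(1) by blast
    obtain w where wq: "w \<in> T2" "on_line w q'" using q'(1) gh'(1-3) unfolding w(1) by blast
    have "v \<noteq> w" using vq wq disj by blast
    then have "\<not> int p dvd cross v w" using ind vq wq by blast
    then show ?thesis using sep_cyclic[OF vq(2) wq(2) _ sep[OF vq(1) wq(1) vq(2) wq(2)] q(3) q'(3) q(2) q'(2)] by blast
  qed
  moreover have "\<one> \<in> beauville_Sigma G a b" for a b
  proof -
    have "\<one> \<in> conj_set G (generate G {a}) \<one>"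
      unfolding conj_set_def by (rule image_eqI[of _ _ \<one>]) (auto intro: generate.one)
    then show ?thesis unfolding beauville_Sigma_def using one_closed by blast
  qed
  ultimately have "beauville_Sigma G g h \<inter> beauville_Sigma G g' h' = {\<one>}" by blast
  then have "beauville_structure G (g, h) (g', h')"
    using gh(4) gh'(4) gc fin is_group by (simp add: beauville_structure_def)
  then show ?thesis by blast
qed

text \<open>Conjugation of p-th powers is multiplication by 1 + j with j of positive degree, so
  separation becomes a statement about \<open>I\<close>.\<close>

lemma sep_ring:
  assumes w1: "g [^] p = \<Phi> w1" and w2: "h [^] p = \<Phi> w2"
    and main: "\<And>k l j j'. \<lbrakk>j \<in> K (Suc 0); j' \<in> K (Suc 0);
       (1 + j) * (of_nat k * w1) - (1 + j') * (of_nat l * w2) \<in> I\<rbrakk> \<Longrightarrow> of_nat k * w1 \<in> I"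
  shows "pow_sep p g h"
  unfolding pow_sep_def
proof (intro allI ballI impI)
  fix k l :: nat and u v assume uv: "u \<in> carrier G" "v \<in> carrier G"
    and eq: "u \<otimes> (g [^] p) [^] k \<otimes> inv u = v \<otimes> (h [^] p) [^] l \<otimes> inv v"
  obtain j where j: "j \<in> aug" "acts u (1 + j)" using exists_acts uv by blast
  obtain j' where j': "j' \<in> aug" "acts v (1 + j')" using exists_acts uv by blast
  have 1: "u \<otimes> (g [^] p) [^] k \<otimes> inv u = \<Phi> ((1 + j) * (of_nat k * w1))"
    using j by (simp add: acts_def w1 phi_of_nat)
  have "v \<otimes> (h [^] p) [^] l \<otimes> inv v = \<Phi> ((1 + j') * (of_nat l * w2))"
    using j' by (simp add: acts_def w2 phi_of_nat)
  then have "(1 + j) * (of_nat k * w1) - (1 + j') * (of_nat l * w2) \<in> I"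
    using eq 1 by (simp add: phi_eq_iff I_def)
  then have "of_nat k * w1 \<in> I" using main aug_K j(1) j'(1) by blast
  then have "(1 + j) * (of_nat k * w1) \<in> I" by (rule I_mult)
  then show "u \<otimes> (g [^] p) [^] k \<otimes> inv u = \<one>" using 1 by (simp add: I_def)
qed

text \<open>Equal conjugates make A and B agree modulo the last term, so the operators of both
  directions, hence \<open>U\<close> and \<open>V\<close>, kill A. Then A and B lie in the last
  term, and the exponent of a power outside it is divisible by p.\<close>

lemma sep_good:
  assumes g: "dir g s t" "\<not> (p dvd s \<and> p dvd t)" and h: "dir h s' t'" "\<not> (p dvd s' \<and> p dvd t')"
    and ind: "\<not> int p dvd cross (s, t) (s', t')"
    and w1: "g [^] p = \<Phi> w1" and w2: "h [^] p = \<Phi> w2" and good: "w1 \<notin> K (C - 2) \<or> w2 \<notin> K (C - 2)"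
  shows "pow_sep p g h"
proof (rule sep_ring[OF w1 w2])
  fix k l :: nat and j j' assume j: "j \<in> K (Suc 0)" "j' \<in> K (Suc 0)"
    and eq: "(1 + j) * (of_nat k * w1) - (1 + j') * (of_nat l * w2) \<in> I"
  define A where "A = of_nat k * w1"
  define B where "B = of_nat l * w2"
  have S: "Suc (C - 3) = C - 2" using C_ge by simp
  have k1: "w1 \<in> K (C - 3)" and k2: "w2 \<in> K (C - 3)"
    using power_in_K_top(1)[OF g w1] power_in_K_top(1)[OF h w2] by auto
  have A: "A \<in> K (C - 3)" and B: "B \<in> K (C - 3)" unfolding A_def B_def by (intro K_mult k1 k2)+
  have K31: "f \<in> K (C - 3) \<Longrightarrow> f \<in> K (Suc 0)" for f by (erule K_antimono[rotated]) (use C_ge in auto)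
  have K3j: "i * f \<in> K (C - 2)" if "i \<in> K (Suc 0)" "f \<in> K (C - 3)" for i f
    using K_mult_add[OF that] S by simp
  have "A - B = ((1 + j) * A - (1 + j') * B) - j * A + j' * B" by (simp add: algebra_simps)
  also have "\<dots> \<in> K (C - 2)"
    by (intro K_add K_diff I_subset_K[OF eq[folded A_def B_def]] K3j[OF j(1) A] K3j[OF j(2) B])
  finally have AB: "A - B \<in> K (C - 2)" .
  obtain Z where Z: "acts g (1 + Z)" "Z - (of_nat s * U + of_nat t * V) \<in> K 2" using dir_acts[OF g(1)] by blast
  obtain W where W: "acts h (1 + W)" "W - (of_nat s' * U + of_nat t' * V) \<in> K 2" using dir_acts[OF h(1)] by blast
  have W1: "W \<in> K (Suc 0)" using K1_of_linear[of W "int s'" "int t'"] W by simp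
  have ZA: "Z * A \<in> I" using I_mult[OF power_kernel[OF Z(1) w1], of "of_nat k"] by (simp add: A_def algebra_simps)
  have "W * B \<in> I" using I_mult[OF power_kernel[OF W(1) w2], of "of_nat l"] by (simp add: B_def algebra_simps)
  \<comment> \<open>\<open>W\<close> kills the last term, which transfers W B = 0 to A.\<close>
  moreover have "W * (A - B) \<in> I" using K_top_mult[OF AB W1] .
  ultimately have "W * B + W * (A - B) \<in> I" by (rule I_add)
  then have WA: "W * A \<in> I" by (simp add: algebra_simps)
  have K2A: "f * A \<in> I" if "f \<in> K 2" for f
    using K_mult_add[OF that A] C_ge by (intro K_top_I) (simp add: numeral_3_eq_3 numeral_2_eq_2 Suc_diff_Suc)
  have lin1: "(of_nat s * U + of_nat t * V) * A \<in> I"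
    using I_diff[OF ZA K2A[OF Z(2)]] by (simp add: algebra_simps)
  have lin2: "(of_nat s' * U + of_nat t' * V) * A \<in> I"
    using I_diff[OF WA K2A[OF W(2)]] by (simp add: algebra_simps)
  define \<Delta> where "\<Delta> = cross (s, t) (s', t')"
  have \<Delta>: "\<Delta> = int s * int t' - int s' * int t" by (simp add: \<Delta>_def cross_def)
  have "of_int \<Delta> * (U * A) = of_nat t' * ((of_nat s * U + of_nat t * V) * A) - of_nat t * ((of_nat s' * U + of_nat t' * V) * A)"
    by (simp add: \<Delta> algebra_simps)
  also have "\<dots> \<in> I" by (intro I_diff I_mult lin1 lin2)
  finally have UA: "U * A \<in> I" by (rule cancel_I1[OF ind[folded \<Delta>_def] _ K_mult_right[OF U_in_K]])
  have "of_int \<Delta> * (V * A) = of_nat s * ((of_nat s' * U + of_nat t' * V) * A) - of_nat s' * ((of_nat s * U + of_nat t * V) * A)"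
    by (simp add: \<Delta> algebra_simps)
  also have "\<dots> \<in> I" by (intro I_diff I_mult lin1 lin2)
  finally have VA: "V * A \<in> I" by (rule cancel_I1[OF ind[folded \<Delta>_def] _ K_mult_right[OF V_in_K]])
  have AK: "A \<in> K (C - 2)" using joint_kernel[OF UA VA] .
  then have BK: "B \<in> K (C - 2)" using K_diff[OF AK AB] by simp
  have can: "int p dvd int n" if "of_nat n * w \<in> K (C - 2)" "w \<in> K (C - 3)" "w \<notin> K (C - 2)" for n w
    using cancel_K[of "int n" w "C - 3"] that S by auto
  show "of_nat k * w1 \<in> I"
    using good
  proof
    assume "w1 \<notin> K (C - 2)"
    then have "int p dvd int k" using can AK k1 by (auto simp: A_def)
    then show ?thesis using p_dvd_I[OF _ K31[OF k1], of "int k"] by simp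
  next
    assume "w2 \<notin> K (C - 2)"
    then have "int p dvd int l" using can BK k2 by (auto simp: B_def)
    then have "B \<in> I" using p_dvd_I[OF _ K31[OF k2], of "int l"] by (simp add: B_def)
    then have "A * (1 + j) \<in> I"
      using I_add[OF eq[folded A_def B_def] I_mult[of B "1 + j'"]] by (simp add: mult.commute)
    then show ?thesis using unit_cancel[OF j(1)] by (simp add: A_def)
  qed
qed

text \<open>Positive degree annihilates the last term, so conjugation has no effect there.\<close>

lemma sep_central:
  assumes w1: "g [^] p = \<Phi> w1" "w1 \<in> K (C - 2)" and w2: "h [^] p = \<Phi> w2" "w2 \<in> K (C - 2)"
    and main: "\<And>k l::nat. of_nat k * w1 - of_nat l * w2 \<in> I \<Longrightarrow> of_nat k * w1 \<in> I"
  shows "pow_sep p g h"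
proof (rule sep_ring[OF w1(1) w2(1)])
  fix k l :: nat and j j' assume j: "j \<in> K (Suc 0)" "j' \<in> K (Suc 0)"
    and eq: "(1 + j) * (of_nat k * w1) - (1 + j') * (of_nat l * w2) \<in> I"
  have "of_nat k * w1 - of_nat l * w2 =
    ((1 + j) * (of_nat k * w1) - (1 + j') * (of_nat l * w2)) - of_nat k * (j * w1) + of_nat l * (j' * w2)"
    by (simp add: algebra_simps)
  also have "\<dots> \<in> I" by (intro I_add I_diff eq I_mult K_top_mult w1 w2 j)
  finally show "of_nat k * w1 \<in> I" by (rule main)
qed

end

text \<open>The coordinates of \<open>(t\<^sup>2 - d s\<^sup>2) w\<close>, where \<open>w\<close> represents \<open>(x\<^sup>s y\<^sup>t)\<^sup>p\<close> and \<open>x\<^sup>p\<close>, \<open>y\<^sup>p\<close> have the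
  coordinates \<open>a\<close> and \<open>b\<close>.\<close>

definition cub1 :: "int \<Rightarrow> int \<Rightarrow> int \<Rightarrow> int \<Rightarrow> int \<Rightarrow> int" where
  "cub1 d a b s t = (t * t - d * (s * s)) * (s * a + t * b) - 2 * s * t * t"

definition cub2 :: "int \<Rightarrow> int \<Rightarrow> int \<Rightarrow> int \<Rightarrow> int \<Rightarrow> int" where
  "cub2 d a b s t = (t * t - d * (s * s)) * (s * a + t * b) + 2 * s * s * t"

lemma cub_homogeneous:
  "cub1 d a b (l * s) (l * t) = l * (l * l) * cub1 d a b s t"
  "cub2 d a b (l * s) (l * t) = l * (l * l) * cub2 d a b s t"
  by (simp_all add: cub1_def cub2_def algebra_simps)

lemma cub_mod:
  "[cub1 (d mod q) (a mod q) (b mod q) s t mod q = cub1 d a b s t] (mod q)"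
  "[cub2 (d mod q) (a mod q) (b mod q) s t mod q = cub2 d a b s t] (mod q)"
proof -
  have "[cub1 (d mod q) (a mod q) (b mod q) s t = cub1 d a b s t] (mod q)"
    "[cub2 (d mod q) (a mod q) (b mod q) s t = cub2 d a b s t] (mod q)"
    unfolding cub1_def cub2_def by (intro cong_add cong_mult cong_diff cong_refl; simp add: cong_def)+
  then show "[cub1 (d mod q) (a mod q) (b mod q) s t mod q = cub1 d a b s t] (mod q)"
    "[cub2 (d mod q) (a mod q) (b mod q) s t mod q = cub2 d a b s t] (mod q)" by (simp_all add: cong_def)
qed

lemma const_dvd_pCons: "[:c:] dvd pCons a f \<longleftrightarrow> c dvd a \<and> [:c:] dvd f" for c :: int
proof -
  have "(\<forall>n. c dvd coeff (pCons a f) n) \<longleftrightarrow> c dvd a \<and> (\<forall>n. c dvd coeff f n)"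
    by (auto simp: coeff_pCons split: nat.splits)
  then show ?thesis by (simp add: const_poly_dvd_iff)
qed

text \<open>Transfers the table of residues to arbitrary integers, and from lists to
  \<open>proj_line 5\<close>.\<close>

lemma exists_fibre_not_pair:
  fixes d a1 a2 b1 b2 :: int
  assumes d: "d mod 5 \<in> {2, 3}"
  defines "F1 \<equiv> \<lambda>v. cub1 d a1 b1 (int (fst v)) (int (snd v))" and "F2 \<equiv> \<lambda>v. cub2 d a2 b2 (int (fst v)) (int (snd v))"
  shows "\<exists>v\<in>proj_line 5. card {w \<in> proj_line 5. 5 dvd F1 v * F2 w - F2 v * F1 w} \<noteq> 2"
proof -
  have m: "c mod 5 \<in> {0, 1, 2, 3, 4}" for c :: int
    using pos_mod_bound[of 5 c] pos_mod_sign[of 5 c] by auto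
  define vs :: "(nat \<times> nat) list" where "vs = [(1, 0), (1, 1), (1, 2), (1, 3), (1, 4), (0, 1)]"
  have "{..<5::nat} = {0, 1, 2, 3, 4}" by (simp add: lessThan_nat_numeral lessThan_Suc insert_commute)
  then have set_vs: "set vs = proj_line 5"
    unfolding vs_def proj_line_def by (simp only: list.set image_insert image_empty) blast
  have dist: "distinct vs" by (simp add: vs_def)
  define f where "f = (\<lambda>v::nat \<times> nat. (cub1 (d mod 5) (a1 mod 5) (b1 mod 5) (int (fst v)) (int (snd v)) mod 5,
      cub2 (d mod 5) (a2 mod 5) (b2 mod 5) (int (fst v)) (int (snd v)) mod 5))"
  have "quintic_fibres (d mod 5) (a1 mod 5) (a2 mod 5) (b1 mod 5) (b2 mod 5)"
  proof -
    have "d mod 5 \<in> set [2, 3]" "c mod 5 \<in> set [0, 1, 2, 3, 4]" for c :: int using d m[of c] by simp_all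
    then show ?thesis using quintic_fibres_all unfolding list_all_iff by (elim ballE) blast+
  qed
  moreover have "map (\<lambda>(s, t). let D = t * t - d mod 5 * (s * s)
        in ((D * (s * (a1 mod 5) + t * (b1 mod 5)) - 2 * s * t * t) mod 5,
            (D * (s * (a2 mod 5) + t * (b2 mod 5)) + 2 * s * s * t) mod 5))
      [(1, 0), (1, 1), (1, 2), (1, 3), (1, 4), (0, 1)] = map f vs"
  proof -
    have ivs: "[(1, 0), (1, 1), (1, 2), (1, 3), (1, 4), (0, 1)] = map (\<lambda>v. (int (fst v), int (snd v))) vs"
      by (simp add: vs_def)
    show ?thesis
      unfolding ivs map_map by (rule map_cong[OF refl]) (simp add: f_def cub1_def cub2_def Let_def)
  qed
  ultimately have "list_ex (\<lambda>(u, w). length (filter (\<lambda>(u', w'). (u * w' - w * u') mod 5 = 0) (map f vs)) \<noteq> 2) (map f vs)"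
    unfolding quintic_fibres_def by (simp only:) (simp only: Let_def)
  then obtain v where v: "v \<in> set vs"
    "length (filter (\<lambda>(u', w'). (fst (f v) * w' - snd (f v) * u') mod 5 = 0) (map f vs)) \<noteq> 2"
    by (auto simp: list_ex_iff split: prod.splits)
  let ?P = "\<lambda>w. (fst (f v) * snd (f w) - snd (f v) * fst (f w)) mod 5 = 0"
  have "length (filter (\<lambda>(u', w'). (fst (f v) * w' - snd (f v) * u') mod 5 = 0) (map f vs)) = length (filter ?P vs)"
    by (simp add: filter_map o_def case_prod_beta)
  also have "\<dots> = card (set (filter ?P vs))"
    by (rule distinct_card[symmetric]) (rule distinct_filter[OF dist])
  finally have "card {w \<in> proj_line 5. ?P w} \<noteq> 2" using v set_vs by simp
  moreover have "?P w \<longleftrightarrow> 5 dvd F1 v * F2 w - F2 v * F1 w" for w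
  proof -
    have "[fst (f v) * snd (f w) - snd (f v) * fst (f w) = F1 v * F2 w - F2 v * F1 w] (mod 5)"
      unfolding f_def F1_def F2_def fst_conv snd_conv by (intro cong_diff cong_mult cub_mod)
    then show ?thesis by (simp add: cong_dvd_iff dvd_eq_mod_eq_0[symmetric])
  qed
  ultimately show ?thesis using v set_vs by auto
qed

section \<open>Maximal subgroups and the cases of the theorem\<close>

context thin_metabelian
begin

abbreviation max_over :: "'a \<Rightarrow> 'a set" where
  "max_over g \<equiv> generate G (insert g M)"

lemma max_over_subgroup: "g \<in> carrier G \<Longrightarrow> subgroup (max_over g) G"
  using M_carrier by (intro generate_is_subgroup) auto

lemma max_over_mem: "g \<in> max_over g" "m \<in> M \<Longrightarrow> m \<in> max_over g"
  by (auto intro: generate.incl)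

text \<open>A subgroup strictly in between would need a third factor p, but M has index p^2.\<close>

lemma max_over_maximal:
  assumes g: "g \<in> carrier G" "g \<notin> M" shows "maximal_subgroup (max_over g) G"
proof -
  let ?N = "max_over g"
  have N: "subgroup ?N G" by (rule max_over_subgroup[OF g(1)])
  have "M \<subset> ?N" using g max_over_mem by blast
  then have 1: "p * card M \<le> card ?N" using card_proper_subgroup M_subgroup N by blast
  have ne: "?N \<noteq> carrier G" using not_cyclic_mod_M g by blast
  have "H = ?N \<or> H = carrier G" if H: "subgroup H G" "?N \<subseteq> H" for H
  proof (rule ccontr)
    assume neg: "\<not> (H = ?N \<or> H = carrier G)"
    then have "p * card ?N \<le> card H" using card_proper_subgroup[OF N H(1)] H(2) by blast
    moreover have "p * card H \<le> card (carrier G)"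
      using card_proper_subgroup[OF H(1) subgroup_self] subgroup.subset[OF H(1)] neg by blast
    ultimately have "p * (p * (p * card M)) \<le> p\<^sup>2 * card M"
      using 1 order_eq unfolding Coset.order_def by (metis dual_order.trans mult_le_mono2)
    moreover have "card M > 0" using card_subgroup_power[OF M_subgroup] p_gt_1 by auto
    ultimately show False using p_gt_1 by (simp add: power2_eq_square)
  qed
  then show ?thesis using N ne unfolding maximal_subgroup_def by blast
qed

text \<open>Since M consists of nongenerators, it lies in every maximal subgroup, which is then
  determined by any element outside M.\<close>

lemma maximal_subgroup_cases:
  assumes N: "maximal_subgroup N G"
  shows "\<exists>g\<in>N. g \<in> carrier G \<and> g \<notin> M" and "\<lbrakk>g \<in> N; g \<notin> M\<rbrakk> \<Longrightarrow> max_over g = N"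
proof -
  have sg: "subgroup N G" and ne: "N \<noteq> carrier G"
    and max: "\<And>H. \<lbrakk>subgroup H G; N \<subseteq> H\<rbrakk> \<Longrightarrow> H = N \<or> H = carrier G"
    using N unfolding maximal_subgroup_def by blast+
  have Nc: "N \<subseteq> carrier G" using subgroup.subset[OF sg] .
  have "generate G N = N" using generate_subgroup_incl[OF _ sg, of N] generate.incl[of _ N G] by blast
  then have "generate G (N \<union> M) \<noteq> carrier G" using generate_mod_M[OF Nc] ne by metis
  moreover have "subgroup (generate G (N \<union> M)) G" using Nc M_carrier by (intro generate_is_subgroup) auto
  moreover have "N \<subseteq> generate G (N \<union> M)" by (auto intro: generate.incl)
  ultimately have "generate G (N \<union> M) = N" using max by blast
  then have MN: "M \<subseteq> N" by (metis Un_iff generate.incl subsetI)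
  show over: "max_over g = N" if g: "g \<in> N" "g \<notin> M" for g
  proof -
    have gc: "g \<in> carrier G" using g Nc by blast
    have "max_over g \<subseteq> N" using g MN by (intro generate_subgroup_incl[OF _ sg]) auto
    then show ?thesis using max_over_maximal[OF gc g(2)] sg ne unfolding maximal_subgroup_def by blast
  qed
  show "\<exists>g\<in>N. g \<in> carrier G \<and> g \<notin> M"
  proof (rule ccontr)
    assume "\<not> ?thesis"
    then have NM: "N = M" using MN Nc by blast
    obtain x y where xy: "x \<in> carrier G" "y \<in> carrier G" "generate G {x, y} = carrier G" using two_generators by blast
    have "x \<notin> M"
    proof
      assume "x \<in> M"
      then have "carrier G \<subseteq> max_over y"
        using max_over_mem xy by (intro generated_subset[OF xy(3) max_over_subgroup]) auto
      then show False using not_cyclic_mod_M[OF xy(2)] subgroup.subset[OF max_over_subgroup[OF xy(2)]] by blast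
    qed
    moreover have "max_over x = N \<or> max_over x = carrier G"
      using max[OF max_over_subgroup[OF xy(1)]] max_over_mem(2) NM by blast
    ultimately show False using not_cyclic_mod_M[OF xy(1)] max_over_mem(1) NM by blast
  qed
qed

text \<open>Orders are powers of p, so the bound p leaves only 1 and p; the trivial subgroup meets
  the condition on p-th powers but has exponent 1.\<close>

lemma exponent_p_iff:
  assumes N: "subgroup N G"
  shows "group_exponent (G\<lparr>carrier := N\<rparr>) = p \<longleftrightarrow> N \<noteq> {\<one>} \<and> (\<forall>u\<in>N. u [^] p = \<one>)"
proof -
  have grp: "group (G\<lparr>carrier := N\<rparr>)" using subgroup_imp_group[OF N] .
  have "group.ord (G\<lparr>carrier := N\<rparr>) u = ord u" for u
    unfolding group.ord_def[OF grp] ord_def using nat_pow_consistent[of u _ N] by simp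
  then have e: "group_exponent (G\<lparr>carrier := N\<rparr>) = Max (ord ` N)" by (simp add: group_exponent_def)
  have finN: "finite N" using finite_sub[OF N] .
  have one: "\<one> \<in> N" using subgroup.one_closed[OF N] .
  have Nc: "u \<in> carrier G" if "u \<in> N" for u using that N subgroup.mem_carrier by metis
  show ?thesis
  proof
    assume "group_exponent (G\<lparr>carrier := N\<rparr>) = p"
    then have Max: "Max (ord ` N) = p" using e by simp
    have "u [^] p = \<one>" if u: "u \<in> N" for u
    proof -
      have "ord u \<le> p" using Max finN u by (metis Max_ge finite_imageI imageI)
      obtain n where "Coset.order G = p ^ n" using order_p_power by blast
      then have "ord u dvd p ^ n" using ord_dvd_group_order[OF Nc[OF u]] by simp
      then obtain i where i: "ord u = p ^ i" using divides_primepow_nat[OF prime_p] by blast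
      then have "p ^ i \<le> p ^ 1" using \<open>ord u \<le> p\<close> by simp
      then have "i \<le> 1" using p_gt_1 power_le_imp_le_exp by blast
      then have "ord u dvd p" using i le_imp_power_dvd[of i 1 p] by simp
      then show ?thesis using pow_eq_id[OF Nc[OF u]] by simp
    qed
    moreover have "N \<noteq> {\<one>}" using Max p_gt_1 by auto
    ultimately show "N \<noteq> {\<one>} \<and> (\<forall>u\<in>N. u [^] p = \<one>)" by blast
  next
    assume *: "N \<noteq> {\<one>} \<and> (\<forall>u\<in>N. u [^] p = \<one>)"
    have dvd: "ord u dvd p" if "u \<in> N" for u using pow_eq_id[OF Nc[OF that], of p] * that by blast
    obtain u where u: "u \<in> N" "u \<noteq> \<one>" using * one by blast
    then have "ord u \<noteq> 1" using ord_eq_1[OF Nc] by blast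
    then have "ord u = p" using dvd[OF u(1)] prime_p by (auto simp: prime_nat_iff)
    moreover have "ord v \<le> p" if "v \<in> N" for v using dvd[OF that] p_gt_1 dvd_imp_le by fastforce
    ultimately have "Max (ord ` N) = p" using u finN by (intro Max_eqI) auto
    then show "group_exponent (G\<lparr>carrier := N\<rparr>) = p" using e by simp
  qed
qed

end

section \<open>Powers outside the last term\<close>

context thin_normalized
begin

lemma proj_line_nonzero:
  assumes "v \<in> proj_line p" "\<not> p dvd l" shows "\<not> (p dvd l * fst v \<and> p dvd l * snd v)"
  using assms by (auto simp: proj_line_def)

lemma card_proj_line_ge: "card (proj_line p) \<ge> 6"
  using card_proj_line[of p] p5 by simp

text \<open>With \<open>B\<close> inside the first triple, every pair across the triples has its
  second member outside \<open>B\<close>, as \<open>sep_good\<close> requires.\<close>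

lemma beauville_of_few_bad_lines:
  assumes B: "B \<subseteq> proj_line p" "card B \<le> 2"
    and good: "\<And>v l g w. \<lbrakk>v \<in> proj_line p; v \<notin> B; \<not> p dvd l; dir g (l * fst v) (l * snd v); g [^] p = \<Phi> w\<rbrakk> \<Longrightarrow> w \<notin> K (C - 2)"
  shows "\<exists>u v. beauville_structure G u v"
proof -
  have finB: "finite B" by (rule finite_subset[OF B(1) finite_proj_line])
  obtain T1 where T1: "B \<subseteq> T1" "T1 \<subseteq> proj_line p" "card T1 = 3"
  proof -
    have "card (proj_line p - B) \<ge> 3 - card B" using card_proj_line_ge B finB by (subst card_Diff_subset) auto
    then obtain S where S: "S \<subseteq> proj_line p - B" "card S = 3 - card B" by (rule obtain_subset_with_card_n)
    have finS: "finite S" using S finite_subset[of S "proj_line p"] by auto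
    have "card (B \<union> S) = 3" using S B finB finS by (subst card_Un_disjoint) auto
    then show ?thesis using that[of "B \<union> S"] S B by auto
  qed
  have "card (proj_line p - T1) \<ge> 3"
    using card_proj_line_ge T1 finite_subset[of T1 "proj_line p"] by (subst card_Diff_subset) auto
  then obtain T2 where T2: "T2 \<subseteq> proj_line p - T1" "card T2 = 3" by (rule obtain_subset_with_card_n)
  show ?thesis
  proof (rule beauville_of_lines[of T1 T2])
    fix v w g h assume vw: "v \<in> T1" "w \<in> T2" and g: "on_line v g" and h: "on_line w h"
    obtain l where l: "\<not> p dvd l" "dir g (l * fst v) (l * snd v)" using g by (auto simp: on_line_def)
    obtain l' where l': "\<not> p dvd l'" "dir h (l' * fst w) (l' * snd w)" using h by (auto simp: on_line_def)
    obtain w1 where w1: "g [^] p = \<Phi> w1" using pow_p_phi on_line_closed[OF g] by blast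
    obtain w2 where w2: "h [^] p = \<Phi> w2" using pow_p_phi on_line_closed[OF h] by blast
    have v: "v \<in> proj_line p" and w: "w \<in> proj_line p" "w \<notin> B" and "v \<noteq> w" using vw T1 T2 by auto
    have "cross (l * fst v, l * snd v) (l' * fst w, l' * snd w) = int l * (int l' * cross v w)"
      by (simp add: cross_def algebra_simps)
    moreover have "\<not> int p dvd int l * (int l' * cross v w)"
      using l l' cross_proj_line[OF p_gt_1 v w(1) \<open>v \<noteq> w\<close>] by (intro not_dvd_mult) auto
    ultimately have "\<not> int p dvd cross (l * fst v, l * snd v) (l' * fst w, l' * snd w)" by simp
    then show "pow_sep p g h"
      by (rule sep_good[OF l(2) proj_line_nonzero[OF v l(1)] l'(2) proj_line_nonzero[OF w(1) l'(1)] _ w1 w2])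
         (use good[OF w l' w2] in blast)
  qed (use T1 T2 in auto)
qed

lemma beauville_class_Suc_p:
  assumes C: "C = Suc p" shows "\<exists>u v. beauville_structure G u v"
proof -
  obtain q0 q1 q2 where q: "\<not> (int p dvd q0 \<and> int p dvd q1 \<and> int p dvd q2)"
    and bad: "\<And>g s t w. \<lbrakk>dir g s t; \<not> (p dvd s \<and> p dvd t); g [^] p = \<Phi> w; w \<in> K (C - 2)\<rbrakk>
       \<Longrightarrow> int p dvd q0 * (int s * int s) + q1 * (int s * int t) + q2 * (int t * int t)"
    using bad_directions_quadratic[OF C] by metis
  define Q where "Q = (\<lambda>v. q0 * (int (fst v) * int (fst v)) + q1 * (int (fst v) * int (snd v)) + q2 * (int (snd v) * int (snd v)))"
  let ?B = "{v \<in> proj_line p. int p dvd Q v}"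
  have "card ?B \<le> 2"
    by (rule card_form_roots[OF prime_p, of "[:q0, q1, q2:]"])
       (use q in \<open>auto simp: Q_def const_dvd_pCons algebra_simps numeral_2_eq_2\<close>)
  moreover have "w \<notin> K (C - 2)"
    if v: "v \<in> proj_line p" "v \<notin> ?B" and l: "\<not> p dvd l" and g: "dir g (l * fst v) (l * snd v)" "g [^] p = \<Phi> w" for v l g w
  proof
    assume "w \<in> K (C - 2)"
    from bad[OF g(1) proj_line_nonzero[OF v(1) l] g(2) this]
    have "int p dvd (int l * int l) * Q v" by (simp add: Q_def algebra_simps)
    moreover have "\<not> int p dvd int l * int l" using l by (intro not_dvd_mult) simp_all
    ultimately have "int p dvd Q v" by (rule prime_dvd_cancel)
    then show False using v by blast
  qed
  ultimately show ?thesis by (intro beauville_of_few_bad_lines[of ?B]) auto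
qed

lemma beauville_class_p_noncentral:
  assumes C: "C = p" and "of_nat p \<notin> I" shows "\<exists>u v. beauville_structure G u v"
proof (rule beauville_of_few_bad_lines[of "{}"])
  fix v l g w assume v: "v \<in> proj_line p" and l: "\<not> p dvd l"
    and g: "dir g (l * fst v) (l * snd v)" and w: "g [^] p = \<Phi> w"
  show "w \<notin> K (C - 2)"
    using power_top_iff_class_p[OF C g proj_line_nonzero[OF v l] w] assms(2) by simp
qed simp_all

text \<open>Modulo the last term, x^p and y^p span the last but one; c^p generates the last
  term.\<close>

lemma power_subgroup_noncentral:
  assumes C: "C = p" and pI: "of_nat p \<notin> I"
  shows "power_subgroup G p = lower_central G (p - 1)"
proof -
  have nt: "\<not> top2" using top2_imp pI by blast
  have L: "lower_central G (p - 1) = \<Phi> ` K (C - 3)"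
    using phi_image_K[of "C - 3"] C p5 by (simp add: numeral_3_eq_3 Suc_diff_Suc)
  have pK: "of_nat p \<in> K (C - 2)"
    using p_mult_K1[OF U_in_K] p_mult_K1[OF V_in_K] by (intro joint_kernel) (auto simp: mult.commute)
  have K23: "f \<in> K (C - 2) \<Longrightarrow> f \<in> K (C - 3)" for f by (erule K_antimono[rotated]) auto
  have P: "subgroup (power_subgroup G p) G" unfolding power_subgroup_def by (rule generate_is_subgroup) auto
  have powP: "g [^] p \<in> power_subgroup G p" if "g \<in> carrier G" for g
    unfolding power_subgroup_def using that by (auto intro: generate.incl)
  show ?thesis
  proof
    show "power_subgroup G p \<subseteq> lower_central G (p - 1)"
      unfolding power_subgroup_def
    proof (rule generate_subgroup_incl[OF _ lower_central_subgroup], safe)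
      fix g assume g: "g \<in> carrier G"
      obtain s t where st: "dir g s t" using dir_exists[OF g] by blast
      show "g [^] p \<in> lower_central G (p - 1)"
      proof (cases "p dvd s \<and> p dvd t")
        case True
        then obtain f where "g = \<Phi> f" using dir_in_M_iff[OF st] range_phi_M by blast
        then have "g [^] p = \<Phi> (of_nat p * f)" by (simp add: phi_of_nat)
        then show ?thesis unfolding L using K23[OF K_mult_right[OF pK]] by simp
      next
        case False
        obtain w where w: "g [^] p = \<Phi> w" using pow_p_phi[OF g] by blast
        then show ?thesis unfolding L using power_in_K_top(1)[OF st False w] by simp
      qed
    qed
    show "lower_central G (p - 1) \<subseteq> power_subgroup G p"
    proof
      fix u assume "u \<in> lower_central G (p - 1)"
      then obtain f where f: "u = \<Phi> f" "f \<in> K (C - 3)" unfolding L by auto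
      obtain z where z: "z \<in> K (C - 2)" "\<And>n. of_int n * z \<in> I \<longleftrightarrow> int p dvd n"
        and gz: "\<And>h. h \<in> K (C - 2) \<Longrightarrow> \<exists>n. h - of_int n * z \<in> I"
        using top1_generator[OF nt] rep_top_exists by metis
      obtain wx where wx: "x [^] p = \<Phi> wx" using pow_p_phi[OF x_closed] by blast
      obtain wy where wy: "y [^] p = \<Phi> wy" using pow_p_phi[OF y_closed] by blast
      have nz: "\<not> (p dvd Suc 0 \<and> p dvd 0)" "\<not> (p dvd 0 \<and> p dvd Suc 0)" using p_gt_1 by auto
      have kx: "wx \<in> K (C - 3)" "wx \<notin> K (C - 2)"
        using power_in_K_top(1)[OF dir_x nz(1) wx] power_top_iff_class_p[OF C dir_x nz(1) wx] pI by auto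
      have ky: "wy \<in> K (C - 3)" "wy \<notin> K (C - 2)"
        using power_in_K_top(1)[OF dir_y nz(2) wy] power_top_iff_class_p[OF C dir_y nz(2) wy] pI by auto
      have Uwx: "U * wx \<in> I" and Vwy: "V * wy \<in> I"
        using power_kernel[OF acts_x1 wx] power_kernel[OF acts_y1 wy] by auto
      have S: "Suc (C - 3) = C - 2" using C_ge by simp
      \<comment> \<open>The last term has order p, so every value of \<open>W\<close> there is a
        multiple of a given nonzero one.\<close>
      have solve: "\<exists>k. W * h - of_int k * (W * w) \<in> I"
        if W: "W \<in> K (Suc 0)" and w: "w \<in> K (C - 3)" "W * w \<notin> I" and h: "h \<in> K (C - 3)" for W w h
      proof -
        obtain m where m: "W * w - of_int m * z \<in> I" using gz K_mult_add[OF W w(1)] S by auto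
        obtain n where n: "W * h - of_int n * z \<in> I" using gz K_mult_add[OF W h] S by auto
        have pm: "\<not> int p dvd m"
        proof
          assume "int p dvd m"
          then have "of_int m * z \<in> I" using z by blast
          from I_add[OF m this] show False using w by simp
        qed
        obtain k where k: "int p dvd m * int k - n" using exists_mod_solution[OF prime_p pm] .
        have "W * h - of_int (int k) * (W * w) =
            (W * h - of_int n * z) - of_int (int k) * (W * w - of_int m * z) - of_int (m * int k - n) * z"
          by (simp add: algebra_simps)
        also have "\<dots> \<in> I" by (intro I_diff n I_mult[OF m] iffD2[OF z(2) k])
        finally show ?thesis by blast
      qed
      have Vwx: "V * wx \<notin> I" using joint_kernel[OF Uwx] kx by blast
      have Uwy: "U * wy \<notin> I" using joint_kernel[OF _ Vwy] ky by blast
      obtain k where k: "V * f - of_int k * (V * wx) \<in> I" using solve[OF V_in_K kx(1) Vwx f(2)] by blast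
      obtain l where l: "U * f - of_int l * (U * wy) \<in> I" using solve[OF U_in_K ky(1) Uwy f(2)] by blast
      \<comment> \<open>\<open>U\<close> kills \<open>wx\<close> and \<open>V\<close> kills
        \<open>wy\<close>, so the two coefficients are adjusted separately and both operators kill
        the rest.\<close>
      define r where "r = f - of_int k * wx - of_int l * wy"
      have "U * r = (U * f - of_int l * (U * wy)) - of_int k * (U * wx)" by (simp add: r_def algebra_simps)
      also have "\<dots> \<in> I" by (intro I_diff l I_mult[OF Uwx])
      finally have Ur: "U * r \<in> I" .
      have "V * r = (V * f - of_int k * (V * wx)) - of_int l * (V * wy)" by (simp add: r_def algebra_simps)
      also have "\<dots> \<in> I" by (intro I_diff k I_mult[OF Vwy])
      finally have Vr: "V * r \<in> I" .
      have rK: "r \<in> K (C - 2)" using joint_kernel[OF Ur Vr] .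
      \<comment> \<open>c^p is a nontrivial element of the last term and absorbs the rest.\<close>
      obtain m where m: "of_nat p - of_int m * z \<in> I" using gz[OF pK] by blast
      have pm: "\<not> int p dvd m"
      proof
        assume "int p dvd m"
        then have "of_int m * z \<in> I" using z by blast
        from I_add[OF m this] show False using pI by simp
      qed
      obtain n where n: "r - of_int n * z \<in> I" using gz[OF rK] by blast
      obtain j where j: "int p dvd m * int j - n" using exists_mod_solution[OF prime_p pm] .
      have "f - (of_int k * wx + of_int l * wy + of_int (int j) * of_nat p) =
          (r - of_int n * z) - of_int (int j) * (of_nat p - of_int m * z) - of_int (m * int j - n) * z"
        by (simp add: r_def algebra_simps)
      also have "\<dots> \<in> I" by (intro I_diff n I_mult[OF m] iffD2[OF z(2) j])
      finally have "u = \<Phi> (of_int k * wx) \<otimes> \<Phi> (of_int l * wy) \<otimes> \<Phi> (of_nat p * of_nat j)"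
        using f by (simp add: phi_eq_iff I_def mult.commute flip: phi_add)
      also have "\<dots> = (x [^] p) [^] k \<otimes> (y [^] p) [^] l \<otimes> \<Phi> (of_nat j) [^] p"
        unfolding phi_of_int phi_of_nat wx wy ..
      finally show "u \<in> power_subgroup G p"
        using powP[OF x_closed] powP[OF y_closed] powP[OF phi_closed]
        by (simp add: subgroup.m_closed[OF P] subgroup_int_pow_closed[OF P])
    qed
  qed
qed

end

section \<open>Class p with all p-th powers in the last term\<close>

context thin_normalized
begin

lemma central_cubic:
  assumes C: "C = p" and pI: "of_nat p \<in> I"
  obtains a1 a2 b1 b2 where
    "\<And>g s t w. \<lbrakk>dir g s t; g [^] p = \<Phi> w\<rbrakk> \<Longrightarrow>
      rep (C - 3) (of_int (int t * int t - d * (int s * int s)) * w)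
        (cub1 d a1 b1 (int s) (int t)) (cub2 d a2 b2 (int s) (int t))"
proof -
  obtain wx where wx: "x [^] p = \<Phi> wx" using pow_p_phi[OF x_closed] by blast
  obtain wy where wy: "y [^] p = \<Phi> wy" using pow_p_phi[OF y_closed] by blast
  have nz: "\<not> (p dvd Suc 0 \<and> p dvd 0)" "\<not> (p dvd 0 \<and> p dvd Suc 0)" using p_gt_1 by auto
  have "wx \<in> K (C - 2)" "wy \<in> K (C - 2)"
    using power_top_iff_class_p[OF C dir_x nz(1) wx] power_top_iff_class_p[OF C dir_y nz(2) wy] pI by simp_all
  then obtain a1 a2 b1 b2 where r: "rep (C - 3) wx a1 a2" "rep (C - 3) wy b1 b2" using rep_top_exists by metis
  show ?thesis
  proof (rule that)
    fix g s t w assume "dir g s t" "g [^] p = \<Phi> w"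
    from power_cubic[OF C pI wx wy r this]
    show "rep (C - 3) (of_int (int t * int t - d * (int s * int s)) * w)
        (cub1 d a1 b1 (int s) (int t)) (cub2 d a2 b2 (int s) (int t))"
      unfolding cub1_def cub2_def by (simp only: of_nat_mult of_nat_numeral)
  qed
qed

text \<open>The functional gives the norm times a linear form plus terms in s^2 t and s t^2. If it
  vanished, its coefficients at s^3 and t^3 would kill the linear form, and the extra terms would
  force e1 = e2 = 0 modulo p.\<close>

lemma card_cubic_roots:
  assumes e: "\<not> (int p dvd e1 \<and> int p dvd e2)"
  shows "card {v \<in> proj_line p. int p dvd cub1 d a1 b1 (int (fst v)) (int (snd v)) * e1
           + cub2 d a2 b2 (int (fst v)) (int (snd v)) * e2} \<le> 3"
proof -
  define \<alpha> where "\<alpha> = a1 * e1 + a2 * e2"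
  define \<beta> where "\<beta> = b1 * e1 + b2 * e2"
  let ?f = "[:- d * \<alpha>, - d * \<beta> + 2 * e2, \<alpha> - 2 * e1, \<beta>:]"
  show ?thesis
  proof (rule card_form_roots[OF prime_p, of ?f])
    show "\<not> [:int p:] dvd ?f"
    proof
      assume "[:int p:] dvd ?f"
      then have *: "int p dvd - d * \<alpha>" "int p dvd - d * \<beta> + 2 * e2" "int p dvd \<alpha> - 2 * e1" "int p dvd \<beta>"
        unfolding const_dvd_pCons by auto
      have "int p dvd d * \<alpha>" using *(1) by simp
      then have \<alpha>: "int p dvd \<alpha>" by (rule prime_dvd_cancel[OF _ not_dvd_d])
      have "int p dvd \<alpha> - (\<alpha> - 2 * e1)" by (rule dvd_diff[OF \<alpha> *(3)])
      then have "int p dvd 2 * e1" by simp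
      then have 1: "int p dvd e1" by (rule prime_dvd_cancel[OF _ not_dvd_2])
      have "int p dvd (- d * \<beta> + 2 * e2) + d * \<beta>" by (rule dvd_add[OF *(2) dvd_mult[OF *(4)]])
      then have "int p dvd 2 * e2" by simp
      then have "int p dvd e2" by (rule prime_dvd_cancel[OF _ not_dvd_2])
      then show False using 1 e by blast
    qed
    fix i assume "int p dvd cub1 d a1 b1 (int (fst (1::nat, i))) (int (snd (1::nat, i))) * e1
           + cub2 d a2 b2 (int (fst (1::nat, i))) (int (snd (1::nat, i))) * e2"
    then show "int p dvd poly ?f (int i)"
      by (simp add: cub1_def cub2_def \<alpha>_def \<beta>_def algebra_simps)
  next
    assume "int p dvd cub1 d a1 b1 (int (fst (0::nat, 1::nat))) (int (snd (0::nat, 1::nat))) * e1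
           + cub2 d a2 b2 (int (fst (0::nat, 1::nat))) (int (snd (0::nat, 1::nat))) * e2"
    then show "int p dvd coeff ?f 3"
      by (simp add: cub1_def cub2_def \<beta>_def numeral_3_eq_3)
  qed simp
qed

lemma lower_central_top: "lower_central G C = \<Phi> ` K (C - 2)"
  using phi_image_K[of "C - 2"] C_ge by (simp add: Suc_diff_Suc numeral_2_eq_2)

lemma power_in_top:
  assumes C: "C = p" and pI: "of_nat p \<in> I" and g: "g \<in> carrier G"
  shows "g [^] p \<in> lower_central G p"
proof -
  obtain s t where st: "dir g s t" using dir_exists[OF g] by blast
  show ?thesis
  proof (cases "p dvd s \<and> p dvd t")
    case True
    then obtain f where "g = \<Phi> f" using dir_in_M_iff[OF st] range_phi_M by blast
    then have "g [^] p = \<Phi> (of_nat p * f)" by (simp add: phi_of_nat)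
    moreover have "f * of_nat p \<in> I" by (rule I_mult[OF pI])
    ultimately have "g [^] p = \<one>" by (simp add: I_def mult.commute)
    then show ?thesis using subgroup.one_closed[OF lower_central_subgroup] by simp
  next
    case False
    obtain w where w: "g [^] p = \<Phi> w" using pow_p_phi[OF g] by blast
    then have "w \<in> K (C - 2)" using power_top_iff_class_p[OF C st False w] pI by simp
    then show ?thesis using w lower_central_top C by auto
  qed
qed

text \<open>Otherwise the functional of the last term would vanish in all p + 1 directions, more
  than three.\<close>

lemma exists_nontrivial_power:
  assumes C: "C = p" and pI: "of_nat p \<in> I" and nt: "\<not> top2"
  shows "\<exists>g\<in>carrier G. g [^] p \<noteq> \<one>"
proof (rule ccontr)
  assume neg: "\<not> ?thesis"
  obtain a1 a2 b1 b2 where cub: "\<And>g s t w. \<lbrakk>dir g s t; g [^] p = \<Phi> w\<rbrakk> \<Longrightarrow>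
      rep (C - 3) (of_int (int t * int t - d * (int s * int s)) * w)
        (cub1 d a1 b1 (int s) (int t)) (cub2 d a2 b2 (int s) (int t))"
    using central_cubic[OF C pI] by metis
  obtain z e1 e2 where e: "\<not> (int p dvd e1 \<and> int p dvd e2)"
    and z: "\<And>n. of_int n * z \<in> I \<longleftrightarrow> int p dvd n"
    and rz: "\<And>f \<alpha> \<beta>. rep (C - 3) f \<alpha> \<beta> \<Longrightarrow> f - of_int (\<alpha> * e1 + \<beta> * e2) * z \<in> I"
    using top1_generator[OF nt] by metis
  have "int p dvd cub1 d a1 b1 (int s) (int t) * e1 + cub2 d a2 b2 (int s) (int t) * e2" for s t
  proof -
    have "(x [^] s \<otimes> y [^] t) [^] p = \<Phi> 0" using neg by simp
    from I_minus[OF rz[OF cub[OF dir_xy this]]]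
    have "of_int (cub1 d a1 b1 (int s) (int t) * e1 + cub2 d a2 b2 (int s) (int t) * e2) * z \<in> I"
      by (simp only: mult_zero_right diff_0 minus_minus)
    then show ?thesis using z by blast
  qed
  then have "{v \<in> proj_line p. int p dvd cub1 d a1 b1 (int (fst v)) (int (snd v)) * e1
           + cub2 d a2 b2 (int (fst v)) (int (snd v)) * e2} = proj_line p" by blast
  then have "card (proj_line p) \<le> 3" using card_cubic_roots[OF e, of a1 b1 a2 b2] by simp
  then show False using card_proj_line_ge by simp
qed

lemma subgroup_of_top:
  assumes C: "C = p" and nt: "\<not> top2" and H: "subgroup H G" "H \<subseteq> lower_central G p" "H \<noteq> {\<one>}"
  shows "H = lower_central G p"
proof -
  have "{\<one>} \<subset> H" using subgroup.one_closed[OF H(1)] H(3) by blast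
  then have "p * card {\<one>} \<le> card H" using card_proper_subgroup[OF triv_subgroup H(1)] by blast
  moreover have "card (lower_central G p) = p" using card_top nt C by simp
  ultimately show ?thesis using H finite_sub[OF lower_central_subgroup] by (intro card_seteq) auto
qed

lemma power_subgroup_central:
  assumes C: "C = p" and pI: "of_nat p \<in> I" and nt: "\<not> top2"
  shows "power_subgroup G p = lower_central G p"
proof (rule subgroup_of_top[OF C nt])
  show "subgroup (power_subgroup G p) G" unfolding power_subgroup_def by (rule generate_is_subgroup) auto
  show "power_subgroup G p \<subseteq> lower_central G p"
    unfolding power_subgroup_def using power_in_top[OF C pI]
    by (intro generate_subgroup_incl[OF _ lower_central_subgroup]) auto
  obtain g where "g \<in> carrier G" "g [^] p \<noteq> \<one>" using exists_nontrivial_power[OF assms] by blast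
  moreover from this have "g [^] p \<in> power_subgroup G p"
    unfolding power_subgroup_def by (auto intro: generate.incl)
  ultimately show "power_subgroup G p \<noteq> {\<one>}" by auto
qed

text \<open>Modulo M, elements of one line are powers of each other.\<close>

lemma line_in_max_over:
  assumes g: "on_line v g" and h: "on_line v h" shows "h \<in> max_over g"
proof -
  obtain l where l: "\<not> p dvd l" "dir g (l * fst v) (l * snd v)" using g by (auto simp: on_line_def)
  obtain m where m: "dir h (m * fst v) (m * snd v)" using h by (auto simp: on_line_def)
  have gc: "g \<in> carrier G" using on_line_closed[OF g] .
  have "\<not> int p dvd int l" using l by simp
  then obtain k where k: "int p dvd int l * int k - int m" using exists_mod_solution[OF prime_p] by blast
  have kdir: "dir (g [^] k) (m * fst v) (m * snd v)"
  proof (rule dir_change[OF dir_pow[OF l(2)]])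
    have "int (k * (l * fst v)) - int (m * fst v) = (int l * int k - int m) * int (fst v)"
      "int (k * (l * snd v)) - int (m * snd v) = (int l * int k - int m) * int (snd v)"
      by (simp_all add: algebra_simps)
    then show "int p dvd int (k * (l * fst v)) - int (m * fst v)" "int p dvd int (k * (l * snd v)) - int (m * snd v)"
      using k by (simp_all only: dvd_mult2)
  qed
  obtain f where f: "g [^] k = \<Phi> f \<otimes> (x [^] (m * fst v) \<otimes> y [^] (m * snd v))" using kdir by (auto simp: dir_def)
  obtain f' where f': "h = \<Phi> f' \<otimes> (x [^] (m * fst v) \<otimes> y [^] (m * snd v))" using m by (auto simp: dir_def)
  have "h = \<Phi> f' \<otimes> (inv (\<Phi> f) \<otimes> g [^] k)" unfolding f f' by simp
  moreover note N = max_over_subgroup[OF gc]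
  have "g [^] k \<in> max_over g" using subgroup_int_pow_closed[OF N max_over_mem(1), of "int k"] by (simp add: int_pow_int)
  moreover have "\<Phi> f \<in> max_over g" "\<Phi> f' \<in> max_over g" using max_over_mem(2) phi_in_M by blast+
  ultimately show ?thesis using subgroup.m_closed[OF N] subgroup.m_inv_closed[OF N] by simp
qed

abbreviation exponent_p_maximals :: "'a set set" where
  "exponent_p_maximals \<equiv> {N. maximal_subgroup N G \<and> group_exponent (G\<lparr>carrier := N\<rparr>) = p}"

lemma finite_maximals: "finite exponent_p_maximals"
proof (rule finite_subset[of _ "Pow (carrier G)"])
  show "exponent_p_maximals \<subseteq> Pow (carrier G)" using subgroup.subset by (fastforce simp: maximal_subgroup_def)
qed (simp add: fin)

text \<open>Different maximal subgroups of exponent p give different directions, all with trivial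
  p-th powers. Three of them form a triple separated from any other.\<close>

lemma beauville_of_exponent_p_maximals:
  assumes C: "C = p" and pI: "of_nat p \<in> I" and three: "card exponent_p_maximals \<ge> 3"
  shows "\<exists>u v. beauville_structure G u v"
proof -
  let ?S = exponent_p_maximals
  have "\<exists>v. v \<in> proj_line p \<and> (\<exists>g\<in>N. g \<notin> M \<and> on_line v g)" if N: "N \<in> ?S" for N
  proof -
    obtain g where "g \<in> N" "g \<in> carrier G" "g \<notin> M" using maximal_subgroup_cases(1)[of N] N by blast
    then show ?thesis using exists_line by blast
  qed
  then have "\<forall>N\<in>?S. \<exists>v. v \<in> proj_line p \<and> (\<exists>g\<in>N. g \<notin> M \<and> on_line v g)" by (rule ballI)
  from bchoice[OF this] obtain \<phi> where
    "\<forall>N\<in>?S. \<phi> N \<in> proj_line p \<and> (\<exists>g\<in>N. g \<notin> M \<and> on_line (\<phi> N) g)" by (rule exE)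
  then have \<phi>: "\<phi> N \<in> proj_line p \<and> (\<exists>g\<in>N. g \<notin> M \<and> on_line (\<phi> N) g)" if "N \<in> ?S" for N
    using that by (rule bspec)
  have mem: "h \<in> N" if N: "N \<in> ?S" and h: "on_line (\<phi> N) h" for N h
  proof -
    obtain g where g: "g \<in> N" "g \<notin> M" "on_line (\<phi> N) g" using \<phi>[OF N] by blast
    have "max_over g = N" using maximal_subgroup_cases(2) N g by blast
    then show ?thesis using line_in_max_over[OF g(3) h] by simp
  qed
  let ?T = "{v \<in> proj_line p. \<forall>h. on_line v h \<longrightarrow> h [^] p = \<one>}"
  have "inj_on \<phi> ?S"
  proof (rule inj_onI)
    fix N N' assume NN: "N \<in> ?S" "N' \<in> ?S" "\<phi> N = \<phi> N'"
    obtain g where g: "g \<in> N'" "g \<notin> M" "on_line (\<phi> N') g" using \<phi>[OF NN(2)] by blast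
    then have "g \<in> N" using mem[OF NN(1)] NN(3) by simp
    then have "max_over g = N" using maximal_subgroup_cases(2) NN g by blast
    moreover have "max_over g = N'" using maximal_subgroup_cases(2) NN g by blast
    ultimately show "N = N'" by simp
  qed
  moreover have "\<phi> ` ?S \<subseteq> ?T"
  proof (rule image_subsetI)
    fix N assume N: "N \<in> ?S"
    have sg: "subgroup N G" using N by (simp add: maximal_subgroup_def)
    have "\<forall>u\<in>N. u [^] p = \<one>" using exponent_p_iff[OF sg] N by simp
    then show "\<phi> N \<in> ?T" using mem[OF N] \<phi>[OF N] by blast
  qed
  ultimately have "card ?S \<le> card ?T" by (intro card_inj_on_le[of \<phi>]) auto
  then have "card ?T \<ge> 3" using three by simp
  then obtain T1 where T1: "T1 \<subseteq> ?T" "card T1 = 3" by (rule obtain_subset_with_card_n)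
  have "card (proj_line p - T1) \<ge> 3"
    using card_proj_line_ge T1 finite_subset[of T1 "proj_line p"] by (subst card_Diff_subset) auto
  then obtain T2 where T2: "T2 \<subseteq> proj_line p - T1" "card T2 = 3" by (rule obtain_subset_with_card_n)
  show ?thesis
  proof (rule beauville_of_lines[of T1 T2])
    fix v w g h assume "v \<in> T1" "w \<in> T2" "on_line v g" "on_line w h"
    then have "g [^] p = \<one>" using T1 by blast
    then have "u \<otimes> (g [^] p) [^] k \<otimes> inv u = \<one>" if "u \<in> carrier G" for u and k :: nat using that by simp
    then show "pow_sep p g h" unfolding pow_sep_def by blast
  qed (use T1 T2 in auto)
qed

text \<open>Nontrivial p-th powers all generate the same group of order p, so one of the two triples
  has only trivial ones. Its members lie in three different maximal subgroups.\<close>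

lemma exponent_p_maximals_of_beauville:
  assumes C: "C = p" and pI: "of_nat p \<in> I" and nt: "\<not> top2" and B: "beauville_structure G u v"
  shows "card exponent_p_maximals \<ge> 3"
proof -
  obtain g h g' h' where uv: "u = (g, h)" "v = (g', h')" by (cases u, cases v)
  have gc: "g \<in> carrier G" "h \<in> carrier G" "g' \<in> carrier G" "h' \<in> carrier G"
    and gen1: "generate G {g, h} = carrier G" and gen2: "generate G {g', h'} = carrier G"
    and disj: "beauville_Sigma G g h \<inter> beauville_Sigma G g' h' = {\<one>}"
    using B by (auto simp: uv beauville_structure_def)
  have sig: "q [^] (k::int) \<in> beauville_Sigma G a b" if "q \<in> {a, b, a \<otimes> b}" "a \<in> carrier G" "b \<in> carrier G" for q k a b
  proof -
    have qc: "q \<in> carrier G" using that by auto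
    have "q [^] k \<in> conj_set G (generate G {q}) \<one>"
      unfolding conj_set_def generate_pow[OF qc] by (rule image_eqI[of _ _ "q [^] k"]) (use qc in auto)
    then show ?thesis using that unfolding beauville_Sigma_def by blast
  qed
  have "(\<forall>q\<in>{g, h, g \<otimes> h}. q [^] p = \<one>) \<or> (\<forall>q\<in>{g', h', g' \<otimes> h'}. q [^] p = \<one>)"
  proof (rule ccontr)
    assume "\<not> ?thesis"
    then obtain q q' where q: "q \<in> {g, h, g \<otimes> h}" "q [^] p \<noteq> \<one>" and q': "q' \<in> {g', h', g' \<otimes> h'}" "q' [^] p \<noteq> \<one>" by blast
    have qc: "q \<in> carrier G" "q' \<in> carrier G" using q(1) q'(1) gc by auto
    have "generate G {q' [^] p} = lower_central G p"
    proof (rule subgroup_of_top[OF C nt])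
      show "subgroup (generate G {q' [^] p}) G" using qc by (intro generate_is_subgroup) auto
      show "generate G {q' [^] p} \<subseteq> lower_central G p"
        using power_in_top[OF C pI qc(2)] by (intro generate_subgroup_incl[OF _ lower_central_subgroup]) auto
      have "q' [^] p \<in> generate G {q' [^] p}" by (auto intro: generate.incl)
      then show "generate G {q' [^] p} \<noteq> {\<one>}" using q' by auto
    qed
    then have "q [^] p \<in> generate G {q' [^] p}" using power_in_top[OF C pI qc(1)] by simp
    then obtain k :: int where "q [^] p = (q' [^] p) [^] k" using generate_pow[of "q' [^] p"] qc by auto
    then have "q [^] p = q' [^] (int p * k)" using qc by (simp add: int_pow_pow int_pow_int[symmetric])
    then have "q [^] p \<in> beauville_Sigma G g' h'" using sig[OF q'(1) gc(3,4)] by simp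
    moreover have "q [^] p \<in> beauville_Sigma G g h" using sig[OF q(1) gc(1,2), of "int p"] by (simp add: int_pow_int)
    ultimately show False using disj q(2) by blast
  qed
  then obtain a b where ab: "a \<in> carrier G" "b \<in> carrier G" "generate G {a, b} = carrier G"
    and pow: "\<And>q. q \<in> {a, b, a \<otimes> b} \<Longrightarrow> q [^] p = \<one>"
    using gc gen1 gen2 by metis
  have abc: "a \<otimes> b \<in> carrier G" using ab by simp
  have two: "\<not> (a \<in> max_over q \<and> b \<in> max_over q)" if q: "q \<in> carrier G" for q
  proof
    assume "a \<in> max_over q \<and> b \<in> max_over q"
    then have "carrier G \<subseteq> max_over q" by (intro generated_subset[OF ab(3) max_over_subgroup[OF q]]) auto
    then show False using not_cyclic_mod_M[OF q] subgroup.subset[OF max_over_subgroup[OF q]] by blast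
  qed
  have a1: "a \<in> max_over q" if q: "q \<in> carrier G" and "b \<in> max_over q" "a \<otimes> b \<in> max_over q" for q
  proof -
    have "a \<otimes> b \<otimes> inv b \<in> max_over q"
      using that subgroup.m_closed[OF max_over_subgroup[OF q]] subgroup.m_inv_closed[OF max_over_subgroup[OF q]] by blast
    then show ?thesis using ab by (simp add: m_assoc)
  qed
  have b1: "b \<in> max_over q" if q: "q \<in> carrier G" and "a \<in> max_over q" "a \<otimes> b \<in> max_over q" for q
  proof -
    have "inv a \<otimes> (a \<otimes> b) \<in> max_over q"
      using that subgroup.m_closed[OF max_over_subgroup[OF q]] subgroup.m_inv_closed[OF max_over_subgroup[OF q]] by blast
    then show ?thesis using ab by simp
  qed
  have notM: "a \<notin> M" "b \<notin> M" "a \<otimes> b \<notin> M"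
    using two[OF ab(1)] two[OF ab(2)] b1[OF ab(1)] max_over_mem by blast+
  have mem: "max_over q \<in> exponent_p_maximals" if q: "q \<in> carrier G" "q \<notin> M" "q [^] p = \<one>" for q
  proof -
    note N = max_over_subgroup[OF q(1)]
    \<comment> \<open>p-th powers are constant on cosets of M, so powers of \<open>q\<close> are
      enough.\<close>
    have "r [^] p = \<one>" if r: "r \<in> max_over q" for r
    proof -
      have "max_over q \<subseteq> {k \<otimes> n |k n. k \<in> generate G {q} \<and> n \<in> M}"
      proof (rule generate_subgroup_incl)
        show "subgroup {k \<otimes> n |k n. k \<in> generate G {q} \<and> n \<in> M} G"
          using q by (intro subgroup_mult_normal[OF generate_is_subgroup M_normal]) auto
        have "q = q \<otimes> \<one>" "q \<in> generate G {q}" using q by (auto intro: generate.incl)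
        moreover have "m = \<one> \<otimes> m" if "m \<in> M" for m using that M_carrier by simp
        ultimately show "insert q M \<subseteq> {k \<otimes> n |k n. k \<in> generate G {q} \<and> n \<in> M}"
          using subgroup.one_closed[OF M_subgroup] generate.one[of G "{q}"] by blast
      qed
      then obtain k n where kn: "r = k \<otimes> n" "k \<in> generate G {q}" "n \<in> M" using r by blast
      obtain j :: nat where j: "k = q [^] j" using kn generate_pow_on_finite_carrier[OF fin q(1)] by auto
      obtain f where f: "n = \<Phi> f" using kn range_phi_M by blast
      obtain f' where "r = \<Phi> f' \<otimes> q [^] j" using phi_swap[of "q [^] j" f] kn j f q by auto
      then have "r [^] p = (q [^] j) [^] p" using power_mod_derived[OF C pI] q by simp
      also have "\<dots> = (q [^] p) [^] j" using q(1) by (simp add: nat_pow_pow mult.commute)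
      finally show ?thesis using q by simp
    qed
    moreover have "max_over q \<noteq> {\<one>}"
      using q(2) max_over_mem(1)[of q] subgroup.one_closed[OF M_subgroup] by auto
    ultimately show ?thesis using exponent_p_iff[OF N] max_over_maximal[OF q(1,2)] by blast
  qed
  have "{max_over a, max_over b, max_over (a \<otimes> b)} \<subseteq> exponent_p_maximals"
    using mem[OF ab(1) notM(1) pow] mem[OF ab(2) notM(2) pow] mem[OF abc notM(3) pow] by simp
  moreover have "max_over a \<noteq> max_over b" "max_over a \<noteq> max_over (a \<otimes> b)" "max_over b \<noteq> max_over (a \<otimes> b)"
  proof -
    show "max_over a \<noteq> max_over b" using two[OF ab(1)] max_over_mem(1) by metis
    show "max_over a \<noteq> max_over (a \<otimes> b)" using two[OF ab(1)] b1[OF ab(1)] max_over_mem(1) by metis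
    show "max_over b \<noteq> max_over (a \<otimes> b)" using two[OF ab(2)] a1[OF ab(2)] max_over_mem(1) by metis
  qed
  then have c3: "card {max_over a, max_over b, max_over (a \<otimes> b)} = 3" by simp
  ultimately have "card {max_over a, max_over b, max_over (a \<otimes> b)} \<le> card exponent_p_maximals"
    by (intro card_mono[OF finite_maximals])
  then show ?thesis unfolding c3 .
qed

text \<open>Up to a factor prime to p, the coordinates of g^p are the value of the cubic pair at the
  direction of g; so separation reduces to a vanishing or non-proportional value.\<close>

lemma beauville_top2:
  assumes top2 shows "\<exists>u v. beauville_structure G u v"
proof -
  have C: "C = p" and pI: "of_nat p \<in> I" using top2_imp[OF assms] by auto
  obtain a1 a2 b1 b2 where cub: "\<And>g s t w. \<lbrakk>dir g s t; g [^] p = \<Phi> w\<rbrakk> \<Longrightarrow>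
      rep (C - 3) (of_int (int t * int t - d * (int s * int s)) * w)
        (cub1 d a1 b1 (int s) (int t)) (cub2 d a2 b2 (int s) (int t))"
    using central_cubic[OF C pI] by metis
  define F1 where "F1 = (\<lambda>v::nat \<times> nat. cub1 d a1 b1 (int (fst v)) (int (snd v)))"
  define F2 where "F2 = (\<lambda>v::nat \<times> nat. cub2 d a2 b2 (int (fst v)) (int (snd v)))"
  define zero where "zero = (\<lambda>v. int p dvd F1 v \<and> int p dvd F2 v)"
  define par where "par = (\<lambda>v w. int p dvd F1 v * F2 w - F2 v * F1 w)"
  have "\<exists>T1 T2. T1 \<subseteq> proj_line p \<and> T2 \<subseteq> proj_line p \<and> card T1 = 3 \<and> card T2 = 3 \<and> T1 \<inter> T2 = {} \<and>
           (\<forall>v\<in>T1. \<forall>w\<in>T2. zero v \<or> zero w \<or> \<not> par v w)"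
  proof (rule choose_separated_triples)
    show "card (proj_line p) \<ge> 6" by (rule card_proj_line_ge)
    show "par v v" for v by (simp add: par_def mult.commute)
    show "par w v" if "par v w" for v w
    proof -
      have "F1 w * F2 v - F2 w * F1 v = - (F1 v * F2 w - F2 v * F1 w)" by simp
      then show ?thesis using that unfolding par_def by (simp only: dvd_minus_iff)
    qed
    show "par v w" if "zero v" for v w
      using that unfolding zero_def par_def by (auto intro!: dvd_diff)
    show "par u w" if nz: "\<not> zero v" and uv: "par u v" and vw: "par v w" for u v w
    proof -
      have "F1 v * (F1 u * F2 w - F2 u * F1 w) =
          F1 u * (F1 v * F2 w - F2 v * F1 w) + F1 w * (F1 u * F2 v - F2 u * F1 v)"
        "F2 v * (F1 u * F2 w - F2 u * F1 w) =
          F2 u * (F1 v * F2 w - F2 v * F1 w) + F2 w * (F1 u * F2 v - F2 u * F1 v)"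
        by (simp_all add: algebra_simps)
      then have "int p dvd F1 v * (F1 u * F2 w - F2 u * F1 w)" "int p dvd F2 v * (F1 u * F2 w - F2 u * F1 w)"
        using uv vw unfolding par_def by (simp_all only: dvd_add dvd_mult)
      then show ?thesis using nz prime_dvd_cancel unfolding zero_def par_def by blast
    qed
    show "card {w \<in> proj_line p. par v w} \<le> 3" if "\<not> zero v" for v
    proof -
      \<comment> \<open>The determinant with the fixed value at \<open>v\<close> is a nonzero
        functional of the cubic pair.\<close>
      have "\<not> (int p dvd - F2 v \<and> int p dvd F1 v)" using that unfolding zero_def by auto
      from card_cubic_roots[OF this, of a1 b1 a2 b2]
      have "card {w \<in> proj_line p. int p dvd F1 w * - F2 v + F2 w * F1 v} \<le> 3" by (simp only: F1_def F2_def)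
      moreover have "F1 w * - F2 v + F2 w * F1 v = F1 v * F2 w - F2 v * F1 w" for w by simp
      ultimately show ?thesis unfolding par_def by (simp only:)
    qed
    show "card (proj_line p) \<ge> 7 \<or> (\<exists>v\<in>proj_line p. card {w \<in> proj_line p. par v w} \<noteq> 2)"
    proof (cases "p = 5")
      case True
      have ne: "d mod 5 \<noteq> u * u mod 5" if "\<not> 5 dvd (1::int)" for u
      proof
        assume "d mod 5 = u * u mod 5"
        then have "int p dvd u * u - d * (1 * 1)" using True by (simp add: mod_eq_dvd_iff dvd_diff_commute)
        then show False using norm_nonzero[of u 1] True by simp
      qed
      \<comment> \<open>The squares modulo 5 are those of 0, 1 and 2.\<close>
      have "d mod 5 \<noteq> 0" "d mod 5 \<noteq> 1" "d mod 5 \<noteq> 4" using ne[of 0] ne[of 1] ne[of 2] by simp_all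
      moreover have "d mod 5 < 5" "d mod 5 \<ge> 0" by simp_all
      ultimately have "d mod 5 \<in> {2, 3}" by auto
      from exists_fibre_not_pair[OF this, of a1 b1 a2 b2] show ?thesis
        using True unfolding par_def F1_def F2_def by simp
    next
      case False
      then show ?thesis using p5 card_proj_line[of p] by simp
    qed
  qed simp
  then obtain T1 T2 where T: "T1 \<subseteq> proj_line p" "T2 \<subseteq> proj_line p" "card T1 = 3" "card T2 = 3" "T1 \<inter> T2 = {}"
    and TT: "\<And>v w. \<lbrakk>v \<in> T1; w \<in> T2\<rbrakk> \<Longrightarrow> zero v \<or> zero w \<or> \<not> par v w" by blast
  show ?thesis
  proof (rule beauville_of_lines[OF T(1,3,2,4,5)])
    fix v w g h assume vw: "v \<in> T1" "w \<in> T2" and g: "on_line v g" and h: "on_line w h"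
    have info: "\<exists>w1 \<alpha> \<beta> D l. g [^] p = \<Phi> w1 \<and> w1 \<in> K (C - 2) \<and> rep (C - 3) w1 \<alpha> \<beta> \<and> \<not> int p dvd D \<and> \<not> int p dvd l \<and>
        int p dvd D * \<alpha> - l * F1 v \<and> int p dvd D * \<beta> - l * F2 v" if v: "v \<in> proj_line p" and g: "on_line v g" for v g
    proof -
      obtain l where l: "\<not> p dvd l" "dir g (l * fst v) (l * snd v)" using g by (auto simp: on_line_def)
      obtain w1 where w1: "g [^] p = \<Phi> w1" using pow_p_phi on_line_closed[OF g] by blast
      note nz = proj_line_nonzero[OF v l(1)]
      have k1: "w1 \<in> K (C - 2)" using power_top_iff_class_p[OF C l(2) nz w1] pI by simp
      then obtain \<alpha> \<beta> where ab: "rep (C - 3) w1 \<alpha> \<beta>" using rep_top_exists by blast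
      define s where "s = int (l * fst v)"
      define t where "t = int (l * snd v)"
      define D where "D = t * t - d * (s * s)"
      have "\<not> (int p dvd t \<and> int p dvd s)" using nz by (auto simp: s_def t_def simp del: of_nat_mult)
      then have D: "\<not> int p dvd D" using norm_nonzero unfolding D_def by blast
      have r: "rep (C - 3) (of_int D * w1) (cub1 d a1 b1 s t) (cub2 d a2 b2 s t)"
        using cub[OF l(2) w1] by (simp only: D_def s_def t_def)
      \<comment> \<open>Two representations of one element differ by a representation of 0, and
        \<open>top2\<close> makes its coordinates divisible by p.\<close>
      have "rep (C - 3) (of_int D * w1 + of_int (- 1) * (of_int D * w1)) (D * \<alpha> + - 1 * cub1 d a1 b1 s t) (D * \<beta> + - 1 * cub2 d a2 b2 s t)"
        by (intro rep_add rep_int ab r)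
      moreover have "of_int D * w1 + of_int (- 1) * (of_int D * w1) \<in> I" by (simp add: I_zero)
      ultimately have "int p dvd D * \<alpha> + - 1 * cub1 d a1 b1 s t \<and> int p dvd D * \<beta> + - 1 * cub2 d a2 b2 s t"
        using assms unfolding top2_def by blast
      then have "int p dvd D * \<alpha> - (int l * (int l * int l)) * F1 v" "int p dvd D * \<beta> - (int l * (int l * int l)) * F2 v"
        by (simp_all add: s_def t_def F1_def F2_def cub_homogeneous)
      moreover have "\<not> int p dvd int l * (int l * int l)" using l by (intro not_dvd_mult) simp_all
      ultimately show ?thesis using w1 k1 ab D by blast
    qed
    obtain w1 \<alpha> \<beta> D l where w1: "g [^] p = \<Phi> w1" "w1 \<in> K (C - 2)" "rep (C - 3) w1 \<alpha> \<beta>" "\<not> int p dvd D" "\<not> int p dvd l"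
      "int p dvd D * \<alpha> - l * F1 v" "int p dvd D * \<beta> - l * F2 v" using info[OF _ g] vw T by blast
    obtain w2 \<alpha>' \<beta>' D' l' where w2: "h [^] p = \<Phi> w2" "w2 \<in> K (C - 2)" "rep (C - 3) w2 \<alpha>' \<beta>'" "\<not> int p dvd D'" "\<not> int p dvd l'"
      "int p dvd D' * \<alpha>' - l' * F1 w" "int p dvd D' * \<beta>' - l' * F2 w" using info[OF _ h] vw T by blast
    have zI: "w1 \<in> I" if "int p dvd f1" "int p dvd f2" "\<not> int p dvd D" "rep (C - 3) w1 \<alpha> \<beta>"
      "int p dvd D * \<alpha> - l * f1" "int p dvd D * \<beta> - l * f2" for w1 f1 f2 D l \<alpha> \<beta>
    proof -
      have "int p dvd (D * \<alpha> - l * f1) + l * f1" "int p dvd (D * \<beta> - l * f2) + l * f2" 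
        by (rule dvd_add[OF that(5) dvd_mult[OF that(1)]], rule dvd_add[OF that(6) dvd_mult[OF that(2)]])
      then have "int p dvd D * \<alpha>" "int p dvd D * \<beta>" by simp_all
      then have "int p dvd \<alpha>" "int p dvd \<beta>" using prime_dvd_cancel that(3) by blast+
      then show ?thesis using top_dvd_I that(4) by blast
    qed
    show "pow_sep p g h"
    proof (rule sep_central[OF w1(1,2) w2(1,2)])
      fix k m :: nat assume eq: "of_nat k * w1 - of_nat m * w2 \<in> I"
      consider "zero v" | "zero w" | "\<not> par v w" using TT vw by blast
      then show "of_nat k * w1 \<in> I"
      proof cases
        case 1
        then show ?thesis using zI[OF _ _ w1(4,3,6,7)] unfolding zero_def by (intro I_mult) blast
      next
        case 2
        then have "w2 \<in> I" using zI[OF _ _ w2(4,3,6,7)] unfolding zero_def by blast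
        from I_add[OF eq I_mult[OF this, of "of_nat m"]] show ?thesis by simp
      next
        case 3
        have "rep (C - 3) (of_int (int k) * w1 + of_int (- int m) * w2) (int k * \<alpha> + - int m * \<alpha>') (int k * \<beta> + - int m * \<beta>')"
          by (intro rep_add rep_int w1 w2)
        moreover have "of_int (int k) * w1 + of_int (- int m) * w2 \<in> I" using eq by simp
        ultimately have 1: "int p dvd int k * \<alpha> + - int m * \<alpha>'" and 2: "int p dvd int k * \<beta> + - int m * \<beta>'"
          using assms unfolding top2_def by blast+
        define \<delta> where "\<delta> = \<alpha> * \<beta>' - \<beta> * \<alpha>'"
        have "int k * \<delta> = (int k * \<alpha> + - int m * \<alpha>') * \<beta>' - (int k * \<beta> + - int m * \<beta>') * \<alpha>'"
          by (simp add: \<delta>_def algebra_simps)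
        then have k\<delta>: "int p dvd int k * \<delta>" using 1 2 by (simp only: dvd_diff dvd_mult2)
        have "\<not> int p dvd \<delta>"
        proof
          assume \<delta>: "int p dvd \<delta>"
          \<comment> \<open>The two determinants agree up to factors prime to p; the corrections
            come from the congruences between coordinates and cubic values.\<close>
          have "l * l' * (F1 v * F2 w - F2 v * F1 w) = D * D' * \<delta>
             - (D * \<alpha> - l * F1 v) * (D' * \<beta>') - l * F1 v * (D' * \<beta>' - l' * F2 w)
             + (D * \<beta> - l * F2 v) * (D' * \<alpha>') + l * F2 v * (D' * \<alpha>' - l' * F1 w)"
            by (simp add: \<delta>_def algebra_simps)
          also have "int p dvd \<dots>"
            by (rule dvd_add[OF dvd_add[OF dvd_diff[OF dvd_diff[OF dvd_mult[OF \<delta>] dvd_mult2[OF w1(6)]] dvd_mult[OF w2(7)]]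
                dvd_mult2[OF w1(7)]] dvd_mult[OF w2(6)]])
          finally have "int p dvd l * l' * (F1 v * F2 w - F2 v * F1 w)" .
          then have "int p dvd F1 v * F2 w - F2 v * F1 w"
            using prime_dvd_cancel not_dvd_mult[OF w1(5) w2(5)] by blast
          then show False using 3 unfolding par_def by blast
        qed
        then have "int p dvd int k" using k\<delta> prime_int_p prime_dvd_mult_iff by blast
        then show ?thesis using p_dvd_I[OF _ K_top_K1[OF w1(2)], of "int k"] by simp
      qed
    qed
  qed
qed

text \<open>Keeps the last two alternatives apart: the subgroup of p-th powers cannot equal both
  terms.\<close>

lemma lower_central_class_p_strict:
  assumes "C = p" shows "lower_central G p \<noteq> lower_central G (p - 1)"
proof
  assume eq: "lower_central G p = lower_central G (p - 1)"
  have "Suc (C - 3) < C" using C_ge by simp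
  then obtain f where f: "f \<in> K (C - 3)" "f \<notin> K (Suc (C - 3))" using K_strict by blast
  have "Suc (Suc (C - 3)) = p - 1" "Suc (Suc (Suc (C - 3))) = p" using assms p5 by auto
  then show False using f eq unfolding K_def by simp
qed

text \<open>In class p with a last term of order p, the subgroup of p-th powers records whether c^p
  is trivial.\<close>

lemma beauville_iff:
  "(\<exists>u v. beauville_structure G u v) \<longleftrightarrow>
     (C = p \<and> card (lower_central G p) = p\<^sup>2) \<or> C = p + 1 \<or>
     (C = p \<and> card (lower_central G p) = p \<and> power_subgroup G p = lower_central G (p - 1)) \<or>
     (C = p \<and> card (lower_central G p) = p \<and> power_subgroup G p = lower_central G p \<and> card exponent_p_maximals \<ge> 3)"
proof (cases "C = p")
  case False
  then have "C = Suc p" using C_cases by blast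
  then show ?thesis using beauville_class_Suc_p by auto
next
  case C: True
  have pp: "p\<^sup>2 \<noteq> p" using p_gt_1 by (simp add: power2_eq_square)
  have card: "card (lower_central G p) = (if top2 then p\<^sup>2 else p)" using card_top C by simp
  show ?thesis
  proof (cases top2)
    case True
    then show ?thesis using beauville_top2[OF True] card C by simp
  next
    case nt: False
    show ?thesis
    proof (cases "of_nat p \<in> I")
      case False
      then show ?thesis
        using beauville_class_p_noncentral[OF C False] power_subgroup_noncentral[OF C False] card nt C by simp
    next
      case pI: True
      have "(\<exists>u v. beauville_structure G u v) \<longleftrightarrow> card exponent_p_maximals \<ge> 3"
        using beauville_of_exponent_p_maximals[OF C pI] exponent_p_maximals_of_beauville[OF C pI nt] by blast
      then show ?thesis
        using power_subgroup_central[OF C pI nt] lower_central_class_p_strict[OF C] card nt C pp by simp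
    qed
  qed
qed

end

theorem theoremA:
  fixes p :: nat and G :: "('a, 'b) monoid_scheme"
  assumes "Factorial_Ring.prime p" and "p \<ge> 5"
    and "thin_p_group p G" and "metabelian G" and "\<not> maximal_class p G"
    and "nilpotency_class G = p \<or> nilpotency_class G = p + 1"
  shows "(\<exists>u v. beauville_structure G u v) \<longleftrightarrow>
     (nilpotency_class G = p \<and> card (lower_central G p) = p\<^sup>2) \<or>
     nilpotency_class G = p + 1 \<or>
     (nilpotency_class G = p \<and> card (lower_central G p) = p \<and>
        power_subgroup G p = lower_central G (p - 1)) \<or>
     (nilpotency_class G = p \<and> card (lower_central G p) = p \<and>
        power_subgroup G p = lower_central G p \<and>
        card {M. maximal_subgroup M G \<and> group_exponent (G\<lparr>carrier := M\<rparr>) = p} \<ge> 3)"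
proof -
  interpret thin_metabelian G p
    using assms by (simp add: thin_metabelian_def thin_metabelian_axioms_def metabelian_def)
  obtain x y where x: "x \<in> carrier G" and y: "y \<in> carrier G" and gen: "generate G {x, y} = carrier G"
    using two_generators by blast
  obtain \<Phi> :: "int poly poly \<Rightarrow> 'a" and a b where \<Phi>:
    "\<And>f g. \<Phi> (f + g) = \<Phi> f \<otimes>\<^bsub>G\<^esub> \<Phi> g" "\<And>f. \<Phi> f \<in> lower_central G 2" "\<Phi> 1 = cmt x y"
    "\<And>f. \<Phi> (a * f) = x \<otimes>\<^bsub>G\<^esub> \<Phi> f \<otimes>\<^bsub>G\<^esub> inv\<^bsub>G\<^esub> x" "\<And>f. \<Phi> (b * f) = y \<otimes>\<^bsub>G\<^esub> \<Phi> f \<otimes>\<^bsub>G\<^esub> inv\<^bsub>G\<^esub> y"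
    "\<And>N r f. \<lbrakk>N \<lhd> G; \<Phi> f \<in> N\<rbrakk> \<Longrightarrow> \<Phi> (r * f) \<in> N"
    "\<And>r. \<exists>n f g. r = of_int n + (a - 1) * f + (b - 1) * g"
    by (rule exists_polynomial_action[OF M_normal _ x y cmt_in_derived[OF x y]])
       (erule (1) M_comm, rule that, assumption+)
  have "metabelian_action G x y \<Phi> a b"
    using x y gen \<Phi> fin_G M_carrier by unfold_locales auto
  then have "thin_action G x y \<Phi> a b p"
    using assms thin_metabelian_axioms by (simp add: thin_action_def thin_action_axioms_def)
  from thin_action.normalize[OF this]
  obtain l d where "thin_normalized G (x \<otimes>\<^bsub>G\<^esub> y [^]\<^bsub>G\<^esub> (l::nat)) y \<Phi> (a * b ^ l) b p d"
    by (elim exE)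
  then interpret N: thin_normalized G "x \<otimes>\<^bsub>G\<^esub> y [^]\<^bsub>G\<^esub> l" y \<Phi> "a * b ^ l" b p d .
  show ?thesis using N.beauville_iff by (simp only: C_def)
qed

end
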